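(* Let $u\colon\mathscr P_2(\mathbb R^d)\to\mathbb R$ be a continuous function (with respect to the $2$-Wasserstein metric $\mathcal W_2$). Then there exists a sequence $\{u_k\}_k$ in $C^\infty(\mathscr P_2(\mathbb R^d))$ such that $$\lim_{k\to\infty}\ \sup_{\mu\in\mathscr M}|u_k(\mu)-u(\mu)|=0$$ for any compact set $\mathscr M\subset\mathscr P_2(\mathbb R^d)$. Moreover, if $u$ is uniformly continuous with modulus of continuity $w$, i.e. $|u(\mu)-u(\nu)|\le w(\mathcal W_2(\mu,\nu))$ for all $\mu,\nu\in\mathscr P_2(\mathbb R^d)$, then every function $u_k$ is also uniformly continuous with the same modulus of continuity $w$, i.e. $|u_k(\mu)-u_k(\nu)|\le w(\mathcal W_2(\mu,\nu))$ for all $\mu,\nu\in\mathscr P_2(\mathbb R^d)$ and all $k$.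
   Context: Let $d\in\mathbb N$. $\mathscr P_2(\mathbb R^d)$ is the set of Borel probability measures $\mu$ on $\mathbb R^d$ with $\int|x|^2\,\mu(dx)<\infty$, endowed with the $2$-Wasserstein metric $\mathcal W_2(\mu,\nu)=\inf_{\pi\in\Pi(\mu,\nu)}\big(\int|x-y|^2\,\pi(dx,dy)\big)^{1/2}$, where $\Pi(\mu,\nu)$ is the set of couplings of $\mu$ and $\nu$ (probabilities on $\mathbb R^d\times\mathbb R^d$ with first marginal $\mu$ and second marginal $\nu$). A modulus of continuity is a function $w\colon[0,\infty)\to[0,\infty)$ that is continuous, non-decreasing, concave, with $w(0)=0$. Probability space. $(\Omega,\mathcal F,\mathbb P)$ is a fixed probability space on which there exists a real-valued random variable with uniform distribution on $[0,1]$. $\mathbb P_\xi$ denotes the law of a random variable $\xi$, and $L^2=L^2(\Omega,\mathcal F,\mathbb P;\mathbb R^d)$. Lions differentiability. The lifting of $u\colon\mathscr P_2(\mathbb R^d)\to\mathbb R$ is $\tilde u\colon L^2\to\mathbb R$, $\tilde u(\xi)=u(\mathbb P_\xi)$. Suppose that $\tilde u$ is everywhere Fréchet differentiable and that its gradient $D\tilde u\colon L^2\to L^2$ is continuous. Then there is at most one map $\partial_\mu u\colon\mathscr P_2(\mathbb R^d)\times\mathbb R^d\to\mathbb R^d$, $(\mu,x)\mapsto\partial_\mu u(\mu)(x)$, which is continuous on $\mathscr P_2(\mathbb R^d)\times\mathbb R^d$ and satisfies $D\tilde u(\xi)=\partial_\mu u(\mathbb P_\xi)(\xi)$ $\mathbb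 P$-a.s. for every $\xi\in L^2$. If such a map exists, $u$ is said to admit continuous $L$-derivative $\partial_\mu u$. $C^1(\mathscr P_2(\mathbb R^d))$ is the class of continuous $u$ admitting continuous $L$-derivative. Higher-order derivatives are obtained by iteration: given a derivative $f(\mu,x_1,\dots,x_j)$ of $u$ (a tensor-valued map on $\mathscr P_2(\mathbb R^d)\times(\mathbb R^d)^j$), its derivatives are the classical partial derivatives $\partial_{x_i}f$, $i=1,\dots,j$, with $\mu$ and the other variables fixed, and the (componentwise) $L$-derivative $\partial_\mu f(\mu,x_1,\dots,x_j)(x_{j+1})$ of $\mu\mapsto f(\mu,x_1,\dots,x_j)$ with $x_1,\dots,x_j$ fixed, which depends on one additional variable $x_{j+1}\in\mathbb R^d$. For example, the second-order derivatives of $u$ are $\partial_x\partial_\mu u(\mu)(x)\in\mathbb R^{d\times d}$ and $\partial_\mu^2u(\mu)(x,y)\in\mathbb R^{d\times d}$. $C^\infty(\mathscr P_2(\mathbb R^d))$ is the class of continuous functions $u\colon\mathscr P_2(\mathbb R^d)\to\mathbb R$ which admit continuous derivatives of any order, continuity being joint in all the variables (the measure and the spatial variables). *)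

theory Defs
  imports "HOL-Probability.Probability"
begin

section \<open>The Wasserstein space\<close>

definition P2 :: "'a::euclidean_space measure set" where
  "P2 = {\<mu>. prob_space \<mu> \<and> sets \<mu> = sets borel \<and> integrable \<mu> (\<lambda>x. (norm x)\<^sup>2)}"

definition couplings ::
  "'a::euclidean_space measure \<Rightarrow> 'a measure \<Rightarrow> ('a \<times> 'a) measure set" where
  "couplings \<mu> \<nu> = {\<pi>. prob_space \<pi> \<and> sets \<pi> = sets borel \<and>
                      distr \<pi> borel fst = \<mu> \<and> distr \<pi> borel snd = \<nu>}"

text \<open>
  The value 0 outside \<open>P2\<close> is only a totalisation: the locale
  \<open>Metric_space\<close> demands nonnegativity and symmetry on the whole type, and the infimum of
  the empty set of reals is unspecified. On \<open>P2\<close> there is always a coupling and all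
  the integrals are finite.
\<close>

definition W2 :: "'a::euclidean_space measure \<Rightarrow> 'a measure \<Rightarrow> real" where
  "W2 \<mu> \<nu> =
     (if \<mu> \<in> P2 \<and> \<nu> \<in> P2
      then INF \<pi>\<in>couplings \<mu> \<nu>. sqrt (\<integral>z. (norm (fst z - snd z))\<^sup>2 \<partial>\<pi>)
      else 0)"

abbreviation W2_topology :: "'a::euclidean_space measure topology" where
  "W2_topology \<equiv> Metric_space.mtopology P2 W2"

definition modulus_of_continuity :: "(real \<Rightarrow> real) \<Rightarrow> bool" where
  "modulus_of_continuity w \<longleftrightarrow>
     continuous_on {0..} w \<and> mono_on {0..} w \<and> concave_on {0..} w \<and>
     (\<forall>r\<ge>0. 0 \<le> w r) \<and> w 0 = 0"

definition has_modulus ::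
  "(real \<Rightarrow> real) \<Rightarrow> ('a::euclidean_space measure \<Rightarrow> real) \<Rightarrow> bool" where
  "has_modulus w u \<longleftrightarrow> (\<forall>\<mu>\<in>P2. \<forall>\<nu>\<in>P2. \<bar>u \<mu> - u \<nu>\<bar> \<le> w (W2 \<mu> \<nu>))"


section \<open>Lifting and Lions differentiability\<close>

text \<open>Elements of \<open>L2 \<Omega>\<close> are representatives, not almost-sure equivalence classes.\<close>

definition L2 :: "'w measure \<Rightarrow> ('w \<Rightarrow> 'a::euclidean_space) set" where
  "L2 \<Omega> = {\<xi> \<in> borel_measurable \<Omega>. integrable \<Omega> (\<lambda>\<omega>. (norm (\<xi> \<omega>))\<^sup>2)}"

definition L2norm :: "'w measure \<Rightarrow> ('w \<Rightarrow> 'a::euclidean_space) \<Rightarrow> real" where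
  "L2norm \<Omega> \<xi> = sqrt (\<integral>\<omega>. (norm (\<xi> \<omega>))\<^sup>2 \<partial>\<Omega>)"

definition lifting ::
  "'w measure \<Rightarrow> ('a::euclidean_space measure \<Rightarrow> real) \<Rightarrow> ('w \<Rightarrow> 'a) \<Rightarrow> real" where
  "lifting \<Omega> u \<xi> = u (distr \<Omega> borel \<xi>)"

text \<open>Frechet differentiability of \<open>U\<close> on \<open>L2 \<Omega>\<close> at \<open>\<xi>\<close>, the derivative being represented
  by the gradient \<open>g\<close> through the \<open>L2\<close> inner product.\<close>

definition has_L2_gradient ::
  "'w measure \<Rightarrow> (('w \<Rightarrow> 'a::euclidean_space) \<Rightarrow> real) \<Rightarrow> ('w \<Rightarrow> 'a) \<Rightarrow> ('w \<Rightarrow> 'a) \<Rightarrow> bool" where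
  "has_L2_gradient \<Omega> U \<xi> g \<longleftrightarrow> g \<in> L2 \<Omega> \<and>
     (\<forall>e>0. \<exists>\<delta>>0. \<forall>\<eta>\<in>L2 \<Omega>. L2norm \<Omega> \<eta> < \<delta> \<longrightarrow>
        \<bar>U (\<lambda>\<omega>. \<xi> \<omega> + \<eta> \<omega>) - U \<xi> - (\<integral>\<omega>. g \<omega> \<bullet> \<eta> \<omega> \<partial>\<Omega>)\<bar> \<le> e * L2norm \<Omega> \<eta>)"

definition L2_continuous ::
  "'w measure \<Rightarrow> (('w \<Rightarrow> 'a::euclidean_space) \<Rightarrow> ('w \<Rightarrow> 'a)) \<Rightarrow> bool" where
  "L2_continuous \<Omega> G \<longleftrightarrow>
     (\<forall>\<xi>\<in>L2 \<Omega>. \<forall>e>0. \<exists>\<delta>>0. \<forall>\<zeta>\<in>L2 \<Omega>.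
        L2norm \<Omega> (\<lambda>\<omega>. \<zeta> \<omega> - \<xi> \<omega>) < \<delta> \<longrightarrow> L2norm \<Omega> (\<lambda>\<omega>. G \<zeta> \<omega> - G \<xi> \<omega>) < e)"

definition has_L_derivative ::
  "'w measure \<Rightarrow> ('a::euclidean_space measure \<Rightarrow> real) \<Rightarrow> ('a measure \<Rightarrow> 'a \<Rightarrow> 'a) \<Rightarrow> bool" where
  "has_L_derivative \<Omega> u p \<longleftrightarrow>
     (\<exists>G. (\<forall>\<xi>\<in>L2 \<Omega>. has_L2_gradient \<Omega> (lifting \<Omega> u) \<xi> (G \<xi>)) \<and>
          L2_continuous \<Omega> G \<and>
          (\<forall>\<xi>\<in>L2 \<Omega>. AE \<omega> in \<Omega>. G \<xi> \<omega> = p (distr \<Omega> borel \<xi>) (\<xi> \<omega>))) \<and>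
     continuous_map (prod_topology W2_topology euclidean) euclidean (\<lambda>(\<mu>, x). p \<mu> x)"


section \<open>Smooth functions on the Wasserstein space\<close>

text \<open>
  A function of a measure and of \<open>j\<close> spatial variables takes the latter as a point of
  \<open>{..<j} \<rightarrow>\<^sub>E UNIV\<close>, the carrier of the \<open>j\<close>-fold product topology.
\<close>

definition jointly_continuous ::
  "nat \<Rightarrow> ('a::euclidean_space measure \<Rightarrow> (nat \<Rightarrow> 'a) \<Rightarrow> real) \<Rightarrow> bool" where
  "jointly_continuous j f \<longleftrightarrow>
     continuous_map
       (prod_topology W2_topology (product_topology (\<lambda>_. euclidean) {..<j}))
       euclidean (\<lambda>(\<mu>, x). f \<mu> x)"

text \<open>
  \<open>C_order \<Omega> n j f\<close>: the real-valued function \<open>f\<close> of a measure and \<open>j\<close> spatial variables is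
  jointly continuous and has jointly continuous derivatives of all orders up to \<open>n\<close>, each being
  an iterated composition of the partial gradients in the spatial variables present so far and
  of the L-derivative, which appends the spatial variable of index \<open>j\<close>. Tensor-valued derivatives
  are handled through their scalar components: each differentiation yields a vector \<open>g \<mu> x\<close> or
  \<open>p \<mu> x\<close>, whose components along the basis are then differentiated further. The derivatives
  being unique, the existential quantifiers leave no choice.
\<close>

primrec C_order ::
  "'w measure \<Rightarrow> nat \<Rightarrow> nat \<Rightarrow> ('a::euclidean_space measure \<Rightarrow> (nat \<Rightarrow> 'a) \<Rightarrow> real) \<Rightarrow> bool" where
  "C_order \<Omega> 0 = (\<lambda>j f. jointly_continuous j f)"
| "C_order \<Omega> (Suc n) = (\<lambda>j f.
     jointly_continuous j f \<and>
     (\<forall>i<j. \<exists>g.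
        (\<forall>\<mu>\<in>P2. \<forall>x\<in>{..<j} \<rightarrow>\<^sub>E UNIV. GDERIV (\<lambda>y. f \<mu> (x(i := y))) (x i) :> g \<mu> x) \<and>
        (\<forall>b\<in>Basis. C_order \<Omega> n j (\<lambda>\<mu> x. g \<mu> x \<bullet> b))) \<and>
     (\<exists>p.
        (\<forall>x\<in>{..<j} \<rightarrow>\<^sub>E UNIV.
           has_L_derivative \<Omega> (\<lambda>\<mu>. f \<mu> x) (\<lambda>\<mu> y. p \<mu> (x(j := y)))) \<and>
        (\<forall>b\<in>Basis. C_order \<Omega> n (Suc j) (\<lambda>\<mu> x. p \<mu> x \<bullet> b))))"

definition C_infinity :: "'w measure \<Rightarrow> ('a::euclidean_space measure \<Rightarrow> real) set" where
  "C_infinity \<Omega> = {u. \<forall>n. C_order \<Omega> n 0 (\<lambda>\<mu> x. u \<mu>)}"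

end

theory Submission
  imports Defs
begin

text \<open>
  Sampling turns a function of a measure into a function of finitely many points. The
  approximations are

    \<open>u\<^sub>k(\<mu>) = E [\<theta>\<^sub>k (u (empirical measure of T\<^sub>k(Y\<^sub>1 + \<sigma>\<^sub>k Z\<^sub>1), \<dots>, T\<^sub>k(Y\<^sub>m + \<sigma>\<^sub>k Z\<^sub>m)))]\<close>,

  where the \<open>Y\<^sub>l\<close> are independent with law \<open>\<mu>\<close>, the \<open>Z\<^sub>l\<close> are independent standard Gaussian vectors,
  \<open>T\<^sub>k\<close> is the projection onto the ball of radius \<open>k\<close>, \<open>\<theta>\<^sub>k\<close> truncates at \<open>-k\<close> and \<open>k\<close>,
  \<open>\<sigma>\<^sub>k = 1 / (k + 1)\<close>, and the sample size \<open>m\<close> depends on \<open>k\<close>. They have the form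
  \<open>\<integral> f d\<mu>\<^sup>m\<close>, with a kernel \<open>f\<close> of \<open>m\<close> vectors that is a Gaussian convolution of a bounded
  function (\<open>smoothing_by_gauss_noise\<close>).

  All iterated partial derivatives of such a kernel exist and are bounded. If
  \<open>\<xi>\<close> and \<open>\<eta>\<close> are replaced by \<open>m\<close> independent copies, Taylor's formula for \<open>f\<close> becomes the expansion
  of the lifting of \<open>\<mu> \<mapsto> \<integral> f d\<mu>\<^sup>m\<close>, with a remainder that is quadratic in the \<open>L\<^sup>2\<close> norm of \<open>\<eta>\<close>.
  The Lions derivative is therefore the sum over \<open>l\<close> of the integrals of the \<open>l\<close>-th partial gradient of \<open>f\<close>
  in which the \<open>l\<close>-th argument has become a spatial variable. Such integrals are again of the
  same form, so that all orders follow by induction (\<open>C_order_kernel_integral\<close>).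

  The truncation, the projection and the translations by the noise do
  not increase distances, and the empirical measure depends on the sample in a nonexpansive way if
  samples are compared by their root mean square distance. Hence the kernel inherits the modulus
  \<open>w\<close>; evaluating it on independent draws from a coupling and applying Jensen's inequality to
  the concave function \<open>w\<close> gives the modulus of \<open>u\<^sub>k\<close> (\<open>smooth_approx_modulus\<close>).

  A continuous \<open>u\<close> may grow arbitrarily fast, and compact sets of measures admit
  no common rate in the law of large numbers. But measures on the ball of radius \<open>k\<close> do
  (\<open>empirical_rate_on_ball\<close>), so \<open>m\<close> can be chosen such that the empirical measure of \<open>T\<^sub>k(Y)\<close> has
  expected squared distance at most \<open>\<sigma>\<^sub>k\<^sup>2\<close> from its law, whatever \<open>\<mu>\<close> is. By Chebyshev's inequality
  bad samples have probability of order \<open>k\<^sup>-\<^sup>2\<close>, while the truncation bounds the error on them by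
  \<open>2 k\<close> (\<open>smooth_approx_error\<close>). This gives locally uniform convergence, and a finite cover turns it
  into uniform convergence on compact sets.

  The topology is handled through the fact that \<open>W2\<close> is a metric (\<open>Metric_space_W2\<close>); the
  triangle inequality is proved without disintegration of couplings.
\<close>

section \<open>Square-integrable random variables\<close>

lemma L2D:
  assumes "\<xi> \<in> L2 M"
  shows L2_measurable: "\<xi> \<in> borel_measurable M"
    and L2_integrable_sq: "integrable M (\<lambda>\<omega>. (norm (\<xi> \<omega>))\<^sup>2)"
  using assms by (auto simp: L2_def)

lemma L2I:
  "\<xi> \<in> borel_measurable M \<Longrightarrow> integrable M (\<lambda>\<omega>. (norm (\<xi> \<omega>))\<^sup>2) \<Longrightarrow> \<xi> \<in> L2 M"
  by (simp add: L2_def)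

lemma L2norm_nonneg [simp]: "0 \<le> L2norm M \<xi>"
  by (simp add: L2norm_def)

lemma L2norm_sq: "(L2norm M \<xi>)\<^sup>2 = (\<integral>\<omega>. (norm (\<xi> \<omega>))\<^sup>2 \<partial>M)"
  by (simp add: L2norm_def)

text \<open>
  The free weight is chosen below as the ratio of two norms, which makes the inequality sharp.
\<close>
lemma norm_add_sq_le_weighted:
  fixes x y :: "'a::real_normed_vector"
  assumes "0 < c"
  shows "(norm (x + y))\<^sup>2 \<le> (1 + c) * (norm x)\<^sup>2 + (1 + 1 / c) * (norm y)\<^sup>2"
proof -
  have "(norm (x + y))\<^sup>2 \<le> (norm x + norm y)\<^sup>2"
    by (simp add: norm_triangle_ineq power_mono)
  also have "\<dots> = (norm x)\<^sup>2 + (norm y)\<^sup>2 + 2 * norm x * norm y"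
    by (simp add: power2_sum)
  also have "2 * norm x * norm y \<le> c * (norm x)\<^sup>2 + (1 / c) * (norm y)\<^sup>2"
  proof -
    have "0 \<le> (sqrt c * norm x - norm y / sqrt c)\<^sup>2" by simp
    also have "\<dots> = c * (norm x)\<^sup>2 + (1 / c) * (norm y)\<^sup>2 - 2 * norm x * norm y"
      using assms by (simp add: power2_diff power_mult_distrib power_divide field_simps)
    finally show ?thesis by simp
  qed
  finally show ?thesis by (simp add: algebra_simps)
qed

lemma L2_add:
  fixes f g :: "'w \<Rightarrow> 'a::euclidean_space"
  assumes "f \<in> L2 M" "g \<in> L2 M"
  shows "(\<lambda>\<omega>. f \<omega> + g \<omega>) \<in> L2 M"
proof (rule L2I)
  note [measurable] = assms[THEN L2_measurable]
  show "(\<lambda>\<omega>. f \<omega> + g \<omega>) \<in> borel_measurable M" by measurable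
  show "integrable M (\<lambda>\<omega>. (norm (f \<omega> + g \<omega>))\<^sup>2)"
  proof (rule Bochner_Integration.integrable_bound)
    show "integrable M (\<lambda>\<omega>. 2 * (norm (f \<omega>))\<^sup>2 + 2 * (norm (g \<omega>))\<^sup>2)"
      using assms by (simp add: L2_def)
    show "AE \<omega> in M. norm ((norm (f \<omega> + g \<omega>))\<^sup>2) \<le> norm (2 * (norm (f \<omega>))\<^sup>2 + 2 * (norm (g \<omega>))\<^sup>2)"
      using norm_add_sq_le_weighted[of 1] by (intro AE_I2) simp
  qed measurable
qed

lemma L2_scaleR:
  fixes f :: "'w \<Rightarrow> 'a::euclidean_space"
  assumes "f \<in> L2 M"
  shows "(\<lambda>\<omega>. c *\<^sub>R f \<omega>) \<in> L2 M"
  using assms by (auto simp: L2_def power_mult_distrib)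

lemma L2_diff:
  fixes f g :: "'w \<Rightarrow> 'a::euclidean_space"
  assumes "f \<in> L2 M" "g \<in> L2 M"
  shows "(\<lambda>\<omega>. f \<omega> - g \<omega>) \<in> L2 M"
  using L2_add[OF assms(1) L2_scaleR[OF assms(2), of "-1"]] by simp

lemma (in finite_measure) L2_bounded:
  fixes f :: "'a \<Rightarrow> 'b::euclidean_space"
  assumes "f \<in> borel_measurable M" "\<And>x. x \<in> space M \<Longrightarrow> norm (f x) \<le> B"
  shows "f \<in> L2 M"
proof (rule L2I)
  note [measurable] = assms(1)
  have "norm (f x) ^ 2 \<le> B\<^sup>2" if "x \<in> space M" for x
    using assms(2)[OF that] by (intro power_mono) auto
  then show "integrable M (\<lambda>\<omega>. (norm (f \<omega>))\<^sup>2)"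
    by (intro integrable_const_bound[where B="B\<^sup>2"] AE_I2) auto
qed fact

lemma L2_inner_integrable:
  fixes f g :: "'w \<Rightarrow> 'a::euclidean_space"
  assumes "f \<in> L2 M" "g \<in> L2 M"
  shows "integrable M (\<lambda>\<omega>. f \<omega> \<bullet> g \<omega>)"
proof (rule Bochner_Integration.integrable_bound)
  note [measurable] = assms[THEN L2_measurable]
  show "integrable M (\<lambda>\<omega>. (norm (f \<omega>))\<^sup>2 + (norm (g \<omega>))\<^sup>2)"
    using assms by (simp add: L2_def)
  show "(\<lambda>\<omega>. f \<omega> \<bullet> g \<omega>) \<in> borel_measurable M" by measurable
  have "\<bar>f \<omega> \<bullet> g \<omega>\<bar> \<le> (norm (f \<omega>))\<^sup>2 + (norm (g \<omega>))\<^sup>2" for \<omega>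
  proof -
    have "\<bar>f \<omega> \<bullet> g \<omega>\<bar> \<le> norm (f \<omega>) * norm (g \<omega>)" by (rule Cauchy_Schwarz_ineq2)
    also have "\<dots> \<le> (norm (f \<omega>))\<^sup>2 + (norm (g \<omega>))\<^sup>2"
      using sum_squares_bound[of "norm (f \<omega>)" "norm (g \<omega>)"]
        mult_nonneg_nonneg[OF norm_ge_zero[of "f \<omega>"] norm_ge_zero[of "g \<omega>"]] by linarith
    finally show ?thesis .
  qed
  then show "AE \<omega> in M. norm (f \<omega> \<bullet> g \<omega>) \<le> norm ((norm (f \<omega>))\<^sup>2 + (norm (g \<omega>))\<^sup>2)"
    by (intro AE_I2) (simp add: abs_of_nonneg)
qed

text \<open>
  Minkowski's inequality, by integrating the weighted inequality for the square of a sum.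
\<close>
lemma L2norm_triangle:
  fixes f g :: "'w \<Rightarrow> 'a::euclidean_space"
  assumes "f \<in> L2 M" "g \<in> L2 M"
  shows "L2norm M (\<lambda>\<omega>. f \<omega> + g \<omega>) \<le> L2norm M f + L2norm M g"
proof (rule field_le_epsilon)
  fix e :: real assume "0 < e"
  \<comment> \<open>The summand \<open>e / 2\<close> keeps the quotient \<open>b / a\<close> meaningful when a norm vanishes.\<close>
  define a where "a = L2norm M f + e / 2"
  define b where "b = L2norm M g + e / 2"
  have ab: "0 < a" "0 < b" "L2norm M f \<le> a" "L2norm M g \<le> b"
    using \<open>0 < e\<close> L2norm_nonneg[of M f] L2norm_nonneg[of M g] unfolding a_def b_def by linarith+
  have pw: "(norm (f \<omega> + g \<omega>))\<^sup>2 \<le> (1 + b / a) * (norm (f \<omega>))\<^sup>2 + (1 + a / b) * (norm (g \<omega>))\<^sup>2" for \<omega>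
    using norm_add_sq_le_weighted[of "b / a" "f \<omega>" "g \<omega>"] ab(1,2) by simp
  have int: "integrable M (\<lambda>\<omega>. (1 + b / a) * (norm (f \<omega>))\<^sup>2)" "integrable M (\<lambda>\<omega>. (1 + a / b) * (norm (g \<omega>))\<^sup>2)"
    using assms[THEN L2_integrable_sq] by (intro integrable_mult_right; simp)+
  have "b / a * a\<^sup>2 = b * a" "a / b * b\<^sup>2 = a * b"
    using ab(1,2) by (simp_all add: power2_eq_square)
  then have sq: "(1 + b / a) * a\<^sup>2 + (1 + a / b) * b\<^sup>2 = (a + b)\<^sup>2"
    by (simp add: distrib_right power2_sum)
  have "(L2norm M (\<lambda>\<omega>. f \<omega> + g \<omega>))\<^sup>2
      \<le> (\<integral>\<omega>. (1 + b / a) * (norm (f \<omega>))\<^sup>2 + (1 + a / b) * (norm (g \<omega>))\<^sup>2 \<partial>M)"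
    unfolding L2norm_sq
    by (rule integral_mono[OF L2_integrable_sq[OF L2_add[OF assms]] Bochner_Integration.integrable_add[OF int] pw])
  also have "\<dots> = (1 + b / a) * (L2norm M f)\<^sup>2 + (1 + a / b) * (L2norm M g)\<^sup>2"
    by (subst Bochner_Integration.integral_add[OF int]) (simp add: L2norm_sq)
  also have "\<dots> \<le> (1 + b / a) * a\<^sup>2 + (1 + a / b) * b\<^sup>2"
    using ab by (intro add_mono mult_left_mono power_mono) auto
  also note sq
  finally have "L2norm M (\<lambda>\<omega>. f \<omega> + g \<omega>) \<le> a + b"
    by (rule power2_le_imp_le) (use ab in simp)
  then show "L2norm M (\<lambda>\<omega>. f \<omega> + g \<omega>) \<le> L2norm M f + L2norm M g + e"
    by (simp add: a_def b_def)
qed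

lemma L2norm_minus: "L2norm M (\<lambda>\<omega>. f \<omega> - g \<omega>) = L2norm M (\<lambda>\<omega>. g \<omega> - f \<omega>)"
  by (simp add: L2norm_def norm_minus_commute)

lemma L2norm_diff_triangle:
  fixes f g h :: "'w \<Rightarrow> 'a::euclidean_space"
  assumes "f \<in> L2 M" "g \<in> L2 M" "h \<in> L2 M"
  shows "L2norm M (\<lambda>\<omega>. f \<omega> - h \<omega>) \<le> L2norm M (\<lambda>\<omega>. f \<omega> - g \<omega>) + L2norm M (\<lambda>\<omega>. g \<omega> - h \<omega>)"
  using L2norm_triangle[OF L2_diff[OF assms(1,2)] L2_diff[OF assms(2,3)]] by simp

lemma (in prob_space) L2norm_le_bound:
  assumes "AE x in M. norm (f x) \<le> B" "0 \<le> B"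
  shows "L2norm M f \<le> B"
proof -
  have "(L2norm M f)\<^sup>2 \<le> B\<^sup>2" unfolding L2norm_sq
  proof (cases "integrable M (\<lambda>x. (norm (f x))\<^sup>2)")
    case True
    then have "(\<integral>x. (norm (f x))\<^sup>2 \<partial>M) \<le> (\<integral>x. B\<^sup>2 \<partial>M)"
      using assms by (intro integral_mono_AE) (auto intro: power_mono)
    then show "(\<integral>x. (norm (f x))\<^sup>2 \<partial>M) \<le> B\<^sup>2" by (simp add: prob_space)
  qed (simp add: not_integrable_integral_eq)
  then show ?thesis using assms(2) by (rule power2_le_imp_le)
qed

text \<open>
  The variance of the norm is nonnegative.
\<close>
lemma (in prob_space) expectation_norm_le_L2norm:
  fixes f :: "'a \<Rightarrow> 'b::euclidean_space"
  assumes "f \<in> L2 M"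
  shows "integrable M (\<lambda>x. norm (f x))" and "(\<integral>x. norm (f x) \<partial>M) \<le> L2norm M f"
proof -
  note [measurable] = L2_measurable[OF assms]
  show i: "integrable M (\<lambda>x. norm (f x))"
    by (rule square_integrable_imp_integrable[OF _ L2_integrable_sq[OF assms]]) measurable
  have "0 \<le> variance (\<lambda>x. norm (f x))" by (rule variance_positive)
  also have "\<dots> = (L2norm M f)\<^sup>2 - (\<integral>x. norm (f x) \<partial>M)\<^sup>2"
    by (simp only: variance_eq[OF i L2_integrable_sq[OF assms]] L2norm_sq)
  finally have "(\<integral>x. norm (f x) \<partial>M)\<^sup>2 \<le> (L2norm M f)\<^sup>2" by simp
  then show "(\<integral>x. norm (f x) \<partial>M) \<le> L2norm M f"
    by (rule power2_le_imp_le) simp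
qed

lemma L2_distr:
  assumes "\<phi> \<in> measurable M N" "f \<in> borel_measurable N"
  shows "f \<in> L2 (distr M N \<phi>) \<longleftrightarrow> (\<lambda>x. f (\<phi> x)) \<in> L2 M"
  using assms measurable_compose[OF assms] by (auto simp: L2_def integrable_distr_eq)

lemma L2norm_distr:
  assumes "\<phi> \<in> measurable M N" "f \<in> borel_measurable N"
  shows "L2norm (distr M N \<phi>) f = L2norm M (\<lambda>x. f (\<phi> x))"
  using assms unfolding L2norm_def by (subst integral_distr) auto

section \<open>The Wasserstein metric\<close>

lemma P2_iff_L2: "\<mu> \<in> P2 \<longleftrightarrow> prob_space \<mu> \<and> sets \<mu> = sets borel \<and> (\<lambda>x. x) \<in> L2 \<mu>"
proof -
  have "(\<lambda>x. x) \<in> borel_measurable \<mu>" if "sets \<mu> = sets borel"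
    using that measurable_cong_sets[of \<mu> borel borel borel] by simp
  then show ?thesis by (auto simp: P2_def L2_def)
qed

lemma P2D:
  assumes "\<mu> \<in> P2"
  shows P2_prob: "prob_space \<mu>" and P2_sets: "sets \<mu> = sets borel" and P2_L2: "(\<lambda>x. x) \<in> L2 \<mu>"
  using assms by (auto simp: P2_iff_L2)

lemma distr_in_P2:
  assumes "prob_space M" "X \<in> L2 M"
  shows "distr M borel X \<in> P2"
  unfolding P2_iff_L2
  using assms prob_space.prob_space_distr[OF assms(1) L2_measurable[OF assms(2)]]
  by (simp add: L2_distr[OF L2_measurable[OF assms(2)]])

lemma couplingsI:
  fixes X Y :: "'w \<Rightarrow> 'a::euclidean_space"
  assumes "prob_space M" and [measurable]: "X \<in> borel_measurable M" "Y \<in> borel_measurable M"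
  shows "distr M borel (\<lambda>\<omega>. (X \<omega>, Y \<omega>)) \<in> couplings (distr M borel X) (distr M borel Y)"
  unfolding couplings_def
proof (intro CollectI conjI)
  have [measurable]: "(\<lambda>\<omega>. (X \<omega>, Y \<omega>)) \<in> borel_measurable M" by simp
  show "prob_space (distr M borel (\<lambda>\<omega>. (X \<omega>, Y \<omega>)))"
    by (rule prob_space.prob_space_distr) fact+
  have [measurable]: "fst \<in> borel_measurable (borel :: ('a \<times> 'a) measure)"
      "snd \<in> borel_measurable (borel :: ('a \<times> 'a) measure)"
    by (auto intro!: borel_measurable_continuous_onI continuous_intros)
  show "distr (distr M borel (\<lambda>\<omega>. (X \<omega>, Y \<omega>))) borel fst = distr M borel X"
    by (subst distr_distr) (auto simp: comp_def)
  show "distr (distr M borel (\<lambda>\<omega>. (X \<omega>, Y \<omega>))) borel snd = distr M borel Y"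
    by (subst distr_distr) (auto simp: comp_def)
qed simp

lemma couplings_L2:
  fixes \<mu> \<nu> :: "'a::euclidean_space measure"
  assumes "\<mu> \<in> P2" "\<nu> \<in> P2" "\<pi> \<in> couplings \<mu> \<nu>"
  shows "fst \<in> L2 \<pi>" "snd \<in> L2 \<pi>"
proof -
  have s: "sets \<pi> = sets borel" and m: "distr \<pi> borel fst = \<mu>" "distr \<pi> borel snd = \<nu>"
    using assms by (auto simp: couplings_def)
  have "fst \<in> borel_measurable (borel :: ('a \<times> 'a) measure)"
      "snd \<in> borel_measurable (borel :: ('a \<times> 'a) measure)"
    by (auto intro!: borel_measurable_continuous_onI continuous_intros)
  then have f: "fst \<in> borel_measurable \<pi>" and g: "snd \<in> borel_measurable \<pi>"
    using measurable_cong_sets[OF s refl] by auto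
  show "fst \<in> L2 \<pi>" using P2_L2[OF assms(1)] L2_distr[OF f, of "\<lambda>x. x"] m by simp
  show "snd \<in> L2 \<pi>" using P2_L2[OF assms(2)] L2_distr[OF g, of "\<lambda>x. x"] m by simp
qed

lemma W2_eq_Inf:
  "\<mu> \<in> P2 \<Longrightarrow> \<nu> \<in> P2 \<Longrightarrow> W2 \<mu> \<nu> = (INF \<pi>\<in>couplings \<mu> \<nu>. L2norm \<pi> (\<lambda>z. fst z - snd z))"
  by (simp add: W2_def L2norm_def)

lemma bdd_below_coupling_costs: "bdd_below ((\<lambda>\<pi>. L2norm \<pi> (\<lambda>z. fst z - snd z)) ` S)"
  by (rule bdd_belowI[of _ 0]) auto

text \<open>
  The joint law of two random variables is a coupling of their laws. Upper bounds on a
  distance are obtained below by exhibiting suitable random variables.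
\<close>
lemma W2_le_L2norm:
  fixes X Y :: "'w \<Rightarrow> 'a::euclidean_space"
  assumes "prob_space M" "X \<in> L2 M" "Y \<in> L2 M"
  shows "W2 (distr M borel X) (distr M borel Y) \<le> L2norm M (\<lambda>\<omega>. X \<omega> - Y \<omega>)"
proof -
  note [measurable] = assms(2,3)[THEN L2_measurable]
  have [measurable]: "(\<lambda>z. fst z - snd z) \<in> borel_measurable (borel :: ('a \<times> 'a) measure)"
    by (auto intro!: borel_measurable_continuous_onI continuous_intros)
  have "W2 (distr M borel X) (distr M borel Y)
      \<le> L2norm (distr M borel (\<lambda>\<omega>. (X \<omega>, Y \<omega>))) (\<lambda>z. fst z - snd z)"
    unfolding W2_eq_Inf[OF distr_in_P2[OF assms(1,2)] distr_in_P2[OF assms(1,3)]]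
    by (intro cINF_lower bdd_below_coupling_costs couplingsI assms) measurable
  also have "\<dots> = L2norm M (\<lambda>\<omega>. X \<omega> - Y \<omega>)"
    by (subst L2norm_distr) auto
  finally show ?thesis .
qed

text \<open>
  Reweighting a product measure by a function whose partial integrals are 1 produces a coupling.
  The weights used below depend on the two points only through the cells of a countable partition
  in which they lie.
\<close>
lemma marginals_of_density:
  fixes k :: "'a \<times> 'b \<Rightarrow> ennreal"
  assumes "prob_space M" "prob_space N"
    and [measurable]: "k \<in> borel_measurable (M \<Otimes>\<^sub>M N)"
    and 1: "AE x in M. (\<integral>\<^sup>+y. k (x, y) \<partial>N) = 1"
    and 2: "AE y in N. (\<integral>\<^sup>+x. k (x, y) \<partial>M) = 1"
  shows "distr (density (M \<Otimes>\<^sub>M N) k) M fst = M" "distr (density (M \<Otimes>\<^sub>M N) k) N snd = N"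
    "prob_space (density (M \<Otimes>\<^sub>M N) k)"
proof -
  interpret M: prob_space M by fact
  interpret N: prob_space N by fact
  interpret MN: pair_prob_space M N ..
  show m: "distr (density (M \<Otimes>\<^sub>M N) k) M fst = M"
  proof (rule measure_eqI)
    fix A assume "A \<in> sets (distr (density (M \<Otimes>\<^sub>M N) k) M fst)"
    then have [measurable]: "A \<in> sets M" by simp
    have "emeasure (distr (density (M \<Otimes>\<^sub>M N) k) M fst) A
        = (\<integral>\<^sup>+z. k z * indicator (fst -` A \<inter> space (M \<Otimes>\<^sub>M N)) z \<partial>(M \<Otimes>\<^sub>M N))"
      by (subst emeasure_distr) (simp_all add: emeasure_density)
    also have "\<dots> = (\<integral>\<^sup>+z. k z * indicator A (fst z) \<partial>(M \<Otimes>\<^sub>M N))"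
      by (intro nn_integral_cong) (auto simp: indicator_def)
    also have "\<dots> = (\<integral>\<^sup>+x. (\<integral>\<^sup>+y. k (x, y) * indicator A x \<partial>N) \<partial>M)"
      by (subst N.nn_integral_fst[symmetric]) simp_all
    also have "\<dots> = (\<integral>\<^sup>+x. indicator A x \<partial>M)"
      by (rule nn_integral_cong_AE, rule AE_mp[OF 1], rule AE_I2) (simp add: nn_integral_multc)
    finally show "emeasure (distr (density (M \<Otimes>\<^sub>M N) k) M fst) A = emeasure M A" by simp
  qed simp
  show "distr (density (M \<Otimes>\<^sub>M N) k) N snd = N"
  proof (rule measure_eqI)
    fix A assume "A \<in> sets (distr (density (M \<Otimes>\<^sub>M N) k) N snd)"
    then have [measurable]: "A \<in> sets N" by simp
    have "emeasure (distr (density (M \<Otimes>\<^sub>M N) k) N snd) A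
        = (\<integral>\<^sup>+z. k z * indicator (snd -` A \<inter> space (M \<Otimes>\<^sub>M N)) z \<partial>(M \<Otimes>\<^sub>M N))"
      by (subst emeasure_distr) (simp_all add: emeasure_density)
    also have "\<dots> = (\<integral>\<^sup>+z. k z * indicator A (snd z) \<partial>(M \<Otimes>\<^sub>M N))"
      by (intro nn_integral_cong) (auto simp: indicator_def)
    also have "\<dots> = (\<integral>\<^sup>+y. (\<integral>\<^sup>+x. k (x, y) * indicator A y \<partial>M) \<partial>N)"
      by (subst MN.nn_integral_snd[symmetric]) simp_all
    also have "\<dots> = (\<integral>\<^sup>+y. indicator A y \<partial>N)"
      by (rule nn_integral_cong_AE, rule AE_mp[OF 2], rule AE_I2) (simp add: nn_integral_multc)
    finally show "emeasure (distr (density (M \<Otimes>\<^sub>M N) k) N snd) A = emeasure N A" by simp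
  qed simp
  show "prob_space (density (M \<Otimes>\<^sub>M N) k)"
    by (rule prob_space_distrD[of fst _ M]) (simp_all add: m M.prob_space_axioms)
qed

lemma couplings_nonempty:
  fixes \<mu> \<nu> :: "'a::euclidean_space measure"
  assumes "prob_space \<mu>" "prob_space \<nu>" "sets \<mu> = sets borel" "sets \<nu> = sets borel"
  shows "couplings \<mu> \<nu> \<noteq> {}"
proof -
  interpret M: prob_space \<mu> by fact
  interpret N: prob_space \<nu> by fact
  have *: "(fst :: 'a \<times> 'a \<Rightarrow> 'a) \<in> borel_measurable (\<mu> \<Otimes>\<^sub>M \<nu>)" "(snd :: 'a \<times> 'a \<Rightarrow> 'a) \<in> borel_measurable (\<mu> \<Otimes>\<^sub>M \<nu>)"
    using assms(3,4) by (auto simp: measurable_cong_sets[OF refl assms(3)[symmetric]] measurable_cong_sets[OF refl assms(4)[symmetric]])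
  have "prob_space (\<mu> \<Otimes>\<^sub>M \<nu>)" "distr (\<mu> \<Otimes>\<^sub>M \<nu>) \<mu> fst = \<mu>" "distr (\<mu> \<Otimes>\<^sub>M \<nu>) \<nu> snd = \<nu>"
    using marginals_of_density[OF assms(1,2), of "\<lambda>_. 1"]
    by (simp_all add: M.emeasure_space_1 N.emeasure_space_1 density_1)
  moreover have "distr (\<mu> \<Otimes>\<^sub>M \<nu>) borel fst = distr (\<mu> \<Otimes>\<^sub>M \<nu>) \<mu> fst"
      "distr (\<mu> \<Otimes>\<^sub>M \<nu>) borel snd = distr (\<mu> \<Otimes>\<^sub>M \<nu>) \<nu> snd"
    by (intro distr_cong; simp add: assms)+
  ultimately show ?thesis
    using couplingsI[OF _ *] by auto
qed

lemma W2_coupling: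
  fixes \<mu> \<nu> :: "'a::euclidean_space measure"
  assumes "\<mu> \<in> P2" "\<nu> \<in> P2" "0 < e"
  obtains \<pi> :: "('a \<times> 'a) measure"
  where "prob_space \<pi>" "sets \<pi> = sets borel" "distr \<pi> borel fst = \<mu>" "distr \<pi> borel snd = \<nu>"
    "fst \<in> L2 \<pi>" "snd \<in> L2 \<pi>" "L2norm \<pi> (\<lambda>z. fst z - snd z) < W2 \<mu> \<nu> + e"
proof -
  have "couplings \<mu> \<nu> \<noteq> {}"
    using assms by (intro couplings_nonempty P2_prob P2_sets)
  then obtain \<pi> where "\<pi> \<in> couplings \<mu> \<nu>" "L2norm \<pi> (\<lambda>z. fst z - snd z) < W2 \<mu> \<nu> + e"
    using \<open>0 < e\<close> W2_eq_Inf[OF assms(1,2)] cINF_less_iff[OF _ bdd_below_coupling_costs, of "couplings \<mu> \<nu>" "W2 \<mu> \<nu> + e"]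
    by auto
  then show ?thesis
    using that couplings_L2[OF assms(1,2)] by (auto simp: couplings_def)
qed

lemma W2_nonneg: "0 \<le> W2 \<mu> \<nu>"
proof (cases "\<mu> \<in> P2 \<and> \<nu> \<in> P2")
  case True
  then have "couplings \<mu> \<nu> \<noteq> {}"
    by (intro couplings_nonempty P2_prob P2_sets) auto
  then show ?thesis
    using True by (auto simp: W2_eq_Inf intro!: cINF_greatest)
qed (auto simp: W2_def)

lemma W2_commute: "W2 \<mu> \<nu> = W2 \<nu> \<mu>"
proof -
  have le: "W2 \<mu> \<nu> \<le> W2 \<nu> \<mu>" if P2: "\<mu> \<in> P2" "\<nu> \<in> P2" for \<mu> \<nu> :: "'a measure"
  proof (rule field_le_epsilon)
    fix e :: real assume "0 < e"
    obtain \<pi> :: "('a \<times> 'a) measure" where \<pi>: "prob_space \<pi>" "distr \<pi> borel fst = \<nu>" "distr \<pi> borel snd = \<mu>"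
      "fst \<in> L2 \<pi>" "snd \<in> L2 \<pi>" "L2norm \<pi> (\<lambda>z. fst z - snd z) < W2 \<nu> \<mu> + e"
      using W2_coupling[OF P2(2,1) \<open>0 < e\<close>] by blast
    have "W2 \<mu> \<nu> \<le> L2norm \<pi> (\<lambda>z. snd z - fst z)"
      using W2_le_L2norm[OF \<pi>(1,5,4)] \<pi>(2,3) by simp
    then show "W2 \<mu> \<nu> \<le> W2 \<nu> \<mu> + e" using \<pi>(6) L2norm_minus[of \<pi> snd fst] by linarith
  qed
  show ?thesis
  proof (cases "\<mu> \<in> P2 \<and> \<nu> \<in> P2")
    case True then show ?thesis by (intro antisym le) auto
  qed (auto simp: W2_def)
qed

text \<open>
  A point is assigned to the first member of a dense sequence that is close to it. By compactness
  finitely many members are close to all points of a ball.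
\<close>
lemma countable_partition_small_diameter:
  assumes "0 < \<eta>"
  obtains q :: "'a::euclidean_space \<Rightarrow> nat"
  where "q \<in> measurable borel (count_space UNIV)" "\<And>x y. q x = q y \<Longrightarrow> norm (x - y) \<le> \<eta>"
    "\<And>R. finite (q ` cball 0 R)"
proof -
  obtain D :: "'a set" where D: "countable D" "\<And>X. open X \<Longrightarrow> X \<noteq> {} \<Longrightarrow> \<exists>d\<in>D. d \<in> X"
    using countable_dense_exists by blast
  have "D \<noteq> {}" using D(2)[OF open_UNIV] by blast
  define p where "p = from_nat_into D"
  have pD: "range p = D" using \<open>D \<noteq> {}\<close> \<open>countable D\<close> by (simp add: p_def range_from_nat_into)
  have ex: "\<exists>i. dist x (p i) < \<eta> / 2" for x
  proof -
    have "ball x (\<eta> / 2) \<noteq> {}" using assms by simp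
    then obtain d where "d \<in> D" "d \<in> ball x (\<eta> / 2)" using D(2)[OF open_ball] by blast
    moreover then obtain i where "d = p i" using pD by blast
    ultimately show ?thesis by auto
  qed
  define q where "q = (\<lambda>x. LEAST i. dist x (p i) < \<eta> / 2)"
  have q: "dist x (p (q x)) < \<eta> / 2" for x
    unfolding q_def by (rule LeastI_ex[OF ex])
  show ?thesis
  proof
    have "{x \<in> space borel. dist x (p i) < \<eta> / 2} = ball (p i) (\<eta> / 2)" for i
      by (auto simp: dist_commute)
    then show "q \<in> measurable borel (count_space UNIV)"
      unfolding q_def by (intro measurable_Least) (simp add: pred_def)
    show "norm (x - y) \<le> \<eta>" if "q x = q y" for x y
    proof -
      have "dist x y \<le> dist x (p (q x)) + dist y (p (q x))" by (rule dist_triangle2)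
      also have "\<dots> \<le> \<eta>" using q[of x] q[of y] that by simp
      finally show ?thesis by (simp add: dist_norm)
    qed
    show "finite (q ` cball 0 R)" for R
    proof -
      have "cball 0 R \<subseteq> (\<Union>i\<in>UNIV. ball (p i) (\<eta> / 2))"
      proof
        fix x
        obtain i where "dist x (p i) < \<eta> / 2" using ex by blast
        then show "x \<in> (\<Union>i\<in>UNIV. ball (p i) (\<eta> / 2))" by (auto simp: dist_commute)
      qed
      then obtain I where I: "finite I" "cball 0 R \<subseteq> (\<Union>i\<in>I. ball (p i) (\<eta> / 2))"
        by (rule compactE_image[OF compact_cball open_ball])
      have "q x \<le> Max I" if "x \<in> cball 0 R" for x
      proof -
        have "x \<in> (\<Union>i\<in>I. ball (p i) (\<eta> / 2))" using I(2) that by (rule subsetD)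
        then obtain i where i: "i \<in> I" "dist x (p i) < \<eta> / 2" by (auto simp: dist_commute)
        have "q x \<le> i" unfolding q_def by (rule Least_le) fact
        also have "i \<le> Max I" using I(1) i(1) by simp
        finally show ?thesis .
      qed
      then have "q ` cball 0 R \<subseteq> {..Max I}" by blast
      then show ?thesis by (rule finite_subset) simp
    qed
  qed
qed

text \<open>
  There are countably many cells, so those of mass zero are together a null set.
\<close>
lemma AE_cell_not_null:
  fixes q :: "'a \<Rightarrow> nat"
  assumes q: "q \<in> measurable M (count_space UNIV)"
  shows "AE x in M. emeasure M {y \<in> space M. q y = q x} \<noteq> 0"
proof -
  have "AE x in M. emeasure M {y \<in> space M. q y = i} = 0 \<longrightarrow> q x \<noteq> i" for i
  proof (cases "emeasure M {y \<in> space M. q y = i} = 0")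
    case True
    have "{y \<in> space M. q y = i} \<in> sets M"
      using measurable_sets[OF q, of "{i}"] by (simp add: vimage_def Int_def conj_commute)
    then have "AE x in M. q x \<noteq> i" using True by (subst AE_iff_measurable[OF _ refl]) auto
    then show ?thesis by eventually_elim simp
  qed simp
  then have "AE x in M. \<forall>i. emeasure M {y \<in> space M. q y = i} = 0 \<longrightarrow> q x \<noteq> i"
    by (simp add: AE_all_countable)
  then show ?thesis by eventually_elim auto
qed

text \<open>
  Two couplings with a common middle marginal are glued without disintegration: the two middle
  points are only required to lie in the same cell of a countable partition into sets of
  diameter at most \<open>\<eta>\<close>, and are independent given that cell.
\<close>
lemma W2_triangle:
  fixes \<mu> \<nu> \<rho> :: "'a::euclidean_space measure"
  assumes P2: "\<mu> \<in> P2" "\<nu> \<in> P2" "\<rho> \<in> P2"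
  shows "W2 \<mu> \<rho> \<le> W2 \<mu> \<nu> + W2 \<nu> \<rho>"
proof (rule field_le_epsilon)
  fix e :: real assume "0 < e"
  then have e3: "0 < e / 3" by simp
  obtain \<pi>1 :: "('a \<times> 'a) measure" where 1: "prob_space \<pi>1" "sets \<pi>1 = sets borel"
      "distr \<pi>1 borel fst = \<mu>" "distr \<pi>1 borel snd = \<nu>"
      "fst \<in> L2 \<pi>1" "snd \<in> L2 \<pi>1" "L2norm \<pi>1 (\<lambda>z. fst z - snd z) < W2 \<mu> \<nu> + e / 3"
    by (rule W2_coupling[OF P2(1,2) e3])
  obtain \<pi>2 :: "('a \<times> 'a) measure" where 2: "prob_space \<pi>2" "sets \<pi>2 = sets borel"
      "distr \<pi>2 borel fst = \<nu>" "distr \<pi>2 borel snd = \<rho>"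
      "fst \<in> L2 \<pi>2" "snd \<in> L2 \<pi>2" "L2norm \<pi>2 (\<lambda>z. fst z - snd z) < W2 \<nu> \<rho> + e / 3"
    by (rule W2_coupling[OF P2(2,3) e3])
  note [measurable] = 1(5,6)[THEN L2_measurable] 2(5,6)[THEN L2_measurable]
  interpret \<nu>: prob_space \<nu> by (rule P2_prob[OF P2(2)])
  obtain q :: "'a \<Rightarrow> nat" where q: "q \<in> measurable borel (count_space UNIV)"
      "\<And>x y. q x = q y \<Longrightarrow> norm (x - y) \<le> e / 3"
    by (rule countable_partition_small_diameter[OF e3]) blast
  note [measurable] = q(1)
  define c where "c = (\<lambda>i. emeasure \<nu> {x. q x = i})"
  \<comment> \<open>The weight of a pair of cells: the middle points must share a cell, and division by its
    mass makes them independent given the cell. Cells of mass zero get weight \<open>\<infinity>\<close>, on a null set.\<close>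
  define k :: "('a \<times> 'a) \<times> ('a \<times> 'a) \<Rightarrow> ennreal"
    where "k = (\<lambda>z. if q (snd (fst z)) = q (fst (snd z)) then 1 / c (q (snd (fst z))) else 0)"
  have "(\<lambda>z. q (snd (fst z))) \<in> measurable (\<pi>1 \<Otimes>\<^sub>M \<pi>2) (count_space UNIV)"
    by (rule measurable_compose[OF measurable_compose[OF measurable_fst L2_measurable[OF 1(6)]] q(1)])
  moreover have "(\<lambda>z. q (fst (snd z))) \<in> measurable (\<pi>1 \<Otimes>\<^sub>M \<pi>2) (count_space UNIV)"
    by (rule measurable_compose[OF measurable_compose[OF measurable_snd L2_measurable[OF 2(5)]] q(1)])
  ultimately have "(\<lambda>z. (q (snd (fst z)), q (fst (snd z)))) \<in> measurable (\<pi>1 \<Otimes>\<^sub>M \<pi>2) (count_space UNIV)"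
    using measurable_Pair[of _ "\<pi>1 \<Otimes>\<^sub>M \<pi>2" "count_space UNIV" _ "count_space UNIV"]
    by (simp add: pair_measure_countable)
  then have "(\<lambda>z. (\<lambda>(i, j). if i = j then 1 / c i else 0) (q (snd (fst z)), q (fst (snd z)))) \<in> borel_measurable (\<pi>1 \<Otimes>\<^sub>M \<pi>2)"
    by (rule measurable_compose) simp
  then have k [measurable]: "k \<in> borel_measurable (\<pi>1 \<Otimes>\<^sub>M \<pi>2)"
    by (simp add: k_def)
  have cell: "{x. q x = i} \<in> sets borel" for i
    using measurable_sets[OF q(1), of "{i}"] by (simp add: vimage_def)
  have c1: "emeasure \<pi>1 {s \<in> space \<pi>1. q (snd s) = i} = c i" for i
    using emeasure_distr[of snd \<pi>1 borel "{x. q x = i}"] cell 1(4)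
    by (simp add: c_def vimage_def Int_def conj_commute)
  have c2: "emeasure \<pi>2 {t \<in> space \<pi>2. q (fst t) = i} = c i" for i
    using emeasure_distr[of fst \<pi>2 borel "{x. q x = i}"] cell 2(3)
    by (simp add: c_def vimage_def Int_def conj_commute)
  have inv: "1 / c i * c i = 1" if "c i \<noteq> 0" for i
    using ennreal_divide_self[OF that] by (simp add: c_def ennreal_divide_times less_top[symmetric])
  have nz1: "AE s in \<pi>1. c (q (snd s)) \<noteq> 0"
    using AE_cell_not_null[OF measurable_compose[OF L2_measurable[OF 1(6)] q(1)]] by (simp only: c1)
  have nz2: "AE t in \<pi>2. c (q (fst t)) \<noteq> 0"
    using AE_cell_not_null[OF measurable_compose[OF L2_measurable[OF 2(5)] q(1)]] by (simp only: c2)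
  have m1: "AE s in \<pi>1. (\<integral>\<^sup>+t. k (s, t) \<partial>\<pi>2) = 1" using nz1
  proof eventually_elim
    case (elim s)
    have "(\<integral>\<^sup>+t. k (s, t) \<partial>\<pi>2) = (\<integral>\<^sup>+t. 1 / c (q (snd s)) * indicator {t \<in> space \<pi>2. q (fst t) = q (snd s)} t \<partial>\<pi>2)"
      by (intro nn_integral_cong) (auto simp: k_def indicator_def)
    also have "\<dots> = 1" using inv[OF elim] by (subst nn_integral_cmult_indicator) (simp_all add: c2)
    finally show ?case .
  qed
  have m2: "AE t in \<pi>2. (\<integral>\<^sup>+s. k (s, t) \<partial>\<pi>1) = 1" using nz2
  proof eventually_elim
    case (elim t)
    have "(\<integral>\<^sup>+s. k (s, t) \<partial>\<pi>1) = (\<integral>\<^sup>+s. 1 / c (q (fst t)) * indicator {s \<in> space \<pi>1. q (snd s) = q (fst t)} s \<partial>\<pi>1)"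
      by (intro nn_integral_cong) (auto simp: k_def indicator_def)
    also have "\<dots> = 1" using inv[OF elim] by (subst nn_integral_cmult_indicator) (simp_all add: c1)
    finally show ?case .
  qed
  define M where "M = density (\<pi>1 \<Otimes>\<^sub>M \<pi>2) k"
  have M: "distr M \<pi>1 fst = \<pi>1" "distr M \<pi>2 snd = \<pi>2" "prob_space M"
    unfolding M_def using marginals_of_density[OF 1(1) 2(1) k m1 m2] by auto
  interpret M: prob_space M by fact
  have fs [measurable]: "fst \<in> measurable M \<pi>1" "snd \<in> measurable M \<pi>2"
    unfolding M_def by simp_all
  have X: "(\<lambda>z. f (fst z)) \<in> L2 M \<and> L2norm M (\<lambda>z. f (fst z)) = L2norm \<pi>1 f" if "f \<in> L2 \<pi>1" for f :: "'a \<times> 'a \<Rightarrow> 'a"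
    using L2_distr[OF fs(1) L2_measurable[OF that]] L2norm_distr[OF fs(1) L2_measurable[OF that]] that
    by (simp add: M)
  have Y: "(\<lambda>z. f (snd z)) \<in> L2 M \<and> L2norm M (\<lambda>z. f (snd z)) = L2norm \<pi>2 f" if "f \<in> L2 \<pi>2" for f :: "'a \<times> 'a \<Rightarrow> 'a"
    using L2_distr[OF fs(2) L2_measurable[OF that]] L2norm_distr[OF fs(2) L2_measurable[OF that]] that
    by (simp add: M)
  have lawX: "distr M borel (\<lambda>z. fst (fst z)) = \<mu>"
    using distr_distr[of fst \<pi>1 borel fst M] M(1) 1(3) by (simp add: comp_def)
  have lawZ: "distr M borel (\<lambda>z. snd (snd z)) = \<rho>"
    using distr_distr[of snd \<pi>2 borel snd M] M(2) 2(4) by (simp add: comp_def)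
  have "norm (snd (fst z) - fst (snd z)) \<le> e / 3" if "0 < k z" for z
    using that by (intro q(2)) (simp add: k_def split: if_splits)
  then have same: "AE z in M. norm (snd (fst z) - fst (snd z)) \<le> e / 3"
    unfolding M_def by (subst AE_density[OF k]) blast
  have "W2 \<mu> \<rho> \<le> L2norm M (\<lambda>z. fst (fst z) - snd (snd z))"
    using W2_le_L2norm[OF M(3), of "\<lambda>z. fst (fst z)" "\<lambda>z. snd (snd z)"] X[OF 1(5)] Y[OF 2(6)]
    by (simp add: lawX lawZ)
  also have "\<dots> \<le> L2norm M (\<lambda>z. fst (fst z) - snd (fst z)) + L2norm M (\<lambda>z. snd (fst z) - snd (snd z))"
    using X[OF 1(5)] X[OF 1(6)] Y[OF 2(6)] by (intro L2norm_diff_triangle) auto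
  also have "L2norm M (\<lambda>z. snd (fst z) - snd (snd z))
      \<le> L2norm M (\<lambda>z. snd (fst z) - fst (snd z)) + L2norm M (\<lambda>z. fst (snd z) - snd (snd z))"
    using X[OF 1(6)] Y[OF 2(5)] Y[OF 2(6)] by (intro L2norm_diff_triangle) auto
  also have "L2norm M (\<lambda>z. snd (fst z) - fst (snd z)) \<le> e / 3"
    using same e3 by (intro M.L2norm_le_bound) auto
  also have "L2norm M (\<lambda>z. fst (fst z) - snd (fst z)) < W2 \<mu> \<nu> + e / 3"
    using X[OF L2_diff[OF 1(5,6)]] 1(7) by simp
  also have "L2norm M (\<lambda>z. fst (snd z) - snd (snd z)) < W2 \<nu> \<rho> + e / 3"
    using Y[OF L2_diff[OF 2(5,6)]] 2(7) by simp
  finally show "W2 \<mu> \<rho> \<le> W2 \<mu> \<nu> + W2 \<nu> \<rho> + e" by simp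
qed

lemma integral_diff_le_W2:
  fixes g :: "'a::euclidean_space \<Rightarrow> real"
  assumes P2: "\<mu> \<in> P2" "\<nu> \<in> P2" and bdd: "\<And>x. \<bar>g x\<bar> \<le> B"
    and lip: "\<And>x y. \<bar>g x - g y\<bar> \<le> L * norm (x - y)" and "0 \<le> L"
  shows "\<bar>(\<integral>x. g x \<partial>\<mu>) - (\<integral>x. g x \<partial>\<nu>)\<bar> \<le> L * W2 \<mu> \<nu>"
proof (rule field_le_epsilon)
  fix e :: real assume "0 < e"
  have "continuous_on UNIV g"
    using lip \<open>0 \<le> L\<close>
    by (intro lipschitz_on_continuous_on[of L] lipschitz_onI) (auto simp: dist_norm)
  then have [measurable]: "g \<in> borel_measurable borel" by (rule borel_measurable_continuous_onI)
  define d where "d = e / (L + 1)"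
  have "0 < d" using \<open>0 < e\<close> \<open>0 \<le> L\<close> by (simp add: d_def)
  obtain \<pi> :: "('a \<times> 'a) measure" where \<pi>: "prob_space \<pi>" "sets \<pi> = sets borel"
      "distr \<pi> borel fst = \<mu>" "distr \<pi> borel snd = \<nu>"
      "fst \<in> L2 \<pi>" "snd \<in> L2 \<pi>" "L2norm \<pi> (\<lambda>z. fst z - snd z) < W2 \<mu> \<nu> + d"
    by (rule W2_coupling[OF P2 \<open>0 < d\<close>])
  note [measurable] = \<pi>(5,6)[THEN L2_measurable]
  interpret \<pi>: prob_space \<pi> by fact
  have i: "integrable \<pi> (\<lambda>z. g (fst z))" "integrable \<pi> (\<lambda>z. g (snd z))"
    using bdd by (intro \<pi>.integrable_const_bound[where B=B] AE_I2; simp)+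
  have "(\<integral>x. g x \<partial>\<mu>) - (\<integral>x. g x \<partial>\<nu>) = (\<integral>z. g (fst z) \<partial>\<pi>) - (\<integral>z. g (snd z) \<partial>\<pi>)"
    unfolding \<pi>(3,4)[symmetric] by (simp add: integral_distr)
  also have "\<dots> = (\<integral>z. g (fst z) - g (snd z) \<partial>\<pi>)"
    using i by (rule Bochner_Integration.integral_diff[symmetric])
  also have "\<bar>\<dots>\<bar> \<le> (\<integral>z. L * norm (fst z - snd z) \<partial>\<pi>)"
  proof (rule order_trans[OF integral_abs_bound integral_mono])
    show "integrable \<pi> (\<lambda>z. \<bar>g (fst z) - g (snd z)\<bar>)" using i by simp
    show "integrable \<pi> (\<lambda>z. L * norm (fst z - snd z))"
      using \<pi>.expectation_norm_le_L2norm(1)[OF L2_diff[OF \<pi>(5,6)]] by simp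
  qed (rule lip)
  also have "\<dots> \<le> L * L2norm \<pi> (\<lambda>z. fst z - snd z)"
    using \<pi>.expectation_norm_le_L2norm(2)[OF L2_diff[OF \<pi>(5,6)]] \<open>0 \<le> L\<close>
    by (simp add: mult_left_mono)
  also have "\<dots> \<le> L * (W2 \<mu> \<nu> + d)"
    using \<pi>(7) \<open>0 \<le> L\<close> by (intro mult_left_mono) auto
  also have "\<dots> \<le> L * W2 \<mu> \<nu> + e"
    using \<open>0 < e\<close> \<open>0 \<le> L\<close> by (simp add: d_def field_simps)
  finally show "\<bar>(\<integral>x. g x \<partial>\<mu>) - (\<integral>x. g x \<partial>\<nu>)\<bar> \<le> L * W2 \<mu> \<nu> + e" .
qed

text \<open>
  Bounded Lipschitz functions have the same integrals under two measures at distance zero, and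
  the functions \<open>max 0 (1 - n * infdist x C)\<close> decrease to the indicator of the closed set \<open>C\<close>.
\<close>
lemma W2_zero_imp_eq:
  fixes \<mu> \<nu> :: "'a::euclidean_space measure"
  assumes P2: "\<mu> \<in> P2" "\<nu> \<in> P2" and "W2 \<mu> \<nu> = 0"
  shows "\<mu> = \<nu>"
proof (rule measure_eqI_generator_eq[where \<Omega>=UNIV and E="{C. closed C}" and A="\<lambda>_. UNIV"])
  have sb: "sets \<mu> = sets borel" "sets \<nu> = sets borel" using P2[THEN P2_sets] .
  show "sets \<mu> = sigma_sets UNIV {C. closed C}" "sets \<nu> = sigma_sets UNIV {C. closed C}"
    unfolding sb borel_eq_closed by simp_all
  interpret \<mu>: prob_space \<mu> by (rule P2_prob[OF P2(1)])
  interpret \<nu>: prob_space \<nu> by (rule P2_prob[OF P2(2)])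
  fix C :: "'a set" assume "C \<in> {C. closed C}"
  then have C: "closed C" by simp
  show "emeasure \<mu> C = emeasure \<nu> C"
  proof (cases "C = {}")
    case False
    define g where "g = (\<lambda>(n::nat) x. max 0 (1 - real n * infdist x C))"
    have [measurable]: "g n \<in> borel_measurable borel" for n
      unfolding g_def by (intro borel_measurable_continuous_onI continuous_intros)
    have [measurable]: "g n \<in> borel_measurable \<mu>" "g n \<in> borel_measurable \<nu>" for n
      using measurable_cong_sets[OF sb(1) refl, of borel] measurable_cong_sets[OF sb(2) refl, of borel] by auto
    have g1: "\<bar>g n x\<bar> \<le> 1" for n x
      using infdist_nonneg[of x C] by (auto simp: g_def max_def)
    have eq: "(\<integral>x. g n x \<partial>\<mu>) = (\<integral>x. g n x \<partial>\<nu>)" for n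
    proof -
      have "\<bar>g n x - g n y\<bar> \<le> real n * norm (x - y)" for x y
      proof -
        have "\<bar>infdist x C - infdist y C\<bar> \<le> dist x y" by (rule infdist_triangle_abs)
        then have "\<bar>real n * infdist x C - real n * infdist y C\<bar> \<le> real n * norm (x - y)"
          unfolding right_diff_distrib[symmetric] abs_mult by (simp add: dist_norm mult_left_mono)
        then show ?thesis by (simp add: g_def max_def abs_le_iff)
      qed
      then have "\<bar>(\<integral>x. g n x \<partial>\<mu>) - (\<integral>x. g n x \<partial>\<nu>)\<bar> \<le> real n * W2 \<mu> \<nu>"
        by (intro integral_diff_le_W2[OF P2 g1]) auto
      then show ?thesis by (simp add: assms(3))
    qed
    have lim: "(\<lambda>n. g n x) \<longlonglongrightarrow> indicator C x" for x
    proof (cases "x \<in> C")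
      case True
      then show ?thesis by (simp add: g_def)
    next
      case x: False
      then have "0 < infdist x C"
        using in_closed_iff_infdist_zero[OF C False] infdist_nonneg[of x C] by (simp add: less_le)
      then obtain N :: nat where N: "1 < real N * infdist x C"
        using reals_Archimedean3 by blast
      have "eventually (\<lambda>n. g n x = 0) sequentially"
        using eventually_ge_at_top[of N]
      proof eventually_elim
        case (elim n)
        have "real N * infdist x C \<le> real n * infdist x C"
          using elim infdist_nonneg[of x C] by (intro mult_right_mono) auto
        then show ?case using N by (simp add: g_def infdist_nonneg)
      qed
      then show ?thesis using x by (simp add: tendsto_eventually)
    qed
    have Cm: "C \<in> sets \<mu>" "C \<in> sets \<nu>" using C sb by auto
    have "(\<lambda>n. \<integral>x. g n x \<partial>\<mu>) \<longlonglongrightarrow> (\<integral>x. indicator C x \<partial>\<mu>)"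
      using lim g1 Cm by (intro integral_dominated_convergence[where w="\<lambda>_. 1"] AE_I2) auto
    moreover have "(\<lambda>n. \<integral>x. g n x \<partial>\<nu>) \<longlonglongrightarrow> (\<integral>x. indicator C x \<partial>\<nu>)"
      using lim g1 Cm by (intro integral_dominated_convergence[where w="\<lambda>_. 1"] AE_I2) auto
    ultimately have "measure \<mu> C = measure \<nu> C"
      using LIMSEQ_unique Cm by (simp add: eq sb[THEN sets_eq_imp_space_eq]) blast
    then show ?thesis by (simp add: \<mu>.emeasure_eq_measure \<nu>.emeasure_eq_measure)
  qed simp
next
  interpret \<mu>: prob_space \<mu> by (rule P2_prob[OF P2(1)])
  show "emeasure \<mu> UNIV \<noteq> \<infinity>" for i :: nat by (simp add: \<mu>.emeasure_finite)
qed (auto simp: Int_stable_def)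

lemma W2_self: "W2 \<mu> \<mu> = 0"
proof (cases "\<mu> \<in> P2")
  case True
  have "distr \<mu> borel (\<lambda>x. x) = \<mu>" by (rule distr_id2[OF P2_sets[OF True, symmetric]])
  then have "W2 \<mu> \<mu> \<le> 0"
    using W2_le_L2norm[OF P2_prob[OF True] P2_L2[OF True] P2_L2[OF True]] by (simp add: L2norm_def)
  then show ?thesis using W2_nonneg[of \<mu> \<mu>] by simp
qed (simp add: W2_def)

lemma Metric_space_W2: "Metric_space (P2 :: 'a::euclidean_space measure set) W2"
  by unfold_locales
    (auto simp: W2_nonneg W2_commute W2_triangle W2_self intro: W2_zero_imp_eq)

interpretation W2: Metric_space "P2 :: 'a::euclidean_space measure set" W2
  by (rule Metric_space_W2)

section \<open>Functions with bounded partial derivatives\<close>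

text \<open>
  Two applications of the mean value inequality; hence the constant is \<open>C\<close> rather than \<open>C / 2\<close>.
\<close>
lemma DERIV_taylor2_bound:
  fixes g g' g'' :: "real \<Rightarrow> real"
  assumes d1: "\<And>y. (g has_real_derivative g' y) (at y)"
    and d2: "\<And>y. (g' has_real_derivative g'' y) (at y)"
    and b: "\<And>y. y \<in> closed_segment a x \<Longrightarrow> \<bar>g'' y\<bar> \<le> C"
  shows "\<bar>g x - g a - (x - a) * g' a\<bar> \<le> C * (x - a)\<^sup>2"
proof -
  have g': "\<bar>g' y - g' a\<bar> \<le> C * \<bar>x - a\<bar>" if y: "y \<in> closed_segment a x" for y
  proof -
    have "norm (g' y - g' a) \<le> C * norm (y - a)"
      using y b by (intro field_differentiable_bound[of "closed_segment a x" g' g''])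
        (auto intro: has_field_derivative_at_within[OF d2])
    also have "\<dots> \<le> C * \<bar>x - a\<bar>"
    proof (rule mult_left_mono)
      show "norm (y - a) \<le> \<bar>x - a\<bar>" using y by (auto simp: closed_segment_eq_real_ivl split: if_splits)
      show "0 \<le> C" using b[OF ends_in_segment(1)] by (rule order_trans[OF abs_ge_zero])
    qed
    finally show ?thesis by simp
  qed
  have "norm ((g x - x * g' a) - (g a - a * g' a)) \<le> (C * \<bar>x - a\<bar>) * norm (x - a)"
  proof (rule field_differentiable_bound[of "closed_segment a x" _ "\<lambda>y. g' y - g' a"])
    show "((\<lambda>y. g y - y * g' a) has_real_derivative g' z - g' a) (at z within closed_segment a x)" for z
      by (rule has_field_derivative_at_within) (auto intro!: derivative_eq_intros d1)
  qed (use g' in auto)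
  moreover have "(C * \<bar>x - a\<bar>) * norm (x - a) = C * (x - a)\<^sup>2"
    by (simp add: power2_eq_square mult.assoc flip: abs_mult)
  ultimately show ?thesis by (simp add: algebra_simps)
qed

lemma DERIV_of_quadratic_remainder:
  fixes K :: "real \<Rightarrow> real"
  assumes "\<And>y. \<bar>y - x\<bar> \<le> 1 \<Longrightarrow> \<bar>K y - K x - (y - x) * D\<bar> \<le> C * (y - x)\<^sup>2"
  shows "(K has_real_derivative D) (at x)"
proof -
  have C: "0 \<le> C" using assms[of "x + 1"] by (simp add: order_trans[OF abs_ge_zero])
  have "((\<lambda>y. (K y - K x) / (y - x)) \<longlongrightarrow> D) (at x)"
  proof (rule Lim_transform_bound[THEN LIM_zero_cancel, rotated])
    show "((\<lambda>y. C * \<bar>y - x\<bar>) \<longlongrightarrow> 0) (at x)"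
      by (auto intro!: tendsto_eq_intros)
    have "eventually (\<lambda>y. y \<in> ball x 1 - {x}) (at x)"
      by (intro eventually_at_in_open) auto
    then show "eventually (\<lambda>y. norm ((K y - K x) / (y - x) - D) \<le> norm (C * \<bar>y - x\<bar>)) (at x)"
    proof eventually_elim
      case (elim y)
      then have y: "\<bar>y - x\<bar> \<le> 1" "y - x \<noteq> 0" by (auto simp: dist_real_def)
      have "\<bar>(K y - K x) / (y - x) - D\<bar> = \<bar>K y - K x - (y - x) * D\<bar> / \<bar>y - x\<bar>"
        using y(2) by (simp add: field_simps flip: abs_divide)
      also have "\<dots> \<le> C * (y - x)\<^sup>2 / \<bar>y - x\<bar>"
        using assms[OF y(1)] by (rule divide_right_mono) simp
      also have "\<dots> = C * \<bar>y - x\<bar>"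
        using y(2) by (simp add: power2_eq_square field_simps flip: abs_mult)
      finally show ?case using C by (simp add: abs_mult)
    qed
  qed
  then show ?thesis by (simp add: has_field_derivative_iff)
qed

text \<open>
  The coordinates are shifted one after the other, so that only derivatives in one real variable
  occur.
\<close>
lemma partial_derivs_imp_lipschitz:
  fixes f :: "('i \<Rightarrow> real) \<Rightarrow> real"
  assumes "finite J"
    and d: "\<And>s i. i \<in> J \<Longrightarrow> ((\<lambda>y. f (s(i := y))) has_real_derivative D i s) (at (s i))"
    and b: "\<And>s i. i \<in> J \<Longrightarrow> \<bar>D i s\<bar> \<le> C"
  shows "\<bar>f (\<lambda>i. if i \<in> J then s i + t i else s i) - f s\<bar> \<le> C * (\<Sum>i\<in>J. \<bar>t i\<bar>)"
  using assms
proof (induction J)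
  case (insert i J)
  define s' where "s' = (\<lambda>i. if i \<in> J then s i + t i else s i)"
  have s'i: "s' i = s i" using insert.hyps by (simp add: s'_def)
  have eq: "(\<lambda>k. if k \<in> insert i J then s k + t k else s k) = s'(i := s i + t i)"
    using insert.hyps by (auto simp: s'_def fun_eq_iff)
  have der: "((\<lambda>y. f (s'(i := y))) has_real_derivative D i (s'(i := y))) (at y)" for y
    using insert.prems(1)[OF insertI1, of "s'(i := y)"] by (simp only: fun_upd_upd fun_upd_same)
  have "norm (f (s'(i := s i + t i)) - f (s'(i := s i))) \<le> C * norm (s i + t i - s i)"
    using insert.prems(2)[of i]
    by (intro field_differentiable_bound[OF convex_UNIV, of "\<lambda>y. f (s'(i := y))" "\<lambda>y. D i (s'(i := y))"] der) auto
  moreover have "s'(i := s i) = s'" using s'i by auto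
  moreover have "\<bar>f s' - f s\<bar> \<le> C * (\<Sum>i\<in>J. \<bar>t i\<bar>)"
    unfolding s'_def using insert.prems by (intro insert.IH) auto
  ultimately show ?case
    unfolding eq using insert.hyps by (simp add: distrib_left)
qed simp

text \<open>
  Again the coordinates are shifted one after the other. The derivative in the next coordinate is
  then taken at a partially shifted point, which costs a product of two increments since that
  derivative is itself Lipschitz.
\<close>
lemma partial_derivs_imp_taylor:
  fixes f :: "('i \<Rightarrow> real) \<Rightarrow> real"
  assumes "finite J"
    and d: "\<And>s i. i \<in> J \<Longrightarrow> ((\<lambda>y. f (s(i := y))) has_real_derivative D i s) (at (s i))"
    and d2: "\<And>s i j. i \<in> J \<Longrightarrow> j \<in> J \<Longrightarrow> ((\<lambda>y. D i (s(j := y))) has_real_derivative H i j s) (at (s j))"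
    and b: "\<And>s i j. i \<in> J \<Longrightarrow> j \<in> J \<Longrightarrow> \<bar>H i j s\<bar> \<le> C" and C: "0 \<le> C"
  shows "\<bar>f (\<lambda>i. if i \<in> J then s i + t i else s i) - f s - (\<Sum>i\<in>J. t i * D i s)\<bar> \<le> C * (\<Sum>i\<in>J. \<bar>t i\<bar>)\<^sup>2"
  using assms(1-4)
proof (induction J)
  case (insert i J)
  define s' where "s' = (\<lambda>i. if i \<in> J then s i + t i else s i)"
  define S where "S = (\<Sum>i\<in>J. \<bar>t i\<bar>)"
  have S: "0 \<le> S" by (auto simp: S_def intro: sum_nonneg)
  have s'i: "s' i = s i" using insert.hyps by (simp add: s'_def)
  have eq: "(\<lambda>k. if k \<in> insert i J then s k + t k else s k) = s'(i := s i + t i)"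
    using insert.hyps by (auto simp: s'_def fun_eq_iff)
  have s's: "s'(i := s i) = s'" using s'i by auto
  have 1: "\<bar>f (s'(i := s i + t i)) - f (s'(i := s i)) - (s i + t i - s i) * D i (s'(i := s i))\<bar>
      \<le> C * (s i + t i - s i)\<^sup>2"
  proof (rule DERIV_taylor2_bound[where g="\<lambda>y. f (s'(i := y))" and g'="\<lambda>y. D i (s'(i := y))"
        and g''="\<lambda>y. H i i (s'(i := y))"])
    show "((\<lambda>y. f (s'(i := y))) has_real_derivative D i (s'(i := y))) (at y)" for y
      using insert.prems(1)[OF insertI1, of "s'(i := y)"] by (simp only: fun_upd_upd fun_upd_same)
    show "((\<lambda>y. D i (s'(i := y))) has_real_derivative H i i (s'(i := y))) (at y)" for y
      using insert.prems(2)[OF insertI1 insertI1, of "s'(i := y)"] by (simp only: fun_upd_upd fun_upd_same)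
  qed (use insert.prems(3) in auto)
  have 2: "\<bar>f s' - f s - (\<Sum>i\<in>J. t i * D i s)\<bar> \<le> C * S\<^sup>2"
    unfolding s'_def S_def using insert.prems by (intro insert.IH) auto
  have "\<bar>D i s' - D i s\<bar> \<le> C * S"
    unfolding s'_def S_def using insert.prems insert.hyps
    by (intro partial_derivs_imp_lipschitz[where D="H i"]) auto
  then have "\<bar>t i\<bar> * \<bar>D i s' - D i s\<bar> \<le> \<bar>t i\<bar> * (C * S)" by (rule mult_left_mono) simp
  then have 3: "\<bar>t i * D i s' - t i * D i s\<bar> \<le> C * (\<bar>t i\<bar> * S)"
    by (simp add: abs_mult right_diff_distrib[symmetric] mult_ac)
  have "(\<Sum>k\<in>insert i J. \<bar>t k\<bar>)\<^sup>2 = (\<bar>t i\<bar> + S)\<^sup>2" using insert.hyps by (simp add: S_def)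
  also have "\<dots> = (t i)\<^sup>2 + S\<^sup>2 + 2 * (\<bar>t i\<bar> * S)" by (simp add: power2_sum)
  finally have sq: "C * (\<Sum>k\<in>insert i J. \<bar>t k\<bar>)\<^sup>2 = C * (t i)\<^sup>2 + C * S\<^sup>2 + 2 * (C * (\<bar>t i\<bar> * S))"
    by (simp add: algebra_simps)
  have "0 \<le> C * (\<bar>t i\<bar> * S)" using C S by simp
  moreover have "(\<Sum>k\<in>insert i J. t k * D k s) = t i * D i s + (\<Sum>k\<in>J. t k * D k s)"
    using insert.hyps by simp
  ultimately show ?case using 1 2 3 unfolding eq sq s's by simp
qed simp

section \<open>Mollification by Gaussians times polynomials\<close>

text \<open>
  A family of mollifiers that is closed under differentiation. Its members need neither be
  nonnegative nor have integral 1.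
\<close>
definition gauss_poly :: "real \<Rightarrow> real poly \<Rightarrow> real \<Rightarrow> real" where
  "gauss_poly c p x = poly p x * exp (- c * x\<^sup>2)"

text \<open>
  The polynomial factor of the derivative.
\<close>
definition gauss_pderiv :: "real \<Rightarrow> real poly \<Rightarrow> real poly" where
  "gauss_pderiv c p = pderiv p - [:0, 2 * c:] * p"

lemma gauss_poly_measurable [measurable]: "gauss_poly c p \<in> borel_measurable borel"
  unfolding gauss_poly_def
  by (intro borel_measurable_continuous_onI continuous_intros)

lemma gauss_poly_deriv:
  "(gauss_poly c p has_real_derivative gauss_poly c (gauss_pderiv c p) x) (at x)"
  unfolding gauss_poly_def
  by (auto intro!: derivative_eq_intros simp: gauss_pderiv_def algebra_simps)

text \<open>
  The rate \<open>a\<close> is arbitrary because the induction over the coefficients halves it.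
\<close>
lemma poly_le_exp:
  fixes p :: "real poly"
  assumes "0 < a"
  shows "\<exists>C\<ge>0. \<forall>x. \<bar>poly p x\<bar> \<le> C * exp (a * \<bar>x\<bar>)"
  using assms
proof (induction p arbitrary: a)
  case (pCons k p)
  from pCons.IH[of "a / 2"] pCons.prems obtain C where C: "0 \<le> C" "\<And>x. \<bar>poly p x\<bar> \<le> C * exp (a / 2 * \<bar>x\<bar>)"
    by auto
  have "\<bar>poly (pCons k p) x\<bar> \<le> (\<bar>k\<bar> + 2 / a * C) * exp (a * \<bar>x\<bar>)" for x
  proof -
    have "a / 2 * \<bar>x\<bar> \<le> exp (a / 2 * \<bar>x\<bar>)" using exp_ge_add_one_self[of "a / 2 * \<bar>x\<bar>"] by linarith
    then have x: "\<bar>x\<bar> \<le> 2 / a * exp (a / 2 * \<bar>x\<bar>)" using pCons.prems by (simp add: field_simps)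
    have "\<bar>x\<bar> * \<bar>poly p x\<bar> \<le> (2 / a * exp (a / 2 * \<bar>x\<bar>)) * (C * exp (a / 2 * \<bar>x\<bar>))"
      using C(2)[of x] x by (intro mult_mono) (auto intro: order_trans[OF abs_ge_zero])
    also have "\<dots> = 2 / a * C * (exp (a / 2 * \<bar>x\<bar>) * exp (a / 2 * \<bar>x\<bar>))" by simp
    also have "exp (a / 2 * \<bar>x\<bar>) * exp (a / 2 * \<bar>x\<bar>) = exp (a * \<bar>x\<bar>)" by (simp add: exp_add[symmetric])
    finally have 1: "\<bar>x * poly p x\<bar> \<le> 2 / a * C * exp (a * \<bar>x\<bar>)" by (simp add: abs_mult)
    have "1 \<le> exp (a * \<bar>x\<bar>)" using pCons.prems by simp
    then have 2: "\<bar>k\<bar> \<le> \<bar>k\<bar> * exp (a * \<bar>x\<bar>)" by (simp add: mult_le_cancel_left1)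
    have "\<bar>poly (pCons k p) x\<bar> \<le> \<bar>k\<bar> + \<bar>x * poly p x\<bar>" by simp
    also have "\<dots> \<le> \<bar>k\<bar> * exp (a * \<bar>x\<bar>) + 2 / a * C * exp (a * \<bar>x\<bar>)" using 1 2 by (rule add_mono[rotated])
    finally show ?thesis by (simp add: distrib_right)
  qed
  then show ?case using C(1) pCons.prems by (intro exI[of _ "\<bar>k\<bar> + 2 / a * C"]) auto
qed (auto intro: exI[of _ 0])

text \<open>
  Half of the exponent absorbs the growth of the polynomial.
\<close>
lemma gauss_poly_bound:
  assumes c: "0 < c"
  obtains C where "0 \<le> C" "\<And>x. \<bar>gauss_poly c p x\<bar> \<le> C * exp (- (c / 2) * x\<^sup>2)"
proof -
  obtain C where C: "0 \<le> C" "\<And>x. \<bar>poly p x\<bar> \<le> C * exp (1 * \<bar>x\<bar>)"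
    using poly_le_exp[of 1 p] by auto
  have "\<bar>gauss_poly c p x\<bar> \<le> (C * exp (1 / (2 * c))) * exp (- (c / 2) * x\<^sup>2)" for x
  proof -
    have "0 \<le> (\<bar>x\<bar> * c - 1)\<^sup>2 / (2 * c)" using c by simp
    also have "\<dots> = c / 2 * x\<^sup>2 + 1 / (2 * c) - \<bar>x\<bar>"
      using c by (simp add: power2_diff field_simps power2_eq_square)
    finally have le: "\<bar>x\<bar> - c * x\<^sup>2 \<le> 1 / (2 * c) - (c / 2) * x\<^sup>2" by simp
    have "\<bar>gauss_poly c p x\<bar> = \<bar>poly p x\<bar> * exp (- c * x\<^sup>2)" by (simp add: gauss_poly_def abs_mult)
    also have "\<dots> \<le> C * exp \<bar>x\<bar> * exp (- c * x\<^sup>2)" using C(2)[of x] by (intro mult_right_mono) auto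
    also have "\<dots> = C * exp (\<bar>x\<bar> - c * x\<^sup>2)" by (simp add: exp_diff exp_minus field_simps)
    also have "\<dots> \<le> C * exp (1 / (2 * c) - (c / 2) * x\<^sup>2)" using le C(1) by (intro mult_left_mono) auto
    also have "\<dots> = (C * exp (1 / (2 * c))) * exp (- (c / 2) * x\<^sup>2)"
      by (simp add: mult.assoc flip: exp_add)
    finally show ?thesis .
  qed
  then show ?thesis using that[of "C * exp (1 / (2 * c))"] C(1) by simp
qed

lemma integrable_exp_minus_square:
  assumes "0 < a"
  shows "integrable lborel (\<lambda>x::real. exp (- a * x\<^sup>2))"
proof -
  define \<sigma> where "\<sigma> = sqrt (1 / (2 * a))"
  have \<sigma>: "0 < \<sigma>" "\<sigma>\<^sup>2 = 1 / (2 * a)" using assms by (auto simp: \<sigma>_def)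
  have "integrable lborel (\<lambda>x. sqrt (2 * pi * \<sigma>\<^sup>2) * normal_density 0 \<sigma> x)"
    using integrable_normal_moment[OF \<sigma>(1), of 0 0] by (intro integrable_mult_right) simp
  moreover have "sqrt (2 * pi * \<sigma>\<^sup>2) * normal_density 0 \<sigma> x = exp (- a * x\<^sup>2)" for x
    using \<sigma> assms by (simp add: normal_density_def)
  ultimately show ?thesis by simp
qed

lemma gauss_poly_integrable:
  assumes "0 < c"
  shows "integrable lborel (gauss_poly c p)"
proof -
  obtain C where C: "0 \<le> C" "\<And>x. \<bar>gauss_poly c p x\<bar> \<le> C * exp (- (c / 2) * x\<^sup>2)"
    by (rule gauss_poly_bound[OF assms]) blast
  have "integrable lborel (\<lambda>x. C * exp (- (c / 2) * x\<^sup>2))"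
    using integrable_exp_minus_square[of "c / 2"] assms by (intro integrable_mult_right) auto
  then show ?thesis
    by (rule Bochner_Integration.integrable_bound) (use C in \<open>auto intro!: AE_I2 order_trans[OF _ abs_ge_self]\<close>)
qed

text \<open>
  The second derivative is again a polynomial times a Gaussian. On shifts of size at most 1 half of
  its exponent is lost, which leaves an integrable constant \<open>E\<close>.
\<close>
lemma gauss_poly_taylor:
  assumes c: "0 < c"
  obtains E where "integrable lborel E" "\<And>x. 0 \<le> E x"
    "\<And>x t. \<bar>t\<bar> \<le> 1 \<Longrightarrow>
      \<bar>gauss_poly c p (x + t) - gauss_poly c p x - t * gauss_poly c (gauss_pderiv c p) x\<bar> \<le> E x * t\<^sup>2"
proof -
  define p1 where "p1 = gauss_pderiv c p"
  define p2 where "p2 = gauss_pderiv c p1"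
  obtain C where C: "0 \<le> C" "\<And>x. \<bar>gauss_poly c p2 x\<bar> \<le> C * exp (- (c / 2) * x\<^sup>2)"
    by (rule gauss_poly_bound[OF c]) blast
  define E where "E = (\<lambda>x::real. C * exp (c / 2) * exp (- (c / 4) * x\<^sup>2))"
  show ?thesis
  proof
    show "integrable lborel E"
      unfolding E_def using integrable_exp_minus_square[of "c / 4"] c by (intro integrable_mult_right) auto
    show "0 \<le> E x" for x using C(1) by (simp add: E_def)
    fix x t :: real assume t: "\<bar>t\<bar> \<le> 1"
    have bound: "\<bar>gauss_poly c p2 y\<bar> \<le> E x" if y: "y \<in> closed_segment x (x + t)" for y
    proof -
      have "\<bar>y - x\<bar> \<le> 1"
        using y t by (auto simp: closed_segment_eq_real_ivl split: if_splits)
      then have "(y - x)\<^sup>2 \<le> 1" by (simp add: abs_square_le_1)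
      moreover have "0 \<le> (2 * y - x)\<^sup>2" by simp
      moreover have "2 * y\<^sup>2 - x\<^sup>2 + 2 * (y - x)\<^sup>2 = (2 * y - x)\<^sup>2"
        by (simp add: power2_eq_square algebra_simps)
      ultimately have "x\<^sup>2 \<le> 2 * y\<^sup>2 + 2" by linarith
      then have "c / 4 * x\<^sup>2 \<le> c / 4 * (2 * y\<^sup>2 + 2)" using c by (intro mult_left_mono) auto
      then have le: "- (c / 2) * y\<^sup>2 \<le> c / 2 + - (c / 4) * x\<^sup>2" by (simp add: algebra_simps)
      have "\<bar>gauss_poly c p2 y\<bar> \<le> C * exp (- (c / 2) * y\<^sup>2)" by (rule C(2))
      also have "\<dots> \<le> C * exp (c / 2 + - (c / 4) * x\<^sup>2)" using le C(1) by (intro mult_left_mono) auto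
      also have "\<dots> = E x" by (simp add: E_def exp_add[symmetric] mult.assoc)
      finally show ?thesis .
    qed
    show "\<bar>gauss_poly c p (x + t) - gauss_poly c p x - t * gauss_poly c (gauss_pderiv c p) x\<bar> \<le> E x * t\<^sup>2"
      using DERIV_taylor2_bound[of "gauss_poly c p" "gauss_poly c p1" "gauss_poly c p2" x "x + t" "E x"]
        gauss_poly_deriv bound by (simp add: p1_def p2_def)
  qed
qed

text \<open>
  Each coordinate has its own polynomial, so that partial derivatives stay within the family: they
  replace one polynomial (\<open>mollify_deriv\<close>).
\<close>
definition mollify ::
  "real \<Rightarrow> 'i set \<Rightarrow> (('i \<Rightarrow> real) \<Rightarrow> real) \<Rightarrow> ('i \<Rightarrow> real poly) \<Rightarrow> ('i \<Rightarrow> real) \<Rightarrow> real" where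
  "mollify c I h p s = (\<integral>z. h z * (\<Prod>i\<in>I. gauss_poly c (p i) (s i - z i)) \<partial>PiM I (\<lambda>_. lborel))"

context
  fixes c B :: real and I :: "'i set" and h :: "('i \<Rightarrow> real) \<Rightarrow> real"
  assumes c: "0 < c" and I: "finite I"
    and h [measurable]: "h \<in> borel_measurable (PiM I (\<lambda>_. lborel))" and B: "\<And>z. \<bar>h z\<bar> \<le> B"
begin

interpretation lb: product_sigma_finite "\<lambda>_::'i. lborel :: real measure" ..

lemma mollify_integrable_prod:
  assumes "\<And>i. i \<in> I \<Longrightarrow> integrable lborel (f i)"
  shows "integrable (PiM I (\<lambda>_. lborel)) (\<lambda>z. h z * (\<Prod>i\<in>I. f i (z i)))"
proof (rule Bochner_Integration.integrable_bound)
  have i: "integrable (PiM I (\<lambda>_. lborel)) (\<lambda>z. (\<Prod>i\<in>I. f i (z i)))"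
    by (rule lb.product_integrable_prod[OF I assms])
  show "integrable (PiM I (\<lambda>_. lborel)) (\<lambda>z. B * (\<Prod>i\<in>I. f i (z i)))"
    using i by (rule integrable_mult_right)
  show "(\<lambda>z. h z * (\<Prod>i\<in>I. f i (z i))) \<in> borel_measurable (PiM I (\<lambda>_. lborel))"
    using borel_measurable_integrable[OF i] h by (rule borel_measurable_times[rotated])
  show "AE z in PiM I (\<lambda>_. lborel). norm (h z * (\<Prod>i\<in>I. f i (z i))) \<le> norm (B * (\<Prod>i\<in>I. f i (z i)))"
    using B by (intro AE_I2) (simp add: abs_mult mult_right_mono order_trans[OF B abs_ge_self])
qed

lemma gauss_poly_reflected_integrable: "integrable lborel (\<lambda>x. gauss_poly c q (s - x))"
  using lborel_integrable_real_affine[OF gauss_poly_integrable[OF c, of q], of "-1" s] by simp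

lemma mollify_integrable:
  "integrable (PiM I (\<lambda>_. lborel)) (\<lambda>z. h z * (\<Prod>i\<in>I. gauss_poly c (p i) (s i - z i)))"
  by (rule mollify_integrable_prod) (rule gauss_poly_reflected_integrable)

lemma mollify_bounded: "\<bar>mollify c I h p s\<bar> \<le> B * (\<Prod>i\<in>I. \<integral>x. \<bar>gauss_poly c (p i) x\<bar> \<partial>lborel)"
proof -
  have B0: "0 \<le> B" using B[of undefined] by (rule order_trans[OF abs_ge_zero])
  have i: "integrable (PiM I (\<lambda>_. lborel)) (\<lambda>z. (\<Prod>i\<in>I. \<bar>gauss_poly c (p i) (s i - z i)\<bar>))"
    by (rule lb.product_integrable_prod[OF I]) (intro integrable_abs gauss_poly_reflected_integrable)
  have "\<bar>mollify c I h p s\<bar> \<le> (\<integral>z. B * (\<Prod>i\<in>I. \<bar>gauss_poly c (p i) (s i - z i)\<bar>) \<partial>PiM I (\<lambda>_. lborel))"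
    unfolding mollify_def
  proof (rule order_trans[OF integral_abs_bound integral_mono])
    show "integrable (PiM I (\<lambda>_. lborel)) (\<lambda>z. \<bar>h z * (\<Prod>i\<in>I. gauss_poly c (p i) (s i - z i))\<bar>)"
      by (intro integrable_abs mollify_integrable)
    show "integrable (PiM I (\<lambda>_. lborel)) (\<lambda>z. B * (\<Prod>i\<in>I. \<bar>gauss_poly c (p i) (s i - z i)\<bar>))"
      using i by (rule integrable_mult_right)
    show "\<bar>h z * (\<Prod>i\<in>I. gauss_poly c (p i) (s i - z i))\<bar> \<le> B * (\<Prod>i\<in>I. \<bar>gauss_poly c (p i) (s i - z i)\<bar>)" for z
      using B by (simp add: abs_mult abs_prod mult_right_mono prod_nonneg)
  qed
  also have "\<dots> = B * (\<Prod>i\<in>I. \<integral>x. \<bar>gauss_poly c (p i) (s i - x)\<bar> \<partial>lborel)"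
    using lb.product_integral_prod[OF I, of "\<lambda>i x. \<bar>gauss_poly c (p i) (s i - x)\<bar>"]
      gauss_poly_reflected_integrable by simp
  also have "(\<Prod>i\<in>I. \<integral>x. \<bar>gauss_poly c (p i) (s i - x)\<bar> \<partial>lborel) = (\<Prod>i\<in>I. \<integral>x. \<bar>gauss_poly c (p i) x\<bar> \<partial>lborel)"
    using lborel_integral_real_affine[of "-1" "\<lambda>x. \<bar>gauss_poly c (p i) x\<bar>" "s i" for i]
    by (intro prod.cong) simp_all
  finally show ?thesis .
qed

text \<open>
  Taylor's formula for the mollifier is used under the integral, with an integrable constant; the
  function \<open>h\<close> itself enters only through its bound.
\<close>
lemma mollify_deriv:
  assumes i: "i \<in> I"
  shows "((\<lambda>y. mollify c I h p (s(i := y))) has_real_derivative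
    mollify c I h (p(i := gauss_pderiv c (p i))) s) (at (s i))"
proof -
  obtain E where E: "integrable lborel E" "\<And>x. 0 \<le> E x"
    "\<And>x t. \<bar>t\<bar> \<le> 1 \<Longrightarrow>
      \<bar>gauss_poly c (p i) (x + t) - gauss_poly c (p i) x - t * gauss_poly c (gauss_pderiv c (p i)) x\<bar> \<le> E x * t\<^sup>2"
    by (rule gauss_poly_taylor[OF c]) blast
  define P where "P = (\<lambda>z. \<Prod>j\<in>I-{i}. gauss_poly c (p j) (s j - z j))"
  define F where "F = (\<lambda>z. E (s i - z i) * \<bar>P z\<bar>)"
  have split: "(\<Prod>j\<in>I. gauss_poly c ((p(i := q)) j) ((s(i := y)) j - z j)) = gauss_poly c q (y - z i) * P z" for q y z
    unfolding P_def using i I by (subst prod.remove[of I i]) (auto intro!: prod.cong)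
  have mol: "mollify c I h (p(i := q)) (s(i := y)) = (\<integral>z. h z * (gauss_poly c q (y - z i) * P z) \<partial>PiM I (\<lambda>_. lborel))"
    and int: "integrable (PiM I (\<lambda>_. lborel)) (\<lambda>z. h z * (gauss_poly c q (y - z i) * P z))" for q y
    using mollify_integrable[of "p(i := q)" "s(i := y)"] unfolding mollify_def split by auto
  have F: "integrable (PiM I (\<lambda>_. lborel)) F"
  proof -
    have "integrable (PiM I (\<lambda>_. lborel)) (\<lambda>z. \<Prod>j\<in>I. (if j = i then E (s i - z j) else \<bar>gauss_poly c (p j) (s j - z j)\<bar>))"
    proof (rule lb.product_integrable_prod[OF I, of "\<lambda>j x. if j = i then E (s i - x) else \<bar>gauss_poly c (p j) (s j - x)\<bar>"])
      show "integrable lborel (\<lambda>x. if j = i then E (s i - x) else \<bar>gauss_poly c (p j) (s j - x)\<bar>)" for j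
        using lborel_integrable_real_affine[OF E(1), of "-1" "s i"] gauss_poly_reflected_integrable
        by (cases "j = i") auto
    qed
    also have "(\<lambda>z. \<Prod>j\<in>I. (if j = i then E (s i - z j) else \<bar>gauss_poly c (p j) (s j - z j)\<bar>)) = F"
      unfolding F_def P_def using i I
      by (auto simp: fun_eq_iff prod.remove[of I i] abs_prod intro!: arg_cong2[where f="(*)"] prod.cong)
    finally show ?thesis .
  qed
  define C where "C = B * (\<integral>z. F z \<partial>PiM I (\<lambda>_. lborel))"
  show ?thesis
  proof (rule DERIV_of_quadratic_remainder[where C=C])
    fix y assume y: "\<bar>y - s i\<bar> \<le> 1"
    define q where "q = gauss_pderiv c (p i)"
    define R where "R = (\<lambda>z. h z * (gauss_poly c (p i) (y - z i) * P z) - h z * (gauss_poly c (p i) (s i - z i) * P z)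
      - (y - s i) * (h z * (gauss_poly c q (s i - z i) * P z)))"
    have "mollify c I h p (s(i := y)) - mollify c I h p (s(i := s i)) - (y - s i) * mollify c I h (p(i := q)) s
        = (\<integral>z. R z \<partial>PiM I (\<lambda>_. lborel))"
      using mol[of "p i" y] mol[of "p i" "s i"] mol[of q "s i"]
        int[of "p i" y] int[of "p i" "s i"] int[of q "s i"] by (simp add: R_def)
    also have "\<bar>\<dots>\<bar> \<le> (\<integral>z. (B * (y - s i)\<^sup>2) * F z \<partial>PiM I (\<lambda>_. lborel))"
    proof (rule order_trans[OF integral_abs_bound integral_mono])
      show "integrable (PiM I (\<lambda>_. lborel)) (\<lambda>z. \<bar>R z\<bar>)"
        unfolding R_def by (intro integrable_abs Bochner_Integration.integrable_diff integrable_mult_right int)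
      show "integrable (PiM I (\<lambda>_. lborel)) (\<lambda>z. (B * (y - s i)\<^sup>2) * F z)"
        using F by (rule integrable_mult_right)
      fix z
      define r where "r = gauss_poly c (p i) ((s i - z i) + (y - s i)) - gauss_poly c (p i) (s i - z i)
        - (y - s i) * gauss_poly c q (s i - z i)"
      have "R z = h z * (r * P z)" by (simp add: R_def r_def algebra_simps)
      then have "\<bar>R z\<bar> = \<bar>h z\<bar> * (\<bar>r\<bar> * \<bar>P z\<bar>)" by (simp add: abs_mult)
      also have "\<dots> \<le> B * ((E (s i - z i) * (y - s i)\<^sup>2) * \<bar>P z\<bar>)"
        using B[of z] E(3)[OF y, of "s i - z i"] unfolding r_def q_def
        by (intro mult_mono) (auto intro: order_trans[OF abs_ge_zero])
      finally show "\<bar>R z\<bar> \<le> (B * (y - s i)\<^sup>2) * F z" by (simp add: F_def mult_ac)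
    qed
    also have "\<dots> = C * (y - s i)\<^sup>2" by (simp add: C_def mult_ac)
    finally show "\<bar>mollify c I h p (s(i := y)) - mollify c I h p (s(i := s i)) - (y - s i) * mollify c I h (p(i := q)) s\<bar>
        \<le> C * (y - s i)\<^sup>2" .
  qed
qed

lemma mollify_taylor:
  "\<exists>C\<ge>0. \<forall>s t. \<bar>mollify c I h p (\<lambda>i. s i + t i) - mollify c I h p s
      - (\<Sum>i\<in>I. t i * mollify c I h (p(i := gauss_pderiv c (p i))) s)\<bar> \<le> C * (\<Sum>i\<in>I. \<bar>t i\<bar>)\<^sup>2"
proof -
  define b where "b = (\<lambda>p. B * (\<Prod>i\<in>I. \<integral>x. \<bar>gauss_poly c (p i) x\<bar> \<partial>lborel))"
  define p1 where "p1 = (\<lambda>i. p(i := gauss_pderiv c (p i)))"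
  define p2 where "p2 = (\<lambda>i j. (p1 i)(j := gauss_pderiv c (p1 i j)))"
  define C where "C = (\<Sum>i\<in>I. \<Sum>j\<in>I. b (p2 i j))"
  have b: "\<bar>mollify c I h p s\<bar> \<le> b p" for p s
    unfolding b_def by (rule mollify_bounded)
  then have b0: "0 \<le> b p" for p by (rule order_trans[OF abs_ge_zero])
  have bC: "b (p2 i j) \<le> C" if "i \<in> I" "j \<in> I" for i j
  proof -
    have "b (p2 i j) \<le> (\<Sum>j\<in>I. b (p2 i j))" using that b0 I by (intro member_le_sum) auto
    also have "\<dots> \<le> C" unfolding C_def using that b0 I by (intro member_le_sum[of i I "\<lambda>i. \<Sum>j\<in>I. b (p2 i j)"] sum_nonneg) auto
    finally show ?thesis .
  qed
  have C0: "0 \<le> C" unfolding C_def by (intro sum_nonneg b0)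
  have "\<bar>mollify c I h p (\<lambda>i. if i \<in> I then s i + t i else s i) - mollify c I h p s
      - (\<Sum>i\<in>I. t i * mollify c I h (p1 i) s)\<bar> \<le> C * (\<Sum>i\<in>I. \<bar>t i\<bar>)\<^sup>2" for s t
  proof (rule partial_derivs_imp_taylor[where D="\<lambda>i. mollify c I h (p1 i)" and H="\<lambda>i j. mollify c I h (p2 i j)", OF I])
    show "((\<lambda>y. mollify c I h p (s(i := y))) has_real_derivative mollify c I h (p1 i) s) (at (s i))" if "i \<in> I" for s i
      unfolding p1_def by (rule mollify_deriv[OF that])
    show "((\<lambda>y. mollify c I h (p1 i) (s(j := y))) has_real_derivative mollify c I h (p2 i j) s) (at (s j))" if "j \<in> I" for s i j
      unfolding p2_def by (rule mollify_deriv[OF that])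
    show "\<bar>mollify c I h (p2 i j) s\<bar> \<le> C" if "i \<in> I" "j \<in> I" for s i j
      by (rule order_trans[OF b bC[OF that]])
  qed (rule C0)
  moreover have "mollify c I h p (\<lambda>i. if i \<in> I then s i + t i else s i) = mollify c I h p (\<lambda>i. s i + t i)" for s t
    unfolding mollify_def by (intro Bochner_Integration.integral_cong refl arg_cong2[where f="(*)"] prod.cong) auto
  ultimately show ?thesis using C0 unfolding p1_def by auto
qed

end

section \<open>Smooth kernels by Gaussian noise\<close>

text \<open>
  The functions of \<open>m\<close> vectors all of whose iterated partial gradients exist and are bounded.
  The quadratic bound on the Taylor remainder is uniform, which is what makes it possible to
  integrate it; it also implies that only the first \<open>m\<close> arguments matter.
\<close>
coinductive smooth_kernel :: "nat \<Rightarrow> ((nat \<Rightarrow> 'a::euclidean_space) \<Rightarrow> real) \<Rightarrow> bool" for m where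
  "(\<And>s. \<bar>f s\<bar> \<le> B) \<Longrightarrow>
   (\<And>s t. \<bar>f (\<lambda>l. s l + t l) - f s - (\<Sum>l<m. G l s \<bullet> t l)\<bar> \<le> C * (\<Sum>l<m. norm (t l))\<^sup>2) \<Longrightarrow>
   (\<And>l b. l < m \<Longrightarrow> b \<in> Basis \<Longrightarrow> smooth_kernel m (\<lambda>s. G l s \<bullet> b)) \<Longrightarrow> smooth_kernel m f"

text \<open>
  Mollification is carried out in the scalar coordinates of the \<open>m\<close> vectors, where calculus in one
  variable suffices.
\<close>
definition coords :: "(nat \<Rightarrow> 'a::euclidean_space) \<Rightarrow> nat \<times> 'a \<Rightarrow> real" where
  "coords s = (\<lambda>(l, b). s l \<bullet> b)"

text \<open>
  By coinduction: the components of the gradients of a mollification are mollifications of the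
  same function.
\<close>
lemma smooth_kernel_mollify:
  fixes h :: "(nat \<times> 'a::euclidean_space \<Rightarrow> real) \<Rightarrow> real"
  assumes c: "0 < c" and h: "h \<in> borel_measurable (PiM ({..<m} \<times> Basis) (\<lambda>_. lborel))"
    and B: "\<And>z. \<bar>h z\<bar> \<le> B"
  shows "smooth_kernel m (\<lambda>s. mollify c ({..<m} \<times> Basis) h p (coords s))"
proof -
  define I where "I = {..<m} \<times> (Basis :: 'a set)"
  have I: "finite I" by (simp add: I_def)
  have h': "h \<in> borel_measurable (PiM I (\<lambda>_. lborel))" using h by (simp add: I_def)
  have "smooth_kernel m f" if "\<exists>p. f = (\<lambda>s. mollify c I h p (coords s))" for f :: "(nat \<Rightarrow> 'a) \<Rightarrow> real"
    using that
  proof (coinduction arbitrary: f rule: smooth_kernel.coinduct)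
    case (smooth_kernel f)
    then obtain p where f: "f = (\<lambda>s. mollify c I h p (coords s))" by blast
    define p1 where "p1 = (\<lambda>l b. p((l, b) := gauss_pderiv c (p (l, b))))"
    define G where "G = (\<lambda>l s. \<Sum>b\<in>(Basis :: 'a set). mollify c I h (p1 l b) (coords s) *\<^sub>R b)"
    obtain C where C: "0 \<le> C" "\<And>s t. \<bar>mollify c I h p (\<lambda>i. s i + t i) - mollify c I h p s
      - (\<Sum>i\<in>I. t i * mollify c I h (p(i := gauss_pderiv c (p i))) s)\<bar> \<le> C * (\<Sum>i\<in>I. \<bar>t i\<bar>)\<^sup>2"
      using mollify_taylor[OF c I h' B, of p] by blast
    have "\<bar>f (\<lambda>l. s l + t l) - f s - (\<Sum>l<m. G l s \<bullet> t l)\<bar> \<le> (C * (real DIM('a))\<^sup>2) * (\<Sum>l<m. norm (t l))\<^sup>2" for s t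
    proof -
      have "(\<Sum>i\<in>I. coords t i * mollify c I h (p(i := gauss_pderiv c (p i))) (coords s))
          = (\<Sum>(l, b)\<in>I. (t l \<bullet> b) * mollify c I h (p1 l b) (coords s))"
        by (intro sum.cong) (auto simp: coords_def p1_def)
      also have "\<dots> = (\<Sum>l<m. \<Sum>b\<in>Basis. (t l \<bullet> b) * mollify c I h (p1 l b) (coords s))"
        unfolding I_def by (rule sum.cartesian_product[symmetric])
      also have "\<dots> = (\<Sum>l<m. G l s \<bullet> t l)"
        unfolding G_def inner_sum_left by (intro sum.cong refl) (simp add: inner_commute)
      finally have "(\<Sum>i\<in>I. coords t i * mollify c I h (p(i := gauss_pderiv c (p i))) (coords s)) = (\<Sum>l<m. G l s \<bullet> t l)" .
      moreover have "coords (\<lambda>l. s l + t l) = (\<lambda>i. coords s i + coords t i)"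
        by (auto simp: coords_def inner_add_left)
      ultimately have "\<bar>f (\<lambda>l. s l + t l) - f s - (\<Sum>l<m. G l s \<bullet> t l)\<bar> \<le> C * (\<Sum>i\<in>I. \<bar>coords t i\<bar>)\<^sup>2"
        using C(2)[of "coords s" "coords t"] by (simp add: f)
      moreover have "(\<Sum>i\<in>I. \<bar>coords t i\<bar>) \<le> (\<Sum>l<m. real DIM('a) * norm (t l))"
      proof -
        have "(\<Sum>i\<in>I. \<bar>coords t i\<bar>) = (\<Sum>l<m. \<Sum>b\<in>(Basis :: 'a set). \<bar>t l \<bullet> b\<bar>)"
          unfolding I_def by (simp add: sum.cartesian_product coords_def case_prod_beta)
        also have "\<dots> \<le> (\<Sum>l<m. \<Sum>b\<in>(Basis :: 'a set). norm (t l))"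
          by (intro sum_mono Basis_le_norm)
        finally show ?thesis by simp
      qed
      then have "C * (\<Sum>i\<in>I. \<bar>coords t i\<bar>)\<^sup>2 \<le> C * (real DIM('a) * (\<Sum>l<m. norm (t l)))\<^sup>2"
        using C(1) by (intro mult_left_mono power_mono) (auto simp: sum_distrib_left intro: sum_nonneg)
      ultimately show ?thesis by (simp add: power_mult_distrib mult.assoc)
    qed
    moreover have "\<exists>p. (\<lambda>s. G l s \<bullet> b) = (\<lambda>s. mollify c I h p (coords s))" if "b \<in> Basis" for l b
      using that by (intro exI[of _ "p1 l b"]) (simp add: G_def inner_sum_left_Basis)
    moreover have "\<bar>f s\<bar> \<le> B * (\<Prod>i\<in>I. \<integral>x. \<bar>gauss_poly c (p i) x\<bar> \<partial>lborel)" for s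
      unfolding f by (rule mollify_bounded[OF c I h' B])
    ultimately show ?case by blast
  qed
  then show ?thesis unfolding I_def by blast
qed

lemma distr_normal_translate:
  assumes "0 < \<sigma>"
  shows "distr (density lborel (normal_density 0 \<sigma>)) borel (\<lambda>x. a + x) = density lborel (normal_density a \<sigma>)"
proof -
  interpret prob_space "density lborel (normal_density 0 \<sigma>)"
    by (rule prob_space_normal_density[OF assms])
  have "distributed (density lborel (normal_density 0 \<sigma>)) lborel (\<lambda>x. x) (normal_density 0 \<sigma>)"
    by (auto simp: distributed_def intro!: distr_id2)
  from normal_density_affine[OF this assms, of 1 a]
  have "distr (density lborel (normal_density 0 \<sigma>)) lborel (\<lambda>x. a + x) = density lborel (normal_density a \<sigma>)"
    by (simp add: distributed_def)
  then show ?thesis by (simp cong: distr_cong)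
qed

text \<open>
  Indexed by scalar coordinates, to match \<open>coords\<close>.
\<close>
definition gauss_noise :: "real \<Rightarrow> nat \<Rightarrow> (nat \<times> 'a::euclidean_space \<Rightarrow> real) measure" where
  "gauss_noise \<sigma> m = PiM ({..<m} \<times> Basis) (\<lambda>_. density lborel (normal_density 0 \<sigma>))"

text \<open>
  Recovers vectors from their coordinates: \<open>assemble (coords s) = s\<close>.
\<close>
definition assemble :: "(nat \<times> 'a::euclidean_space \<Rightarrow> real) \<Rightarrow> nat \<Rightarrow> 'a" where
  "assemble z l = (\<Sum>b\<in>Basis. z (l, b) *\<^sub>R b)"

context
  fixes \<sigma> :: real
  assumes \<sigma>: "0 < \<sigma>"
begin

lemma prob_space_gauss_noise: "prob_space (gauss_noise \<sigma> m)"
  unfolding gauss_noise_def by (intro prob_space_PiM prob_space_normal_density \<sigma>)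

text \<open>
  Both sides are the product of the normal laws with means \<open>s i\<close>.
\<close>
lemma translated_gauss_noise:
  fixes s :: "nat \<times> 'v::euclidean_space \<Rightarrow> real"
  assumes I_def: "I = {..<m} \<times> Basis"
  shows "distr (gauss_noise \<sigma> m) (PiM I (\<lambda>_. lborel)) (\<lambda>z. \<lambda>i\<in>I. s i + z i)
    = density (PiM I (\<lambda>_. lborel)) (\<lambda>z. \<Prod>i\<in>I. ennreal (normal_density (s i) \<sigma> (z i)))"
    (is "?L = ?R")
proof -
  interpret N: product_prob_space "\<lambda>_ :: nat \<times> 'v. density lborel (normal_density 0 \<sigma>)"
    by (intro product_prob_spaceI prob_space_normal_density \<sigma>)
  interpret S: product_prob_space "\<lambda>i. density lborel (normal_density (s i) \<sigma>)"
    by (intro product_prob_spaceI prob_space_normal_density \<sigma>)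
  interpret lb: product_sigma_finite "\<lambda>_::nat \<times> 'v. lborel :: real measure" ..
  have I: "finite I" by (simp add: I_def)
  have gn: "gauss_noise \<sigma> m = PiM I (\<lambda>_. density lborel (normal_density 0 \<sigma>))"
    by (simp add: gauss_noise_def I_def)
  have sets: "sets (PiM I (\<lambda>_. lborel)) = sets (PiM I (\<lambda>i. density lborel (normal_density (s i) \<sigma>)))"
    by (intro sets_PiM_cong) simp_all
  have meas: "(\<lambda>z. \<lambda>i\<in>I. s i + z i) \<in> measurable (gauss_noise \<sigma> m) (PiM I (\<lambda>_. lborel))"
    unfolding gn by (intro measurable_restrict) (auto intro!: borel_measurable_add measurable_component_singleton simp: measurable_lborel2)
  have "?L = PiM I (\<lambda>i. density lborel (normal_density (s i) \<sigma>))"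
  proof (rule S.PiM_eqI[OF I])
    show "sets ?L = sets (PiM I (\<lambda>i. density lborel (normal_density (s i) \<sigma>)))" using sets by simp
    fix A assume "\<And>i. i \<in> I \<Longrightarrow> A i \<in> sets (density lborel (normal_density (s i) \<sigma>))"
    then have A: "A i \<in> sets borel" if "i \<in> I" for i using that by simp
    have "emeasure ?L (Pi\<^sub>E I A) = emeasure (gauss_noise \<sigma> m) ((\<lambda>z. \<lambda>i\<in>I. s i + z i) -` Pi\<^sub>E I A \<inter> space (gauss_noise \<sigma> m))"
      using A I by (intro emeasure_distr[OF meas] sets_PiM_I_finite) auto
    also have "(\<lambda>z. \<lambda>i\<in>I. s i + z i) -` Pi\<^sub>E I A \<inter> space (gauss_noise \<sigma> m) = Pi\<^sub>E I (\<lambda>i. (\<lambda>x. s i + x) -` A i)"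
      unfolding gn by (auto simp: space_PiM PiE_iff)
    also have "emeasure (gauss_noise \<sigma> m) \<dots> = (\<Prod>i\<in>I. emeasure (density lborel (normal_density 0 \<sigma>)) ((\<lambda>x. s i + x) -` A i))"
      unfolding gn
    proof (rule N.emeasure_PiM[OF I])
      fix i assume "i \<in> I"
      then have "(\<lambda>x. s i + x) -` A i \<inter> space borel \<in> sets borel"
        using A by (intro measurable_sets[of _ borel borel]) auto
      then show "(\<lambda>x. s i + x) -` A i \<in> sets (density lborel (normal_density 0 \<sigma>))" by simp
    qed
    also have "\<dots> = (\<Prod>i\<in>I. emeasure (density lborel (normal_density (s i) \<sigma>)) (A i))"
    proof (rule prod.cong[OF refl])
      fix i assume i: "i \<in> I"
      show "emeasure (density lborel (normal_density 0 \<sigma>)) ((\<lambda>x. s i + x) -` A i) = emeasure (density lborel (normal_density (s i) \<sigma>)) (A i)"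
        unfolding distr_normal_translate[OF \<sigma>, of "s i", symmetric]
        using A[OF i] by (subst emeasure_distr) auto
    qed
    finally show "emeasure ?L (Pi\<^sub>E I A) = (\<Prod>i\<in>I. emeasure (density lborel (normal_density (s i) \<sigma>)) (A i))" .
  qed
  moreover have "?R = PiM I (\<lambda>i. density lborel (normal_density (s i) \<sigma>))"
  proof (rule S.PiM_eqI[OF I])
    show "sets ?R = sets (PiM I (\<lambda>i. density lborel (normal_density (s i) \<sigma>)))" using sets by simp
    fix A assume "\<And>i. i \<in> I \<Longrightarrow> A i \<in> sets (density lborel (normal_density (s i) \<sigma>))"
    then have A: "A i \<in> sets borel" if "i \<in> I" for i using that by simp
    have dm: "(\<lambda>z. \<Prod>i\<in>I. ennreal (normal_density (s i) \<sigma> (z i))) \<in> borel_measurable (PiM I (\<lambda>_. lborel))"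
      by (intro borel_measurable_prod_ennreal measurable_compose[OF measurable_component_singleton]) auto
    have "emeasure ?R (Pi\<^sub>E I A) = (\<integral>\<^sup>+z. (\<Prod>i\<in>I. ennreal (normal_density (s i) \<sigma> (z i))) * indicator (Pi\<^sub>E I A) z \<partial>PiM I (\<lambda>_. lborel))"
      using A I by (intro emeasure_density dm sets_PiM_I_finite) auto
    also have "\<dots> = (\<integral>\<^sup>+z. (\<Prod>i\<in>I. ennreal (normal_density (s i) \<sigma> (z i)) * indicator (A i) (z i)) \<partial>PiM I (\<lambda>_. lborel))"
    proof (rule nn_integral_cong)
      fix z :: "nat \<times> 'v \<Rightarrow> real" assume "z \<in> space (PiM I (\<lambda>_. lborel))"
      then have "indicator (Pi\<^sub>E I A) z = (\<Prod>i\<in>I. indicator (A i) (z i) :: ennreal)"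
        using I by (auto simp: space_PiM PiE_iff indicator_def prod_zero_iff)
      then show "(\<Prod>i\<in>I. ennreal (normal_density (s i) \<sigma> (z i))) * indicator (Pi\<^sub>E I A) z
          = (\<Prod>i\<in>I. ennreal (normal_density (s i) \<sigma> (z i)) * indicator (A i) (z i))"
        by (simp only: prod.distrib)
    qed
    also have "\<dots> = (\<Prod>i\<in>I. \<integral>\<^sup>+x. ennreal (normal_density (s i) \<sigma> x) * indicator (A i) x \<partial>lborel)"
      using A by (intro lb.product_nn_integral_prod[OF I]) auto
    also have "\<dots> = (\<Prod>i\<in>I. emeasure (density lborel (normal_density (s i) \<sigma>)) (A i))"
      using A by (intro prod.cong refl emeasure_density[symmetric]) auto
    finally show "emeasure ?R (Pi\<^sub>E I A) = (\<Prod>i\<in>I. emeasure (density lborel (normal_density (s i) \<sigma>)) (A i))" .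
  qed
  ultimately show ?thesis by simp
qed

lemma gauss_noise_second_moment:
  fixes l :: nat
  assumes "l < m"
  shows "integrable (gauss_noise \<sigma> m) (\<lambda>z. (norm (assemble z l :: 'v::euclidean_space))\<^sup>2)"
    and "(\<integral>z. (norm (assemble z l :: 'v::euclidean_space))\<^sup>2 \<partial>gauss_noise \<sigma> m) = real DIM('v) * \<sigma>\<^sup>2"
proof -
  interpret N: product_prob_space "\<lambda>_ :: nat \<times> 'v. density lborel (normal_density 0 \<sigma>)" "{..<m} \<times> Basis"
    by (intro product_prob_spaceI prob_space_normal_density \<sigma>)
  have eq: "(norm (assemble z l :: 'v))\<^sup>2 = (\<Sum>b\<in>Basis. (z (l, b))\<^sup>2)" for z
    unfolding power2_norm_eq_inner euclidean_inner[of "assemble z l" "assemble z l"]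
    by (intro sum.cong) (auto simp: assemble_def inner_sum_left_Basis power2_eq_square)
  have m: "integrable (gauss_noise \<sigma> m) (\<lambda>z. (z (l, b))\<^sup>2) \<and> (\<integral>z. (z (l, b))\<^sup>2 \<partial>gauss_noise \<sigma> m) = \<sigma>\<^sup>2"
    if "b \<in> (Basis :: 'v set)" for b
  proof -
    let ?N = "density lborel (normal_density 0 \<sigma>)"
    have lb: "(l, b) \<in> {..<m} \<times> (Basis :: 'v set)" using assms that by simp
    have d: "distr (gauss_noise \<sigma> m) ?N (\<lambda>z. z (l, b)) = ?N"
      unfolding gauss_noise_def by (rule N.PiM_component[OF lb])
    have meas: "(\<lambda>z. z (l, b)) \<in> measurable (gauss_noise \<sigma> m) ?N"
      unfolding gauss_noise_def by (rule measurable_component_singleton[OF lb])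
    have i: "has_bochner_integral lborel (\<lambda>x. normal_density 0 \<sigma> x * x\<^sup>2) (\<sigma>\<^sup>2)"
    proof -
      have "fact (2 * 1) / ((2 / \<sigma>\<^sup>2) ^ 1 * fact 1) = \<sigma>\<^sup>2" using \<sigma> by simp
      then show ?thesis using normal_moment_even[OF \<sigma>, of 0 1] by simp
    qed
    have "has_bochner_integral ?N (\<lambda>x. x\<^sup>2) (\<sigma>\<^sup>2)"
      using i by (intro has_bochner_integral_density) (auto simp: power2_eq_square)
    then have "integrable ?N (\<lambda>x. x\<^sup>2)" "(\<integral>x. x\<^sup>2 \<partial>?N) = \<sigma>\<^sup>2"
      by (auto simp: has_bochner_integral_iff)
    then show ?thesis
      using integrable_distr[OF meas, of "\<lambda>x. x\<^sup>2"] integral_distr[OF meas, of "\<lambda>x. x\<^sup>2"] d by simp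
  qed
  show "integrable (gauss_noise \<sigma> m) (\<lambda>z. (norm (assemble z l :: 'v))\<^sup>2)"
    unfolding eq using m by auto
  show "(\<integral>z. (norm (assemble z l :: 'v))\<^sup>2 \<partial>gauss_noise \<sigma> m) = real DIM('v) * \<sigma>\<^sup>2"
    unfolding eq using m by (subst Bochner_Integration.integral_sum) auto
qed

text \<open>
  Adding the noise to the arguments of \<open>h\<close> and averaging is mollification by the normal density.
  As a function of the shift the average is thus smooth, however rough \<open>h\<close> is.
\<close>
lemma smoothing_by_gauss_noise:
  fixes h :: "(nat \<Rightarrow> 'v::euclidean_space) \<Rightarrow> real"
  assumes h: "h \<in> borel_measurable (PiM UNIV (\<lambda>_. borel))" and B: "\<And>s. \<bar>h s\<bar> \<le> B"
    and dep: "\<And>s s'. (\<And>l. l < m \<Longrightarrow> s l = s' l) \<Longrightarrow> h s = h s'"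
  shows "smooth_kernel m (\<lambda>s. \<integral>z. h (\<lambda>l. s l + assemble z l) \<partial>gauss_noise \<sigma> m)"
    and "(\<lambda>z. h (\<lambda>l. s l + assemble z l)) \<in> borel_measurable (gauss_noise \<sigma> m)"
proof -
  define I where "I = {..<m} \<times> (Basis :: 'v set)"
  have I: "finite I" by (simp add: I_def)
  define g where "g = (\<lambda>z. h (\<lambda>l. if l < m then assemble z l else 0))"
  have g: "g \<in> borel_measurable (PiM I (\<lambda>_. lborel))"
    unfolding g_def
  proof (rule measurable_compose[OF _ h], rule measurable_PiM_single')
    show "(\<lambda>z. if l < m then assemble z l else 0) \<in> borel_measurable (PiM I (\<lambda>_. lborel))" for l
    proof (cases "l < m")
      case True
      then have "(\<lambda>z. z (l, b)) \<in> borel_measurable (PiM I (\<lambda>_. lborel))" if "b \<in> Basis" for b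
        using measurable_component_singleton[of "(l, b)" I "\<lambda>_. lborel"] that
        by (simp add: I_def measurable_lborel2)
      then show ?thesis using True unfolding assemble_def
        by (auto intro!: borel_measurable_sum borel_measurable_scaleR)
    qed simp
  qed simp
  define c where "c = 1 / (2 * \<sigma>\<^sup>2)"
  have c: "0 < c" using \<sigma> by (simp add: c_def)
  define p where "p = (\<lambda>_ :: nat \<times> 'v. [:1 / sqrt (2 * pi * \<sigma>\<^sup>2):])"
  have gp: "gauss_poly c (p i) (a - x) = normal_density a \<sigma> x" for i a x
    by (simp add: gauss_poly_def c_def p_def normal_density_def power2_commute)
  define T where "T = (\<lambda>s. \<lambda>z. \<lambda>i\<in>I. coords s i + z i)"
  have T: "T s \<in> measurable (gauss_noise \<sigma> m) (PiM I (\<lambda>_. lborel))" for s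
    unfolding T_def gauss_noise_def I_def
    by (intro measurable_restrict) (auto intro!: borel_measurable_add measurable_component_singleton simp: measurable_lborel2)
  have gT: "g (T s z) = h (\<lambda>l. s l + assemble z l)" for s z
    unfolding g_def
  proof (rule dep)
    fix l assume l: "l < m"
    have "assemble (T s z) l = (\<Sum>b\<in>Basis. (s l \<bullet> b) *\<^sub>R b + z (l, b) *\<^sub>R b)"
      unfolding assemble_def T_def I_def coords_def using l by (intro sum.cong) (auto simp: scaleR_add_left)
    also have "\<dots> = s l + assemble z l"
      by (simp add: sum.distrib euclidean_representation assemble_def)
    finally show "(if l < m then assemble (T s z) l else 0) = s l + assemble z l" using l by simp
  qed
  show "(\<lambda>z. h (\<lambda>l. s l + assemble z l)) \<in> borel_measurable (gauss_noise \<sigma> m)"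
    using measurable_compose[OF T g, of s] by (simp add: gT)
  have "mollify c I g p (coords s) = (\<integral>z. h (\<lambda>l. s l + assemble z l) \<partial>gauss_noise \<sigma> m)" for s
  proof -
    have dm: "(\<lambda>z. \<Prod>i\<in>I. normal_density (coords s i) \<sigma> (z i)) \<in> borel_measurable (PiM I (\<lambda>_. lborel))"
      by (intro borel_measurable_prod measurable_compose[OF measurable_component_singleton]) auto
    have "(\<integral>z. h (\<lambda>l. s l + assemble z l) \<partial>gauss_noise \<sigma> m) = (\<integral>z. g z \<partial>distr (gauss_noise \<sigma> m) (PiM I (\<lambda>_. lborel)) (T s))"
      unfolding integral_distr[OF T g] gT ..
    also have "\<dots> = (\<integral>z. g z \<partial>density (PiM I (\<lambda>_. lborel)) (\<lambda>z. ennreal (\<Prod>i\<in>I. normal_density (coords s i) \<sigma> (z i))))"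
      unfolding T_def translated_gauss_noise[OF I_def] by (simp add: prod_ennreal)
    also have "\<dots> = (\<integral>z. (\<Prod>i\<in>I. normal_density (coords s i) \<sigma> (z i)) * g z \<partial>PiM I (\<lambda>_. lborel))"
      by (subst integral_density[OF g dm]) (auto intro!: prod_nonneg)
    also have "\<dots> = mollify c I g p (coords s)"
      unfolding mollify_def gp by (simp add: mult.commute)
    finally show ?thesis ..
  qed
  moreover have "smooth_kernel m (\<lambda>s. mollify c I g p (coords s))"
    unfolding I_def using g B by (intro smooth_kernel_mollify[OF c, where B=B]) (auto simp: I_def g_def)
  ultimately show "smooth_kernel m (\<lambda>s. \<integral>z. h (\<lambda>l. s l + assemble z l) \<partial>gauss_noise \<sigma> m)" by simp
qed

end

section \<open>Rules for Lions derivatives and smooth functions\<close>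

lemma has_L2_gradient_add:
  fixes g h :: "'w \<Rightarrow> 'a::euclidean_space"
  assumes U: "has_L2_gradient \<Omega> U \<xi> g" and V: "has_L2_gradient \<Omega> V \<xi> h"
  shows "has_L2_gradient \<Omega> (\<lambda>\<zeta>. U \<zeta> + V \<zeta>) \<xi> (\<lambda>\<omega>. g \<omega> + h \<omega>)"
  unfolding has_L2_gradient_def
proof (intro conjI allI impI)
  have g: "g \<in> L2 \<Omega>" and h: "h \<in> L2 \<Omega>" using U V by (auto simp: has_L2_gradient_def)
  then show "(\<lambda>\<omega>. g \<omega> + h \<omega>) \<in> L2 \<Omega>" by (rule L2_add)
  fix e :: real assume "0 < e"
  then have e2: "0 < e / 2" by simp
  obtain d1 where d1: "0 < d1" "\<And>\<eta>. \<eta> \<in> L2 \<Omega> \<Longrightarrow> L2norm \<Omega> \<eta> < d1 \<Longrightarrow>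
      \<bar>U (\<lambda>\<omega>. \<xi> \<omega> + \<eta> \<omega>) - U \<xi> - (\<integral>\<omega>. g \<omega> \<bullet> \<eta> \<omega> \<partial>\<Omega>)\<bar> \<le> e / 2 * L2norm \<Omega> \<eta>"
    using U e2 unfolding has_L2_gradient_def by blast
  obtain d2 where d2: "0 < d2" "\<And>\<eta>. \<eta> \<in> L2 \<Omega> \<Longrightarrow> L2norm \<Omega> \<eta> < d2 \<Longrightarrow>
      \<bar>V (\<lambda>\<omega>. \<xi> \<omega> + \<eta> \<omega>) - V \<xi> - (\<integral>\<omega>. h \<omega> \<bullet> \<eta> \<omega> \<partial>\<Omega>)\<bar> \<le> e / 2 * L2norm \<Omega> \<eta>"
    using V e2 unfolding has_L2_gradient_def by blast
  show "\<exists>\<delta>>0. \<forall>\<eta>\<in>L2 \<Omega>. L2norm \<Omega> \<eta> < \<delta> \<longrightarrow>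
      \<bar>U (\<lambda>\<omega>. \<xi> \<omega> + \<eta> \<omega>) + V (\<lambda>\<omega>. \<xi> \<omega> + \<eta> \<omega>) - (U \<xi> + V \<xi>) - (\<integral>\<omega>. (g \<omega> + h \<omega>) \<bullet> \<eta> \<omega> \<partial>\<Omega>)\<bar>
        \<le> e * L2norm \<Omega> \<eta>"
  proof (intro exI[of _ "min d1 d2"] conjI ballI impI)
    fix \<eta> :: "'w \<Rightarrow> 'a" assume \<eta>: "\<eta> \<in> L2 \<Omega>" "L2norm \<Omega> \<eta> < min d1 d2"
    have "(\<integral>\<omega>. (g \<omega> + h \<omega>) \<bullet> \<eta> \<omega> \<partial>\<Omega>) = (\<integral>\<omega>. g \<omega> \<bullet> \<eta> \<omega> \<partial>\<Omega>) + (\<integral>\<omega>. h \<omega> \<bullet> \<eta> \<omega> \<partial>\<Omega>)"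
      unfolding inner_add_left
      by (intro Bochner_Integration.integral_add L2_inner_integrable g h \<eta>)
    moreover have "L2norm \<Omega> \<eta> < d1" "L2norm \<Omega> \<eta> < d2" using \<eta>(2) by auto
    ultimately show "\<bar>U (\<lambda>\<omega>. \<xi> \<omega> + \<eta> \<omega>) + V (\<lambda>\<omega>. \<xi> \<omega> + \<eta> \<omega>) - (U \<xi> + V \<xi>) - (\<integral>\<omega>. (g \<omega> + h \<omega>) \<bullet> \<eta> \<omega> \<partial>\<Omega>)\<bar>
        \<le> e * L2norm \<Omega> \<eta>"
      using d1(2)[OF \<eta>(1)] d2(2)[OF \<eta>(1)] by linarith
  qed (use d1 d2 in auto)
qed

lemma has_L_derivative_add:
  fixes p q :: "'a::euclidean_space measure \<Rightarrow> 'a \<Rightarrow> 'a"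
  assumes u: "has_L_derivative \<Omega> u p" and v: "has_L_derivative \<Omega> v q"
  shows "has_L_derivative \<Omega> (\<lambda>\<mu>. u \<mu> + v \<mu>) (\<lambda>\<mu> y. p \<mu> y + q \<mu> y)"
proof -
  obtain G where G: "\<And>\<xi>. \<xi> \<in> L2 \<Omega> \<Longrightarrow> has_L2_gradient \<Omega> (lifting \<Omega> u) \<xi> (G \<xi>)"
      "L2_continuous \<Omega> G" "\<And>\<xi>. \<xi> \<in> L2 \<Omega> \<Longrightarrow> AE \<omega> in \<Omega>. G \<xi> \<omega> = p (distr \<Omega> borel \<xi>) (\<xi> \<omega>)"
    using u unfolding has_L_derivative_def by blast
  obtain H where H: "\<And>\<xi>. \<xi> \<in> L2 \<Omega> \<Longrightarrow> has_L2_gradient \<Omega> (lifting \<Omega> v) \<xi> (H \<xi>)"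
      "L2_continuous \<Omega> H" "\<And>\<xi>. \<xi> \<in> L2 \<Omega> \<Longrightarrow> AE \<omega> in \<Omega>. H \<xi> \<omega> = q (distr \<Omega> borel \<xi>) (\<xi> \<omega>)"
    using v unfolding has_L_derivative_def by blast
  have L2: "G \<xi> \<in> L2 \<Omega>" "H \<xi> \<in> L2 \<Omega>" if "\<xi> \<in> L2 \<Omega>" for \<xi>
    using G(1)[OF that] H(1)[OF that] by (auto simp: has_L2_gradient_def)
  have "L2_continuous \<Omega> (\<lambda>\<xi> \<omega>. G \<xi> \<omega> + H \<xi> \<omega>)"
    unfolding L2_continuous_def
  proof (intro ballI allI impI)
    fix \<xi> :: "'b \<Rightarrow> 'a" and e :: real assume \<xi>: "\<xi> \<in> L2 \<Omega>" and "0 < e"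
    then have e2: "0 < e / 2" by simp
    obtain d1 where d1: "0 < d1" "\<And>\<zeta>. \<zeta> \<in> L2 \<Omega> \<Longrightarrow> L2norm \<Omega> (\<lambda>\<omega>. \<zeta> \<omega> - \<xi> \<omega>) < d1 \<Longrightarrow> L2norm \<Omega> (\<lambda>\<omega>. G \<zeta> \<omega> - G \<xi> \<omega>) < e / 2"
      using G(2) \<xi> e2 unfolding L2_continuous_def by blast
    obtain d2 where d2: "0 < d2" "\<And>\<zeta>. \<zeta> \<in> L2 \<Omega> \<Longrightarrow> L2norm \<Omega> (\<lambda>\<omega>. \<zeta> \<omega> - \<xi> \<omega>) < d2 \<Longrightarrow> L2norm \<Omega> (\<lambda>\<omega>. H \<zeta> \<omega> - H \<xi> \<omega>) < e / 2"
      using H(2) \<xi> e2 unfolding L2_continuous_def by blast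
    show "\<exists>\<delta>>0. \<forall>\<zeta>\<in>L2 \<Omega>. L2norm \<Omega> (\<lambda>\<omega>. \<zeta> \<omega> - \<xi> \<omega>) < \<delta> \<longrightarrow>
        L2norm \<Omega> (\<lambda>\<omega>. G \<zeta> \<omega> + H \<zeta> \<omega> - (G \<xi> \<omega> + H \<xi> \<omega>)) < e"
    proof (intro exI[of _ "min d1 d2"] conjI ballI impI)
      fix \<zeta> :: "'b \<Rightarrow> 'a" assume \<zeta>: "\<zeta> \<in> L2 \<Omega>" "L2norm \<Omega> (\<lambda>\<omega>. \<zeta> \<omega> - \<xi> \<omega>) < min d1 d2"
      have "L2norm \<Omega> (\<lambda>\<omega>. (G \<zeta> \<omega> - G \<xi> \<omega>) + (H \<zeta> \<omega> - H \<xi> \<omega>))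
          \<le> L2norm \<Omega> (\<lambda>\<omega>. G \<zeta> \<omega> - G \<xi> \<omega>) + L2norm \<Omega> (\<lambda>\<omega>. H \<zeta> \<omega> - H \<xi> \<omega>)"
        by (intro L2norm_triangle L2_diff L2 \<xi> \<zeta>)
      then show "L2norm \<Omega> (\<lambda>\<omega>. G \<zeta> \<omega> + H \<zeta> \<omega> - (G \<xi> \<omega> + H \<xi> \<omega>)) < e"
        using d1(2)[OF \<zeta>(1)] d2(2)[OF \<zeta>(1)] \<zeta>(2) by (simp add: algebra_simps)
    qed (use d1 d2 in auto)
  qed
  moreover have "has_L2_gradient \<Omega> (lifting \<Omega> (\<lambda>\<mu>. u \<mu> + v \<mu>)) \<xi> (\<lambda>\<omega>. G \<xi> \<omega> + H \<xi> \<omega>)" if "\<xi> \<in> L2 \<Omega>" for \<xi>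
    using has_L2_gradient_add[OF G(1)[OF that] H(1)[OF that]] by (simp add: lifting_def[abs_def])
  moreover have "AE \<omega> in \<Omega>. G \<xi> \<omega> + H \<xi> \<omega> = p (distr \<Omega> borel \<xi>) (\<xi> \<omega>) + q (distr \<Omega> borel \<xi>) (\<xi> \<omega>)"
    if "\<xi> \<in> L2 \<Omega>" for \<xi>
    using G(3)[OF that] H(3)[OF that] by eventually_elim simp
  moreover have "continuous_map (prod_topology W2_topology euclidean) euclidean (\<lambda>(\<mu>, y). p \<mu> y + q \<mu> y)"
    using continuous_map_add[of _ "\<lambda>(\<mu>, y). p \<mu> y" "\<lambda>(\<mu>, y). q \<mu> y"] u v
    by (simp add: has_L_derivative_def case_prod_beta')
  ultimately show ?thesis
    unfolding has_L_derivative_def by (intro conjI exI[of _ "\<lambda>\<xi> \<omega>. G \<xi> \<omega> + H \<xi> \<omega>"]) auto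
qed

lemma has_L_derivative_zero: "has_L_derivative \<Omega> (\<lambda>\<mu>. 0) (\<lambda>\<mu> y. 0 :: 'a::euclidean_space)"
  unfolding has_L_derivative_def
  by (intro conjI exI[of _ "\<lambda>\<xi> \<omega>. 0"])
    (auto simp: has_L2_gradient_def L2_def lifting_def L2_continuous_def L2norm_def case_prod_beta'
      intro: exI[of _ 1])

lemma jointly_continuous_add:
  "jointly_continuous j f \<Longrightarrow> jointly_continuous j g \<Longrightarrow> jointly_continuous j (\<lambda>\<mu> x. f \<mu> x + g \<mu> x)"
  using continuous_map_add[of _ "\<lambda>(\<mu>, x). f \<mu> x" "\<lambda>(\<mu>, x). g \<mu> x"]
  by (simp add: jointly_continuous_def case_prod_beta')

lemma C_order_zero: "C_order \<Omega> n j (\<lambda>\<mu> (x :: nat \<Rightarrow> 'a::euclidean_space). 0)"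
proof (induction n arbitrary: j)
  case (Suc n)
  show ?case
    using Suc.IH has_L_derivative_zero
    by (auto simp: jointly_continuous_def case_prod_beta' intro!: exI[of _ "\<lambda>\<mu> x. 0"] GDERIV_const)
qed (simp add: jointly_continuous_def case_prod_beta')

lemma C_order_add:
  fixes f g :: "'a::euclidean_space measure \<Rightarrow> (nat \<Rightarrow> 'a) \<Rightarrow> real"
  assumes "C_order \<Omega> n j f" "C_order \<Omega> n j g"
  shows "C_order \<Omega> n j (\<lambda>\<mu> x. f \<mu> x + g \<mu> x)"
  using assms
proof (induction n arbitrary: j f g)
  case (Suc n)
  have "\<exists>k. (\<forall>\<mu>\<in>P2. \<forall>x\<in>{..<j} \<rightarrow>\<^sub>E UNIV. GDERIV (\<lambda>y. f \<mu> (x(i := y)) + g \<mu> (x(i := y))) (x i) :> k \<mu> x) \<and>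
      (\<forall>b\<in>Basis. C_order \<Omega> n j (\<lambda>\<mu> x. k \<mu> x \<bullet> b))" if i: "i < j" for i
  proof -
    obtain k1 where k1: "\<forall>\<mu>\<in>P2. \<forall>x\<in>{..<j} \<rightarrow>\<^sub>E UNIV. GDERIV (\<lambda>y. f \<mu> (x(i := y))) (x i) :> k1 \<mu> x"
        "\<forall>b\<in>Basis. C_order \<Omega> n j (\<lambda>\<mu> x. k1 \<mu> x \<bullet> b)"
      using Suc.prems(1) i by auto
    obtain k2 where k2: "\<forall>\<mu>\<in>P2. \<forall>x\<in>{..<j} \<rightarrow>\<^sub>E UNIV. GDERIV (\<lambda>y. g \<mu> (x(i := y))) (x i) :> k2 \<mu> x"
        "\<forall>b\<in>Basis. C_order \<Omega> n j (\<lambda>\<mu> x. k2 \<mu> x \<bullet> b)"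
      using Suc.prems(2) i by auto
    show ?thesis
      using k1 k2 by (intro exI[of _ "\<lambda>\<mu> x. k1 \<mu> x + k2 \<mu> x"])
        (auto simp: inner_add_left intro!: GDERIV_add Suc.IH)
  qed
  moreover obtain p1 where p1: "\<forall>x\<in>{..<j} \<rightarrow>\<^sub>E UNIV. has_L_derivative \<Omega> (\<lambda>\<mu>. f \<mu> x) (\<lambda>\<mu> y. p1 \<mu> (x(j := y)))"
      "\<forall>b\<in>Basis. C_order \<Omega> n (Suc j) (\<lambda>\<mu> x. p1 \<mu> x \<bullet> b)"
    using Suc.prems(1) by auto
  moreover obtain p2 where p2: "\<forall>x\<in>{..<j} \<rightarrow>\<^sub>E UNIV. has_L_derivative \<Omega> (\<lambda>\<mu>. g \<mu> x) (\<lambda>\<mu> y. p2 \<mu> (x(j := y)))"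
      "\<forall>b\<in>Basis. C_order \<Omega> n (Suc j) (\<lambda>\<mu> x. p2 \<mu> x \<bullet> b)"
    using Suc.prems(2) by auto
  have "\<exists>p. (\<forall>x\<in>{..<j} \<rightarrow>\<^sub>E UNIV. has_L_derivative \<Omega> (\<lambda>\<mu>. f \<mu> x + g \<mu> x) (\<lambda>\<mu> y. p \<mu> (x(j := y)))) \<and>
      (\<forall>b\<in>Basis. C_order \<Omega> n (Suc j) (\<lambda>\<mu> x. p \<mu> x \<bullet> b))"
    using p1 p2 by (intro exI[of _ "\<lambda>\<mu> x. p1 \<mu> x + p2 \<mu> x"])
      (auto simp: inner_add_left intro!: has_L_derivative_add Suc.IH)
  moreover have "jointly_continuous j (\<lambda>\<mu> x. f \<mu> x + g \<mu> x)"
    using Suc.prems by (auto intro: jointly_continuous_add)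
  ultimately show ?case by simp
qed (simp add: jointly_continuous_add)

lemma C_order_sum:
  fixes f :: "'i \<Rightarrow> 'a::euclidean_space measure \<Rightarrow> (nat \<Rightarrow> 'a) \<Rightarrow> real"
  assumes "\<And>a. a \<in> A \<Longrightarrow> C_order \<Omega> n j (f a)"
  shows "C_order \<Omega> n j (\<lambda>\<mu> x. \<Sum>a\<in>A. f a \<mu> x)"
  using assms
  by (induction A rule: infinite_finite_induct) (auto intro: C_order_zero C_order_add)

text \<open>
  Lipschitz continuity in the measure, uniformly in the other variable, reduces joint continuity to
  continuity in the other variable, uniformly in the measure.
\<close>
lemma continuous_map_W2_prodI:
  fixes F :: "'a::euclidean_space measure \<Rightarrow> 'b \<Rightarrow> 'c::real_normed_vector"
  assumes L: "0 \<le> L"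
    and lip: "\<And>\<mu> \<nu> x. \<mu> \<in> P2 \<Longrightarrow> \<nu> \<in> P2 \<Longrightarrow> x \<in> topspace X \<Longrightarrow> norm (F \<mu> x - F \<nu> x) \<le> L * W2 \<mu> \<nu>"
    and nbh: "\<And>x e. x \<in> topspace X \<Longrightarrow> 0 < e \<Longrightarrow> \<exists>V. openin X V \<and> x \<in> V \<and>
      (\<forall>\<mu>\<in>P2. \<forall>x'\<in>V. norm (F \<mu> x' - F \<mu> x) \<le> e)"
  shows "continuous_map (prod_topology W2_topology X) euclidean (\<lambda>(\<mu>, x). F \<mu> x)"
proof -
  have "\<exists>U. openin (prod_topology W2_topology X) U \<and> z \<in> U \<and> (\<forall>z'\<in>U. dist ((\<lambda>(\<mu>, x). F \<mu> x) z') ((\<lambda>(\<mu>, x). F \<mu> x) z) < e)"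
    if z: "z \<in> topspace (prod_topology W2_topology X)" and e: "0 < e" for z e
  proof -
    obtain \<mu> x where zx: "z = (\<mu>, x)" "\<mu> \<in> P2" "x \<in> topspace X" using z by (auto simp: W2.topspace_mtopology)
    obtain V where V: "openin X V" "x \<in> V" "\<And>\<nu> x'. \<nu> \<in> P2 \<Longrightarrow> x' \<in> V \<Longrightarrow> norm (F \<nu> x' - F \<nu> x) \<le> e / 3"
      using nbh[OF zx(3), of "e / 3"] e by auto
    \<comment> \<open>The summand 1 avoids a division by zero if \<open>L = 0\<close>; the same device occurs repeatedly below.\<close>
    define r where "r = e / (3 * (L + 1))"
    have r: "0 < r" using e L by (simp add: r_def)
    have Lr: "L * r \<le> e / 3" using e L by (simp add: r_def field_simps)
    show ?thesis
    proof (intro exI[of _ "W2.mball \<mu> r \<times> V"] conjI ballI)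
      show "openin (prod_topology W2_topology X) (W2.mball \<mu> r \<times> V)"
        using V(1) by (simp add: openin_prod_Times_iff W2.openin_mball)
      show "z \<in> W2.mball \<mu> r \<times> V" using zx V r by (simp add: W2.centre_in_mball_iff)
      fix z' assume "z' \<in> W2.mball \<mu> r \<times> V"
      then obtain \<nu> x' where z': "z' = (\<nu>, x')" "\<nu> \<in> P2" "W2 \<mu> \<nu> < r" "x' \<in> V" by (auto simp: W2.in_mball)
      have "norm (F \<nu> x - F \<mu> x) \<le> L * W2 \<nu> \<mu>" by (rule lip[OF z'(2) zx(2,3)])
      also have "\<dots> \<le> L * r" using z'(3) L W2_commute[of \<mu> \<nu>] by (intro mult_left_mono) auto
      finally have "norm (F \<nu> x - F \<mu> x) \<le> e / 3" using Lr by simp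
      moreover have "norm (F \<nu> x' - F \<mu> x) \<le> norm (F \<nu> x' - F \<nu> x) + norm (F \<nu> x - F \<mu> x)"
        using norm_triangle_ineq[of "F \<nu> x' - F \<nu> x" "F \<nu> x - F \<mu> x"] by simp
      ultimately have "norm (F \<nu> x' - F \<mu> x) < e" using V(3)[OF z'(2,4)] e by linarith
      then show "dist ((\<lambda>(\<mu>, x). F \<mu> x) z') ((\<lambda>(\<mu>, x). F \<mu> x) z) < e"
        by (simp add: z'(1) zx(1) dist_norm)
    qed
  qed
  then show ?thesis
    by (simp only: mtopology_is_euclidean[symmetric] Met_TC.continuous_map_to_metric) (simp add: Met_TC.in_mball dist_commute)
qed

text \<open>
  The quadratic remainder is at most \<open>e * L2norm \<Omega> \<eta>\<close> if \<open>\<eta>\<close> is small. As laws are no further apart than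
  random variables, the Lipschitz bound on \<open>P\<close> makes the gradient, which is \<open>P\<close> at the law of \<open>\<xi>\<close>
  composed with \<open>\<xi>\<close>, a Lipschitz function of \<open>\<xi>\<close> in \<open>L2 \<Omega>\<close>.
\<close>
lemma has_L_derivativeI:
  fixes P :: "'a::euclidean_space measure \<Rightarrow> 'a \<Rightarrow> 'a"
  assumes "prob_space \<Omega>" "0 \<le> K" "0 \<le> C"
    and bdd: "\<And>\<mu> y. \<mu> \<in> P2 \<Longrightarrow> norm (P \<mu> y) \<le> B"
    and lip: "\<And>\<mu> \<nu> y y'. \<mu> \<in> P2 \<Longrightarrow> \<nu> \<in> P2 \<Longrightarrow> norm (P \<mu> y - P \<nu> y') \<le> K * (W2 \<mu> \<nu> + norm (y - y'))"
    and taylor: "\<And>\<xi> \<eta>. \<xi> \<in> L2 \<Omega> \<Longrightarrow> \<eta> \<in> L2 \<Omega> \<Longrightarrow>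
      \<bar>u (distr \<Omega> borel (\<lambda>\<omega>. \<xi> \<omega> + \<eta> \<omega>)) - u (distr \<Omega> borel \<xi>) - (\<integral>\<omega>. P (distr \<Omega> borel \<xi>) (\<xi> \<omega>) \<bullet> \<eta> \<omega> \<partial>\<Omega>)\<bar>
        \<le> C * (L2norm \<Omega> \<eta>)\<^sup>2"
  shows "has_L_derivative \<Omega> u P"
proof -
  interpret prob_space \<Omega> by fact
  define G where "G = (\<lambda>\<xi> \<omega>. P (distr \<Omega> borel \<xi>) (\<xi> \<omega>))"
  have law: "distr \<Omega> borel \<xi> \<in> P2" if "\<xi> \<in> L2 \<Omega>" for \<xi> :: "_ \<Rightarrow> 'a"
    by (rule distr_in_P2[OF assms(1) that])
  have cont: "continuous_on UNIV (P \<mu>)" if "\<mu> \<in> P2" for \<mu>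
    using lip[OF that that] \<open>0 \<le> K\<close>
    by (intro lipschitz_on_continuous_on[of K] lipschitz_onI) (auto simp: dist_norm W2_self)
  have G_L2: "G \<xi> \<in> L2 \<Omega>" if "\<xi> \<in> L2 \<Omega>" for \<xi>
  proof (rule L2_bounded)
    show "G \<xi> \<in> borel_measurable \<Omega>"
      unfolding G_def using L2_measurable[OF that] borel_measurable_continuous_onI[OF cont[OF law[OF that]]]
      by (rule measurable_compose)
  qed (use bdd[OF law[OF that]] in \<open>simp add: G_def\<close>)
  have grad: "has_L2_gradient \<Omega> (lifting \<Omega> u) \<xi> (G \<xi>)" if \<xi>: "\<xi> \<in> L2 \<Omega>" for \<xi>
    unfolding has_L2_gradient_def
  proof (intro conjI G_L2 \<xi> allI impI)
    fix e :: real assume "0 < e"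
    show "\<exists>\<delta>>0. \<forall>\<eta>\<in>L2 \<Omega>. L2norm \<Omega> \<eta> < \<delta> \<longrightarrow>
        \<bar>lifting \<Omega> u (\<lambda>\<omega>. \<xi> \<omega> + \<eta> \<omega>) - lifting \<Omega> u \<xi> - (\<integral>\<omega>. G \<xi> \<omega> \<bullet> \<eta> \<omega> \<partial>\<Omega>)\<bar> \<le> e * L2norm \<Omega> \<eta>"
    proof (intro exI[of _ "e / (C + 1)"] conjI ballI impI)
      show "0 < e / (C + 1)" using \<open>0 < e\<close> \<open>0 \<le> C\<close> by simp
      fix \<eta> :: "'b \<Rightarrow> 'a" assume \<eta>: "\<eta> \<in> L2 \<Omega>" "L2norm \<Omega> \<eta> < e / (C + 1)"
      have "C * L2norm \<Omega> \<eta> \<le> C * (e / (C + 1))" using \<eta>(2) \<open>0 \<le> C\<close> by (intro mult_left_mono) auto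
      also have "\<dots> \<le> e" using \<open>0 < e\<close> \<open>0 \<le> C\<close> by (simp add: field_simps)
      finally have "C * L2norm \<Omega> \<eta> * L2norm \<Omega> \<eta> \<le> e * L2norm \<Omega> \<eta>" by (rule mult_right_mono) simp
      then show "\<bar>lifting \<Omega> u (\<lambda>\<omega>. \<xi> \<omega> + \<eta> \<omega>) - lifting \<Omega> u \<xi> - (\<integral>\<omega>. G \<xi> \<omega> \<bullet> \<eta> \<omega> \<partial>\<Omega>)\<bar> \<le> e * L2norm \<Omega> \<eta>"
        using taylor[OF \<xi> \<eta>(1)] by (simp add: lifting_def G_def power2_eq_square mult.assoc)
    qed
  qed
  have "L2_continuous \<Omega> G"
    unfolding L2_continuous_def
  proof (intro ballI allI impI)
    fix \<xi> :: "'b \<Rightarrow> 'a" and e :: real assume \<xi>: "\<xi> \<in> L2 \<Omega>" and e: "0 < e"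
    show "\<exists>\<delta>>0. \<forall>\<zeta>\<in>L2 \<Omega>. L2norm \<Omega> (\<lambda>\<omega>. \<zeta> \<omega> - \<xi> \<omega>) < \<delta> \<longrightarrow> L2norm \<Omega> (\<lambda>\<omega>. G \<zeta> \<omega> - G \<xi> \<omega>) < e"
    proof (intro exI[of _ "e / (2 * K + 1)"] conjI ballI impI)
      show "0 < e / (2 * K + 1)" using e \<open>0 \<le> K\<close> by simp
      fix \<zeta> :: "'b \<Rightarrow> 'a" assume \<zeta>: "\<zeta> \<in> L2 \<Omega>" and small: "L2norm \<Omega> (\<lambda>\<omega>. \<zeta> \<omega> - \<xi> \<omega>) < e / (2 * K + 1)"
      define r where "r = L2norm \<Omega> (\<lambda>\<omega>. \<zeta> \<omega> - \<xi> \<omega>)"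
      have r0: "0 \<le> r" by (simp add: r_def)
      have "W2 (distr \<Omega> borel \<zeta>) (distr \<Omega> borel \<xi>) \<le> r"
        unfolding r_def by (rule W2_le_L2norm[OF assms(1) \<zeta> \<xi>])
      then have "norm (G \<zeta> \<omega> - G \<xi> \<omega>) \<le> K * (r + norm (\<zeta> \<omega> - \<xi> \<omega>))" for \<omega>
        unfolding G_def using \<open>0 \<le> K\<close>
        by (intro order_trans[OF lip[OF law[OF \<zeta>] law[OF \<xi>]]] mult_left_mono) auto
      then have pw: "(norm (G \<zeta> \<omega> - G \<xi> \<omega>))\<^sup>2 \<le> K\<^sup>2 * (2 * r\<^sup>2 + 2 * (norm (\<zeta> \<omega> - \<xi> \<omega>))\<^sup>2)" for \<omega>
      proof -
        have "(norm (G \<zeta> \<omega> - G \<xi> \<omega>))\<^sup>2 \<le> (K * (r + norm (\<zeta> \<omega> - \<xi> \<omega>)))\<^sup>2"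
          by (rule power_mono) (auto intro: \<open>norm (G \<zeta> \<omega> - G \<xi> \<omega>) \<le> _\<close>)
        also have "\<dots> = K\<^sup>2 * (r + norm (\<zeta> \<omega> - \<xi> \<omega>))\<^sup>2" by (simp add: power_mult_distrib)
        also have "(r + norm (\<zeta> \<omega> - \<xi> \<omega>))\<^sup>2 \<le> 2 * r\<^sup>2 + 2 * (norm (\<zeta> \<omega> - \<xi> \<omega>))\<^sup>2"
          using norm_add_sq_le_weighted[of 1 r "norm (\<zeta> \<omega> - \<xi> \<omega>)"] by simp
        finally show ?thesis by (simp add: mult_left_mono)
      qed
      have i: "integrable \<Omega> (\<lambda>\<omega>. (norm (\<zeta> \<omega> - \<xi> \<omega>))\<^sup>2)" by (rule L2_integrable_sq[OF L2_diff[OF \<zeta> \<xi>]])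
      have "(L2norm \<Omega> (\<lambda>\<omega>. G \<zeta> \<omega> - G \<xi> \<omega>))\<^sup>2 \<le> (\<integral>\<omega>. K\<^sup>2 * (2 * r\<^sup>2 + 2 * (norm (\<zeta> \<omega> - \<xi> \<omega>))\<^sup>2) \<partial>\<Omega>)"
        unfolding L2norm_sq
        by (rule integral_mono[OF L2_integrable_sq[OF L2_diff[OF G_L2[OF \<zeta>] G_L2[OF \<xi>]]] _ pw]) (use i in simp)
      also have "\<dots> = K\<^sup>2 * (2 * r\<^sup>2 + 2 * r\<^sup>2)"
        using i by (simp add: prob_space r_def L2norm_sq)
      also have "\<dots> = (2 * K * r)\<^sup>2" by (simp add: power_mult_distrib)
      finally have "L2norm \<Omega> (\<lambda>\<omega>. G \<zeta> \<omega> - G \<xi> \<omega>) \<le> 2 * K * r"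
        by (rule power2_le_imp_le) (use r0 \<open>0 \<le> K\<close> in simp)
      also have "\<dots> \<le> 2 * K * (e / (2 * K + 1))"
        using small \<open>0 \<le> K\<close> by (intro mult_left_mono) (auto simp: r_def)
      also have "\<dots> < e" using e \<open>0 \<le> K\<close> by (simp add: field_simps)
      finally show "L2norm \<Omega> (\<lambda>\<omega>. G \<zeta> \<omega> - G \<xi> \<omega>) < e" .
    qed
  qed
  moreover have "continuous_map (prod_topology W2_topology euclidean) euclidean (\<lambda>(\<mu>, x). P \<mu> x)"
  proof (rule continuous_map_W2_prodI[OF \<open>0 \<le> K\<close>])
    show "norm (P \<mu> x - P \<nu> x) \<le> K * W2 \<mu> \<nu>" if "\<mu> \<in> P2" "\<nu> \<in> P2" for \<mu> \<nu> x
      using lip[OF that, of x x] by simp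
    fix x :: 'a and e :: real assume e: "0 < e"
    show "\<exists>V. openin euclidean V \<and> x \<in> V \<and> (\<forall>\<mu>\<in>P2. \<forall>x'\<in>V. norm (P \<mu> x' - P \<mu> x) \<le> e)"
    proof (intro exI[of _ "ball x (e / (K + 1))"] conjI ballI)
      fix \<mu> :: "'a measure" and x' assume \<mu>: "\<mu> \<in> P2" and x': "x' \<in> ball x (e / (K + 1))"
      have "norm (P \<mu> x' - P \<mu> x) \<le> K * norm (x' - x)" using lip[OF \<mu> \<mu>, of x' x] by (simp add: W2_self)
      also have "\<dots> \<le> K * (e / (K + 1))" using x' \<open>0 \<le> K\<close> by (intro mult_left_mono) (auto simp: dist_norm norm_minus_commute)
      also have "\<dots> \<le> e" using e \<open>0 \<le> K\<close> by (simp add: field_simps)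
      finally show "norm (P \<mu> x' - P \<mu> x) \<le> e" .
    qed (use e \<open>0 \<le> K\<close> in auto)
  qed
  ultimately show ?thesis
    unfolding has_L_derivative_def using grad by (intro conjI exI[of _ G]) (auto simp: G_def)
qed

lemma jointly_continuousI:
  fixes F :: "'a::euclidean_space measure \<Rightarrow> (nat \<Rightarrow> 'a) \<Rightarrow> real"
  assumes "0 \<le> L"
    and lip: "\<And>\<mu> \<nu> x. \<mu> \<in> P2 \<Longrightarrow> \<nu> \<in> P2 \<Longrightarrow> \<bar>F \<mu> x - F \<nu> x\<bar> \<le> L * W2 \<mu> \<nu>"
    and lipx: "\<And>\<mu> x x'. \<mu> \<in> P2 \<Longrightarrow> \<bar>F \<mu> x' - F \<mu> x\<bar> \<le> L * (\<Sum>k<j. norm (x' k - x k))"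
  shows "jointly_continuous j F"
  unfolding jointly_continuous_def
proof (rule continuous_map_W2_prodI[OF \<open>0 \<le> L\<close>])
  fix x :: "nat \<Rightarrow> 'a" and e :: real
  assume x: "x \<in> topspace (product_topology (\<lambda>_. euclidean) {..<j})" and e: "0 < e"
  define r where "r = e / (L * real j + 1)"
  have r: "0 < r" using e \<open>0 \<le> L\<close> by (simp add: r_def add_nonneg_pos)
  show "\<exists>V. openin (product_topology (\<lambda>_. euclidean) {..<j}) V \<and> x \<in> V \<and>
      (\<forall>\<mu>\<in>P2. \<forall>x'\<in>V. norm (F \<mu> x' - F \<mu> x) \<le> e)"
  proof (intro exI[of _ "PiE {..<j} (\<lambda>k. ball (x k) r)"] conjI ballI)
    show "openin (product_topology (\<lambda>_. euclidean) {..<j}) (PiE {..<j} (\<lambda>k. ball (x k) r))"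
      by (simp add: openin_PiE)
    show "x \<in> PiE {..<j} (\<lambda>k. ball (x k) r)" using x r by (auto simp: PiE_iff)
    fix \<mu> :: "'a measure" and x' assume \<mu>: "\<mu> \<in> P2" and x': "x' \<in> PiE {..<j} (\<lambda>k. ball (x k) r)"
    have "norm (x' k - x k) \<le> r" if "k < j" for k
      using PiE_mem[OF x', of k] that by (simp add: dist_norm norm_minus_commute)
    then have "(\<Sum>k<j. norm (x' k - x k)) \<le> real j * r"
      using sum_bounded_above[of "{..<j}" "\<lambda>k. norm (x' k - x k)" r] by simp
    then have "\<bar>F \<mu> x' - F \<mu> x\<bar> \<le> L * (real j * r)"
      using lipx[OF \<mu>, of x' x] \<open>0 \<le> L\<close> by (meson mult_left_mono order_trans)
    also have "\<dots> \<le> e"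
    proof -
      have "0 < L * real j + 1" using \<open>0 \<le> L\<close> by (simp add: add_nonneg_pos)
      then show ?thesis using e by (simp add: r_def field_simps)
    qed
    finally show "norm (F \<mu> x' - F \<mu> x) \<le> e" by simp
  qed
qed (use lip in auto)

section \<open>Integrals of kernels against product measures\<close>

text \<open>
  Continuity in the product topology together with independence of the coordinates from \<open>m\<close> on.
\<close>
definition coordwise_continuous :: "nat \<Rightarrow> ((nat \<Rightarrow> 'a::euclidean_space) \<Rightarrow> real) \<Rightarrow> bool" where
  "coordwise_continuous m g \<longleftrightarrow>
     (\<forall>s. \<forall>e>0. \<exists>d>0. \<forall>s'. (\<forall>l<m. norm (s' l - s l) < d) \<longrightarrow> \<bar>g s' - g s\<bar> < e)"

lemma coordwise_continuous_cong:
  assumes g: "coordwise_continuous m g" and eq: "\<And>l. l < m \<Longrightarrow> s l = s' l"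
  shows "g s = g s'"
proof -
  have "\<bar>g s' - g s\<bar> \<le> e" if e: "0 < e" for e
  proof -
    obtain d where d: "0 < d" "\<forall>s'. (\<forall>l<m. norm (s' l - s l) < d) \<longrightarrow> \<bar>g s' - g s\<bar> < e"
      using g e unfolding coordwise_continuous_def by blast
    have "\<forall>l<m. norm (s' l - s l) < d" using eq d(1) by simp
    then show ?thesis using d(2) less_imp_le by blast
  qed
  then have "\<bar>g s' - g s\<bar> \<le> 0" using field_le_epsilon[of "\<bar>g s' - g s\<bar>" 0] by simp
  then show ?thesis by simp
qed

lemma coordwise_continuous_measurable:
  fixes g :: "(nat \<Rightarrow> 'a::euclidean_space) \<Rightarrow> real"
  assumes g: "coordwise_continuous m g"
  shows "g \<in> borel_measurable (PiM UNIV (\<lambda>_. borel))"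
proof -
  have "(g \<longlongrightarrow> g s) (at s)" for s
  proof (rule tendstoI)
    fix e :: real assume "0 < e"
    then obtain d where d: "0 < d" "\<And>s'. (\<forall>l<m. norm (s' l - s l) < d) \<Longrightarrow> \<bar>g s' - g s\<bar> < e"
      using g unfolding coordwise_continuous_def by blast
    have "eventually (\<lambda>s'. norm (s' l - s l) < d) (at s)" for l
    proof -
      have "continuous_on UNIV (\<lambda>s' :: nat \<Rightarrow> 'a. s' l)" by (rule continuous_on_product_coordinates)
      then have "((\<lambda>s'. s' l) \<longlongrightarrow> s l) (at s)" by (simp add: continuous_on_def)
      then show ?thesis using d(1) by (simp add: tendsto_iff dist_norm)
    qed
    then have "eventually (\<lambda>s'. \<forall>l\<in>{..<m}. norm (s' l - s l) < d) (at s)"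
      by (intro eventually_ball_finite) auto
    then show "eventually (\<lambda>s'. dist (g s') (g s) < e) (at s)"
      by eventually_elim (auto intro!: d(2) simp: dist_real_def)
  qed
  then have "continuous_on UNIV g" by (simp add: continuous_on_def)
  then have "g \<in> borel_measurable borel" by (rule borel_measurable_continuous_onI)
  then show ?thesis using measurable_cong_sets[OF sets_PiM_equal_borel refl] by blast
qed

lemma coordwise_continuous_compose_measurable:
  assumes g: "coordwise_continuous m g" and \<phi>: "\<And>l. l < m \<Longrightarrow> \<phi> l \<in> borel_measurable N"
  shows "(\<lambda>\<omega>. g (\<lambda>l. \<phi> l \<omega>)) \<in> borel_measurable N"
proof -
  \<comment> \<open>The functions \<open>\<phi> l\<close> with \<open>l \<ge> m\<close> need not be measurable and are replaced by 0.\<close>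
  have "(\<lambda>\<omega> l. if l < m then \<phi> l \<omega> else 0) \<in> measurable N (PiM UNIV (\<lambda>_. borel))"
  proof (rule measurable_PiM_single')
    show "(\<lambda>\<omega>. if l < m then \<phi> l \<omega> else 0) \<in> borel_measurable N" for l
      using \<phi>[of l] by (cases "l < m") auto
  qed simp
  from measurable_compose[OF this coordwise_continuous_measurable[OF g]]
  have "(\<lambda>\<omega>. g (\<lambda>l. if l < m then \<phi> l \<omega> else 0)) \<in> borel_measurable N" .
  moreover have "g (\<lambda>l. if l < m then \<phi> l \<omega> else 0) = g (\<lambda>l. \<phi> l \<omega>)" for \<omega>
    by (rule coordwise_continuous_cong[OF g]) simp
  ultimately show ?thesis by simp
qed

lemma measurable_PiM_coordinate:
  assumes "sets M = sets borel" "l < m"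
  shows "(\<lambda>y. y l) \<in> borel_measurable (PiM {..<m} (\<lambda>_. M))"
  using measurable_component_singleton[of l "{..<m}" "\<lambda>_. M"] assms
    measurable_cong_sets[OF refl assms(1)] by blast

lemma measurable_PiM_coordinate_compose:
  fixes m :: nat
  assumes "X \<in> measurable M N" "l < m"
  shows "(\<lambda>w. X (w l)) \<in> measurable (PiM {..<m} (\<lambda>_. M)) N"
  using assms by (intro measurable_compose[of "\<lambda>w. w l" _ M X N] measurable_component_singleton) auto

lemma integral_PiM_distr:
  fixes g :: "(nat \<Rightarrow> 'a::euclidean_space) \<Rightarrow> real"
  assumes M: "prob_space M" and X: "X \<in> borel_measurable M" and g: "coordwise_continuous m g"
  shows "(\<integral>y. g y \<partial>PiM {..<m} (\<lambda>_. distr M borel X)) = (\<integral>w. g (\<lambda>l. X (w l)) \<partial>PiM {..<m} (\<lambda>_. M))"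
proof -
  have D: "prob_space (distr M borel X)" by (rule prob_space.prob_space_distr[OF M X])
  have X': "X \<in> measurable M (distr M borel X)" using X by simp
  have "distr (PiM {..<m} (\<lambda>_. M)) (PiM {..<m} (\<lambda>_. distr M borel X)) (compose {..<m} X)
      = PiM {..<m} (\<lambda>i. distr M (distr M borel X) X)"
    by (rule distr_PiM_finite_prob_space') (auto intro: M D X)
  also have "distr M (distr M borel X) X = distr M borel X" by (rule distr_cong) auto
  finally have eq: "PiM {..<m} (\<lambda>_. distr M borel X)
      = distr (PiM {..<m} (\<lambda>_. M)) (PiM {..<m} (\<lambda>_. distr M borel X)) (compose {..<m} X)" by simp
  have c: "compose {..<m} X \<in> measurable (PiM {..<m} (\<lambda>_. M)) (PiM {..<m} (\<lambda>_. distr M borel X))"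
    unfolding compose_def by (intro measurable_restrict measurable_PiM_coordinate_compose[OF X']) simp
  have gm: "(\<lambda>y. g (\<lambda>l. y l)) \<in> borel_measurable (PiM {..<m} (\<lambda>_. distr M borel X))"
    by (intro coordwise_continuous_compose_measurable[OF g] measurable_PiM_coordinate) auto
  have "(\<integral>y. g y \<partial>PiM {..<m} (\<lambda>_. distr M borel X)) = (\<integral>w. g (compose {..<m} X w) \<partial>PiM {..<m} (\<lambda>_. M))"
    by (subst eq) (rule integral_distr[OF c], use gm in simp)
  also have "\<dots> = (\<integral>w. g (\<lambda>l. X (w l)) \<partial>PiM {..<m} (\<lambda>_. M))"
    by (intro Bochner_Integration.integral_cong refl coordwise_continuous_cong[OF g]) (simp add: compose_def)
  finally show ?thesis .
qed

lemma integral_PiM_component: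
  fixes \<phi> :: "'w \<Rightarrow> real" and m :: nat
  assumes M: "prob_space M" and l: "l < m" and \<phi>: "integrable M \<phi>"
  shows "integrable (PiM {..<m} (\<lambda>_. M)) (\<lambda>w. \<phi> (w l))"
    and "(\<integral>w. \<phi> (w l) \<partial>PiM {..<m} (\<lambda>_. M)) = (\<integral>\<omega>. \<phi> \<omega> \<partial>M)"
proof -
  interpret product_prob_space "\<lambda>_ :: nat. M" "{..<m}" using M by (intro product_prob_spaceI)
  have d: "distr (PiM {..<m} (\<lambda>_. M)) M (\<lambda>w. w l) = M" using l by (intro PiM_component) simp
  have c: "(\<lambda>w. w l) \<in> measurable (PiM {..<m} (\<lambda>_. M)) M" using l by (intro measurable_component_singleton) simp
  show "integrable (PiM {..<m} (\<lambda>_. M)) (\<lambda>w. \<phi> (w l))" by (rule integrable_distr[OF c]) (simp add: d \<phi>)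
  show "(\<integral>w. \<phi> (w l) \<partial>PiM {..<m} (\<lambda>_. M)) = (\<integral>\<omega>. \<phi> \<omega> \<partial>M)"
    using integral_distr[OF c borel_measurable_integrable[OF \<phi>]] d by simp
qed

text \<open>
  The arguments of a kernel are either integration variables or, as prescribed by \<open>\<sigma>\<close>, spatial
  variables; differentiating in the measure turns one of the former into the latter.
\<close>
definition slot :: "(nat \<Rightarrow> nat option) \<Rightarrow> (nat \<Rightarrow> 'a) \<Rightarrow> (nat \<Rightarrow> 'a) \<Rightarrow> nat \<Rightarrow> 'a" where
  "slot \<sigma> x y l = (case \<sigma> l of None \<Rightarrow> y l | Some k \<Rightarrow> x k)"

definition kernel_integral ::
  "nat \<Rightarrow> ((nat \<Rightarrow> 'a::euclidean_space) \<Rightarrow> real) \<Rightarrow> (nat \<Rightarrow> nat option) \<Rightarrow> 'a measure \<Rightarrow> (nat \<Rightarrow> 'a) \<Rightarrow> real" where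
  "kernel_integral m f \<sigma> \<mu> x = (\<integral>y. f (slot \<sigma> x y) \<partial>PiM {..<m} (\<lambda>_. \<mu>))"

lemma coordwise_continuous_slot:
  assumes "coordwise_continuous m g"
  shows "coordwise_continuous m (\<lambda>y. g (slot \<sigma> x y))"
  unfolding coordwise_continuous_def
proof (intro allI impI)
  fix s and e :: real assume "0 < e"
  then obtain d where d: "0 < d" "\<forall>s'. (\<forall>l<m. norm (s' l - slot \<sigma> x s l) < d) \<longrightarrow> \<bar>g s' - g (slot \<sigma> x s)\<bar> < e"
    using assms unfolding coordwise_continuous_def by blast
  show "\<exists>d>0. \<forall>s'. (\<forall>l<m. norm (s' l - s l) < d) \<longrightarrow> \<bar>g (slot \<sigma> x s') - g (slot \<sigma> x s)\<bar> < e"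
    using d by (intro exI[of _ d]) (auto simp: slot_def split: option.split)
qed

lemma coordwise_continuous_if_lipschitz:
  assumes "0 \<le> L" "\<And>s s'. \<bar>g s' - g s\<bar> \<le> L * (\<Sum>l<m. norm (s' l - s l))"
  shows "coordwise_continuous m g"
  unfolding coordwise_continuous_def
proof (intro allI impI)
  fix s and e :: real assume "0 < e"
  have pos: "0 < L * real m + 1" using assms(1) by (simp add: add_nonneg_pos)
  show "\<exists>d>0. \<forall>s'. (\<forall>l<m. norm (s' l - s l) < d) \<longrightarrow> \<bar>g s' - g s\<bar> < e"
  proof (intro exI[of _ "e / (L * real m + 1)"] conjI allI impI)
    show "0 < e / (L * real m + 1)" using pos \<open>0 < e\<close> by simp
    fix s' assume "\<forall>l<m. norm (s' l - s l) < e / (L * real m + 1)"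
    then have "(\<Sum>l<m. norm (s' l - s l)) \<le> real m * (e / (L * real m + 1))"
      using sum_bounded_above[of "{..<m}" "\<lambda>l. norm (s' l - s l)" "e / (L * real m + 1)"] by (simp add: less_imp_le)
    then have "\<bar>g s' - g s\<bar> \<le> L * (real m * (e / (L * real m + 1)))"
      using assms by (meson mult_left_mono order_trans)
    also have "\<dots> < e" using pos \<open>0 < e\<close> by (simp add: field_simps)
    finally show "\<bar>g s' - g s\<bar> < e" .
  qed
qed

text \<open>
  The Lipschitz bound combines Taylor's formula for shifts of size at most 1 with the bound on the
  function for larger ones.
\<close>
lemma smooth_kernel_unfold:
  fixes f :: "(nat \<Rightarrow> 'a::euclidean_space) \<Rightarrow> real"
  assumes "smooth_kernel m f"
  obtains B L C G where "0 \<le> B" "0 \<le> L" "0 \<le> C" "\<And>s. \<bar>f s\<bar> \<le> B"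
    "\<And>s s'. \<bar>f s' - f s\<bar> \<le> L * (\<Sum>l<m. norm (s' l - s l))"
    "\<And>s t. \<bar>f (\<lambda>l. s l + t l) - f s - (\<Sum>l<m. G l s \<bullet> t l)\<bar> \<le> C * (\<Sum>l<m. norm (t l))\<^sup>2"
    "\<And>l b. l < m \<Longrightarrow> b \<in> Basis \<Longrightarrow> smooth_kernel m (\<lambda>s. G l s \<bullet> b)"
  using assms
proof (cases rule: smooth_kernel.cases)
  case (1 B G C)
  have "\<exists>K. \<forall>s. norm (G l s) \<le> K" if "l < m" for l
  proof -
    have "\<exists>K. \<forall>s. \<bar>G l s \<bullet> b\<bar> \<le> K" if b: "b \<in> Basis" for b
      using 1(3)[OF \<open>l < m\<close> b] by (cases rule: smooth_kernel.cases) auto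
    then obtain K where "\<And>b s. b \<in> Basis \<Longrightarrow> \<bar>G l s \<bullet> b\<bar> \<le> K b" by metis
    then have "norm (G l s) \<le> (\<Sum>b\<in>Basis. K b)" for s
      by (intro order_trans[OF norm_le_l1] sum_mono)
    then show ?thesis by blast
  qed
  then obtain K where K: "\<And>l s. l < m \<Longrightarrow> norm (G l s) \<le> K l" by metis
  define K' where "K' = (\<Sum>l<m. K l)"
  have K': "norm (G l s) \<le> K'" "0 \<le> K'" if "l < m" for l s
  proof -
    have K0: "0 \<le> K l" if "l < m" for l using K[OF that] norm_ge_zero order_trans by blast
    have "K l \<le> K'" unfolding K'_def using that K0 by (intro member_le_sum) auto
    then show "norm (G l s) \<le> K'" "0 \<le> K'" using K[OF that, of s] K0[OF that] by auto
  qed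
  have B: "0 \<le> B" using 1(1)[of undefined] by (rule order_trans[OF abs_ge_zero])
  define C' where "C' = \<bar>C\<bar>"
  define L where "L = \<bar>K'\<bar> + C' + 2 * B"
  have taylor: "\<bar>f (\<lambda>l. s l + t l) - f s - (\<Sum>l<m. G l s \<bullet> t l)\<bar> \<le> C' * (\<Sum>l<m. norm (t l))\<^sup>2" for s t
    by (rule order_trans[OF 1(2)]) (simp add: C'_def mult_right_mono)
  have lip: "\<bar>f s' - f s\<bar> \<le> L * (\<Sum>l<m. norm (s' l - s l))" for s s'
  proof -
    define S where "S = (\<Sum>l<m. norm (s' l - s l))"
    have S: "0 \<le> S" by (simp add: S_def sum_nonneg)
    have "\<bar>\<Sum>l<m. G l s \<bullet> (s' l - s l)\<bar> \<le> (\<Sum>l<m. \<bar>K'\<bar> * norm (s' l - s l))"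
    proof (rule order_trans[OF sum_abs sum_mono])
      fix l assume "l \<in> {..<m}"
      then have "norm (G l s) \<le> \<bar>K'\<bar>" using K'(1)[of l s] by simp
      then show "\<bar>G l s \<bullet> (s' l - s l)\<bar> \<le> \<bar>K'\<bar> * norm (s' l - s l)"
        by (intro order_trans[OF Cauchy_Schwarz_ineq2] mult_right_mono) auto
    qed
    also have "\<dots> = \<bar>K'\<bar> * S" by (simp add: S_def sum_distrib_left)
    finally have 2: "\<bar>f s' - f s\<bar> \<le> \<bar>K'\<bar> * S + C' * S\<^sup>2"
      using taylor[of s "\<lambda>l. s' l - s l"] by (simp add: S_def)
    show ?thesis
    proof (cases "S \<le> 1")
      case True
      have "C' * S\<^sup>2 \<le> C' * S"
        using S True by (intro mult_left_mono) (auto simp: C'_def power2_eq_square mult_left_le)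
      moreover have "0 \<le> 2 * B * S" using B S by simp
      ultimately have "\<bar>K'\<bar> * S + C' * S\<^sup>2 \<le> L * S" by (simp add: L_def distrib_right)
      then show ?thesis using 2 by (simp add: S_def)
    next
      case False
      have "\<bar>f s' - f s\<bar> \<le> 2 * B * 1" using 1(1)[of s'] 1(1)[of s] by linarith
      also have "\<dots> \<le> L * S"
        using False B S by (intro mult_mono) (auto simp: L_def C'_def)
      finally show ?thesis by (simp add: S_def)
    qed
  qed
  show thesis
    by (rule that[OF B _ _ 1(1) lip taylor 1(3)]) (auto simp: L_def C'_def B)
qed

lemma smooth_kernel_continuous: "smooth_kernel m f \<Longrightarrow> coordwise_continuous m f"
  by (elim smooth_kernel_unfold) (rule coordwise_continuous_if_lipschitz)

lemma kernel_integrable: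
  fixes g :: "(nat \<Rightarrow> 'a::euclidean_space) \<Rightarrow> real"
  assumes g: "coordwise_continuous m g" and B: "\<And>s. \<bar>g s\<bar> \<le> B"
    and M: "prob_space M" and X: "X \<in> borel_measurable M"
  shows "integrable (PiM {..<m} (\<lambda>_. M)) (\<lambda>w. g (slot \<sigma> x (\<lambda>l. X (w l))))"
proof -
  interpret P: prob_space "PiM {..<m} (\<lambda>_. M)" using M by (rule prob_space_PiM)
  have "(\<lambda>w. X (w l)) \<in> borel_measurable (PiM {..<m} (\<lambda>_. M))" if "l < m" for l
    by (rule measurable_PiM_coordinate_compose[OF X that])
  then have "(\<lambda>w. g (slot \<sigma> x (\<lambda>l. X (w l)))) \<in> borel_measurable (PiM {..<m} (\<lambda>_. M))"
    by (rule coordwise_continuous_compose_measurable[OF coordwise_continuous_slot[OF g]])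
  then show ?thesis using B by (intro P.integrable_const_bound[where B=B]) auto
qed

lemma kernel_integral_distr:
  assumes "coordwise_continuous m f" "prob_space M" "X \<in> borel_measurable M"
  shows "kernel_integral m f \<sigma> (distr M borel X) x = (\<integral>w. f (slot \<sigma> x (\<lambda>l. X (w l))) \<partial>PiM {..<m} (\<lambda>_. M))"
  unfolding kernel_integral_def
  by (rule integral_PiM_distr[OF assms(2,3) coordwise_continuous_slot[OF assms(1)]])

lemma kernel_integrable_P2:
  assumes "coordwise_continuous m g" "\<And>s. \<bar>g s\<bar> \<le> B" "\<mu> \<in> P2"
  shows "integrable (PiM {..<m} (\<lambda>_. \<mu>)) (\<lambda>y. g (slot \<sigma> x y))"
  using kernel_integrable[OF assms(1,2) P2_prob[OF assms(3)] L2_measurable[OF P2_L2[OF assms(3)]]] by simp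

lemma kernel_integral_bounded:
  assumes g: "coordwise_continuous m g" and B: "\<And>s. \<bar>g s\<bar> \<le> B" and \<mu>: "\<mu> \<in> P2"
  shows "\<bar>kernel_integral m g \<sigma> \<mu> x\<bar> \<le> B"
proof -
  interpret P: prob_space "PiM {..<m} (\<lambda>_. \<mu>)" using P2_prob[OF \<mu>] by (rule prob_space_PiM)
  have "\<bar>kernel_integral m g \<sigma> \<mu> x\<bar> \<le> (\<integral>y. B \<partial>PiM {..<m} (\<lambda>_. \<mu>))"
    unfolding kernel_integral_def
    by (rule order_trans[OF integral_abs_bound integral_mono])
      (use kernel_integrable_P2[OF g B \<mu>] B in auto)
  then show ?thesis by (simp add: P.prob_space)
qed

lemma integrable_sum_norm_PiM:
  fixes Z :: "'w \<Rightarrow> 'a::euclidean_space"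
  assumes M: "prob_space M" and Z: "Z \<in> L2 M"
  shows "integrable (PiM {..<m} (\<lambda>_. M)) (\<lambda>w. \<Sum>l<m. norm (Z (w l)))"
    and "(\<integral>w. (\<Sum>l<m. norm (Z (w l))) \<partial>PiM {..<m} (\<lambda>_. M)) \<le> real m * L2norm M Z"
proof -
  note i = prob_space.expectation_norm_le_L2norm[OF M Z]
  note c = integral_PiM_component[OF M _ i(1)]
  show "integrable (PiM {..<m} (\<lambda>_. M)) (\<lambda>w. \<Sum>l<m. norm (Z (w l)))"
    by (intro Bochner_Integration.integrable_sum c(1)) simp
  have "(\<integral>w. (\<Sum>l<m. norm (Z (w l))) \<partial>PiM {..<m} (\<lambda>_. M)) = (\<Sum>l<m. \<integral>w. norm (Z (w l)) \<partial>PiM {..<m} (\<lambda>_. M))"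
    by (intro Bochner_Integration.integral_sum c(1)) simp
  also have "\<dots> = real m * (\<integral>\<omega>. norm (Z \<omega>) \<partial>M)"
    by (simp add: c(2))
  also have "\<dots> \<le> real m * L2norm M Z" by (intro mult_left_mono i(2)) simp
  finally show "(\<integral>w. (\<Sum>l<m. norm (Z (w l))) \<partial>PiM {..<m} (\<lambda>_. M)) \<le> real m * L2norm M Z" .
qed

lemma kernel_integral_lipschitz_law:
  fixes X Y :: "'w \<Rightarrow> 'a::euclidean_space"
  assumes L: "0 \<le> L" and lip: "\<And>s s'. \<bar>g s' - g s\<bar> \<le> L * (\<Sum>l<m. norm (s' l - s l))"
    and B: "\<And>s. \<bar>g s\<bar> \<le> B" and M: "prob_space M" and X: "X \<in> L2 M" and Y: "Y \<in> L2 M"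
  shows "\<bar>kernel_integral m g \<sigma> (distr M borel X) x - kernel_integral m g \<sigma> (distr M borel Y) x\<bar>
    \<le> L * real m * L2norm M (\<lambda>\<omega>. X \<omega> - Y \<omega>)"
proof -
  have g: "coordwise_continuous m g" by (rule coordwise_continuous_if_lipschitz[OF L lip])
  note Xm = L2_measurable[OF X] and Ym = L2_measurable[OF Y]
  note i = kernel_integrable[OF g B M Xm, of \<sigma> x] kernel_integrable[OF g B M Ym, of \<sigma> x]
  note s = integrable_sum_norm_PiM[OF M L2_diff[OF X Y], of m]
  have "\<bar>kernel_integral m g \<sigma> (distr M borel X) x - kernel_integral m g \<sigma> (distr M borel Y) x\<bar>
      = \<bar>\<integral>w. g (slot \<sigma> x (\<lambda>l. X (w l))) - g (slot \<sigma> x (\<lambda>l. Y (w l))) \<partial>PiM {..<m} (\<lambda>_. M)\<bar>"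
    unfolding kernel_integral_distr[OF g M Xm] kernel_integral_distr[OF g M Ym]
    by (simp only: Bochner_Integration.integral_diff[OF i])
  also have "\<dots> \<le> (\<integral>w. L * (\<Sum>l<m. norm (X (w l) - Y (w l))) \<partial>PiM {..<m} (\<lambda>_. M))"
  proof (rule order_trans[OF integral_abs_bound integral_mono])
    show "integrable (PiM {..<m} (\<lambda>_. M)) (\<lambda>w. \<bar>g (slot \<sigma> x (\<lambda>l. X (w l))) - g (slot \<sigma> x (\<lambda>l. Y (w l)))\<bar>)"
      by (intro integrable_abs Bochner_Integration.integrable_diff i)
    show "integrable (PiM {..<m} (\<lambda>_. M)) (\<lambda>w. L * (\<Sum>l<m. norm (X (w l) - Y (w l))))"
      using s(1) by (rule integrable_mult_right)
    fix w
    have "(\<Sum>l<m. norm (slot \<sigma> x (\<lambda>l. X (w l)) l - slot \<sigma> x (\<lambda>l. Y (w l)) l)) \<le> (\<Sum>l<m. norm (X (w l) - Y (w l)))"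
      by (intro sum_mono) (auto simp: slot_def split: option.split)
    then show "\<bar>g (slot \<sigma> x (\<lambda>l. X (w l))) - g (slot \<sigma> x (\<lambda>l. Y (w l)))\<bar> \<le> L * (\<Sum>l<m. norm (X (w l) - Y (w l)))"
      by (intro order_trans[OF lip] mult_left_mono L)
  qed
  also have "\<dots> = L * (\<integral>w. (\<Sum>l<m. norm (X (w l) - Y (w l))) \<partial>PiM {..<m} (\<lambda>_. M))"
    by (rule integral_mult_right_zero)
  also have "\<dots> \<le> L * (real m * L2norm M (\<lambda>\<omega>. X \<omega> - Y \<omega>))"
    by (intro mult_left_mono s(2) L)
  finally show ?thesis by (simp add: mult.assoc)
qed

lemma kernel_integral_lipschitz_W2:
  fixes \<mu> \<nu> :: "'a::euclidean_space measure"
  assumes L: "0 \<le> L" and lip: "\<And>s s'. \<bar>g s' - g s\<bar> \<le> L * (\<Sum>l<m. norm (s' l - s l))"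
    and B: "\<And>s. \<bar>g s\<bar> \<le> B" and P2: "\<mu> \<in> P2" "\<nu> \<in> P2"
  shows "\<bar>kernel_integral m g \<sigma> \<mu> x - kernel_integral m g \<sigma> \<nu> x\<bar> \<le> L * real m * W2 \<mu> \<nu>"
proof (rule field_le_epsilon)
  fix e :: real assume "0 < e"
  define K where "K = L * real m"
  have K: "0 \<le> K" using L by (simp add: K_def)
  define d where "d = e / (K + 1)"
  have d: "0 < d" "K * d \<le> e" using K \<open>0 < e\<close> by (auto simp: d_def field_simps)
  obtain \<pi> :: "('a \<times> 'a) measure" where \<pi>: "prob_space \<pi>" "sets \<pi> = sets borel"
      "distr \<pi> borel fst = \<mu>" "distr \<pi> borel snd = \<nu>"
      "fst \<in> L2 \<pi>" "snd \<in> L2 \<pi>" "L2norm \<pi> (\<lambda>z. fst z - snd z) < W2 \<mu> \<nu> + d"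
    by (rule W2_coupling[OF P2 d(1)])
  have "\<bar>kernel_integral m g \<sigma> \<mu> x - kernel_integral m g \<sigma> \<nu> x\<bar> \<le> K * L2norm \<pi> (\<lambda>z. fst z - snd z)"
    using kernel_integral_lipschitz_law[OF L lip B \<pi>(1,5,6)] by (simp add: \<pi>(3,4) K_def)
  also have "\<dots> \<le> K * (W2 \<mu> \<nu> + d)" using \<pi>(7) K by (intro mult_left_mono) auto
  finally show "\<bar>kernel_integral m g \<sigma> \<mu> x - kernel_integral m g \<sigma> \<nu> x\<bar> \<le> L * real m * W2 \<mu> \<nu> + e"
    using d(2) by (simp add: distrib_left K_def)
qed

lemma kernel_integral_lipschitz_space:
  fixes \<mu> :: "'a::euclidean_space measure"
  assumes L: "0 \<le> L" and lip: "\<And>s s'. \<bar>g s' - g s\<bar> \<le> L * (\<Sum>l<m. norm (s' l - s l))"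
    and B: "\<And>s. \<bar>g s\<bar> \<le> B" and \<mu>: "\<mu> \<in> P2" and \<sigma>: "\<And>l k. \<sigma> l = Some k \<Longrightarrow> k < j"
  shows "\<bar>kernel_integral m g \<sigma> \<mu> x' - kernel_integral m g \<sigma> \<mu> x\<bar> \<le> L * real m * (\<Sum>k<j. norm (x' k - x k))"
proof -
  interpret P: prob_space "PiM {..<m} (\<lambda>_. \<mu>)" using P2_prob[OF \<mu>] by (rule prob_space_PiM)
  have g: "coordwise_continuous m g" by (rule coordwise_continuous_if_lipschitz[OF L lip])
  note i = kernel_integrable_P2[OF g B \<mu>, of \<sigma> x'] kernel_integrable_P2[OF g B \<mu>, of \<sigma> x]
  define S where "S = (\<Sum>k<j. norm (x' k - x k))"
  have pw: "\<bar>g (slot \<sigma> x' y) - g (slot \<sigma> x y)\<bar> \<le> L * (real m * S)" for y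
  proof -
    have "norm (slot \<sigma> x' y l - slot \<sigma> x y l) \<le> S" for l
    proof (cases "\<sigma> l")
      case None
      then show ?thesis by (simp add: slot_def S_def sum_nonneg)
    next
      case (Some k)
      then show ?thesis unfolding S_def using \<sigma>[OF Some]
        by (simp add: slot_def) (rule member_le_sum, auto)
    qed
    then have "(\<Sum>l<m. norm (slot \<sigma> x' y l - slot \<sigma> x y l)) \<le> real m * S"
      using sum_bounded_above[of "{..<m}" "\<lambda>l. norm (slot \<sigma> x' y l - slot \<sigma> x y l)" S] by simp
    then show ?thesis by (intro order_trans[OF lip] mult_left_mono L)
  qed
  have "\<bar>kernel_integral m g \<sigma> \<mu> x' - kernel_integral m g \<sigma> \<mu> x\<bar>
      = \<bar>\<integral>y. g (slot \<sigma> x' y) - g (slot \<sigma> x y) \<partial>PiM {..<m} (\<lambda>_. \<mu>)\<bar>"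
    unfolding kernel_integral_def by (simp only: Bochner_Integration.integral_diff[OF i])
  also have "\<dots> \<le> (\<integral>y. L * (real m * S) \<partial>PiM {..<m} (\<lambda>_. \<mu>))"
    by (rule order_trans[OF integral_abs_bound integral_mono])
      (use pw in \<open>auto intro!: integrable_abs Bochner_Integration.integrable_diff i\<close>)
  finally show ?thesis by (simp add: P.prob_space S_def mult.assoc)
qed

section \<open>Derivatives of kernel integrals\<close>

lemma GDERIV_of_quadratic_remainder:
  fixes f :: "'a::euclidean_space \<Rightarrow> real"
  assumes "\<And>h. \<bar>f (x + h) - f x - h \<bullet> D\<bar> \<le> C * (norm h)\<^sup>2"
  shows "GDERIV f x :> D"
  unfolding gderiv_def has_derivative_at
proof
  show "bounded_linear (\<lambda>h. h \<bullet> D)" by (rule bounded_linear_inner_left)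
  show "((\<lambda>h. norm (f (x + h) - f x - h \<bullet> D) / norm h) \<longlongrightarrow> 0) (at 0)"
  proof (rule Lim_null_comparison[of _ "\<lambda>h. C * norm h"])
    show "((\<lambda>h. C * norm h) \<longlongrightarrow> 0) (at (0::'a))" by (auto intro!: tendsto_eq_intros)
    have "norm (norm (f (x + h) - f x - h \<bullet> D) / norm h) \<le> C * norm h" if "h \<noteq> 0" for h
    proof -
      have "\<bar>f (x + h) - f x - h \<bullet> D\<bar> / norm h \<le> C * (norm h)\<^sup>2 / norm h"
        using assms[of h] by (rule divide_right_mono) simp
      then show ?thesis using that by (simp add: power2_eq_square)
    qed
    then show "eventually (\<lambda>h. norm (norm (f (x + h) - f x - h \<bullet> D) / norm h) \<le> C * norm h) (at 0)"
      by (auto simp: eventually_at_filter)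
  qed
qed

text \<open>
  What \<open>has_L_derivativeI\<close> demands of the derivative, in a form that passes to finite sums.
\<close>
definition W2_lipschitz_bounded :: "('a::euclidean_space measure \<Rightarrow> 'a \<Rightarrow> 'b::real_normed_vector) \<Rightarrow> bool" where
  "W2_lipschitz_bounded P \<longleftrightarrow> (\<exists>K\<ge>0. \<exists>B. \<forall>\<mu>\<in>P2. \<forall>\<nu>\<in>P2. \<forall>y y'.
     norm (P \<mu> y) \<le> B \<and> norm (P \<mu> y - P \<nu> y') \<le> K * (W2 \<mu> \<nu> + norm (y - y')))"

lemma W2_lipschitz_bounded_zero: "W2_lipschitz_bounded (\<lambda>\<mu> y. 0)"
  unfolding W2_lipschitz_bounded_def
  by (rule exI[of _ 0], rule conjI[OF order_refl], rule exI[of _ 0]) simp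

lemma W2_lipschitz_bounded_add:
  assumes "W2_lipschitz_bounded P" "W2_lipschitz_bounded Q"
  shows "W2_lipschitz_bounded (\<lambda>\<mu> y. P \<mu> y + Q \<mu> y)"
proof -
  obtain K B where K: "0 \<le> K" "\<And>\<mu> \<nu> y y'. \<mu> \<in> P2 \<Longrightarrow> \<nu> \<in> P2 \<Longrightarrow>
      norm (P \<mu> y) \<le> B \<and> norm (P \<mu> y - P \<nu> y') \<le> K * (W2 \<mu> \<nu> + norm (y - y'))"
    using assms(1) unfolding W2_lipschitz_bounded_def by blast
  obtain K' B' where K': "0 \<le> K'" "\<And>\<mu> \<nu> y y'. \<mu> \<in> P2 \<Longrightarrow> \<nu> \<in> P2 \<Longrightarrow>
      norm (Q \<mu> y) \<le> B' \<and> norm (Q \<mu> y - Q \<nu> y') \<le> K' * (W2 \<mu> \<nu> + norm (y - y'))"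
    using assms(2) unfolding W2_lipschitz_bounded_def by blast
  show ?thesis
    unfolding W2_lipschitz_bounded_def
  proof (rule exI[of _ "K + K'"], rule conjI[rotated], rule exI[of _ "B + B'"], intro ballI allI conjI)
    fix \<mu> \<nu> :: "'a measure" and y y' assume m: "\<mu> \<in> P2" "\<nu> \<in> P2"
    show "norm (P \<mu> y + Q \<mu> y) \<le> B + B'"
      using K(2)[OF m, of y y] K'(2)[OF m, of y y] norm_triangle_ineq[of "P \<mu> y" "Q \<mu> y"] by linarith
    have "P \<mu> y + Q \<mu> y - (P \<nu> y' + Q \<nu> y') = (P \<mu> y - P \<nu> y') + (Q \<mu> y - Q \<nu> y')" by simp
    then have "norm (P \<mu> y + Q \<mu> y - (P \<nu> y' + Q \<nu> y')) \<le> norm (P \<mu> y - P \<nu> y') + norm (Q \<mu> y - Q \<nu> y')"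
      using norm_triangle_ineq by metis
    also have "\<dots> \<le> K * (W2 \<mu> \<nu> + norm (y - y')) + K' * (W2 \<mu> \<nu> + norm (y - y'))"
      using K(2)[OF m, of y y'] K'(2)[OF m, of y y'] by (intro add_mono) auto
    finally show "norm (P \<mu> y + Q \<mu> y - (P \<nu> y' + Q \<nu> y')) \<le> (K + K') * (W2 \<mu> \<nu> + norm (y - y'))"
      by (simp add: distrib_right)
  qed (use K(1) K'(1) in auto)
qed

lemma W2_lipschitz_bounded_sum:
  "(\<And>a. a \<in> A \<Longrightarrow> W2_lipschitz_bounded (P a)) \<Longrightarrow> W2_lipschitz_bounded (\<lambda>\<mu> y. \<Sum>a\<in>A. P a \<mu> y)"
  by (induction A rule: infinite_finite_induct) (auto intro: W2_lipschitz_bounded_zero W2_lipschitz_bounded_add)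

lemma W2_lipschitz_bounded_kernel_integral:
  fixes g :: "(nat \<Rightarrow> 'a::euclidean_space) \<Rightarrow> real"
  assumes "smooth_kernel m g" and \<sigma>: "\<And>l k. \<sigma> l = Some k \<Longrightarrow> k < Suc j" and b: "norm b = 1"
  shows "W2_lipschitz_bounded (\<lambda>\<mu> y. kernel_integral m g \<sigma> \<mu> (x(j := y)) *\<^sub>R b)"
  using assms(1)
proof (cases rule: smooth_kernel_unfold)
  case (1 B L C G)
  note g = smooth_kernel_continuous[OF assms(1)]
  have K: "0 \<le> L * real m" using 1(2) by simp
  show ?thesis
    unfolding W2_lipschitz_bounded_def
  proof (rule exI[of _ "L * real m"], rule conjI[OF K], rule exI[of _ B], intro ballI allI conjI)
    fix \<mu> \<nu> :: "'a measure" and y y' assume m: "\<mu> \<in> P2" "\<nu> \<in> P2"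
    let ?F = "\<lambda>\<mu> y. kernel_integral m g \<sigma> \<mu> (x(j := y))"
    show "norm (?F \<mu> y *\<^sub>R b) \<le> B"
      using kernel_integral_bounded[OF g 1(4) m(1)] b by simp
    have "\<bar>?F \<mu> y - ?F \<nu> y\<bar> \<le> L * real m * W2 \<mu> \<nu>"
      by (rule kernel_integral_lipschitz_W2[OF 1(2,5,4) m])
    moreover have "\<bar>?F \<nu> y - ?F \<nu> y'\<bar> \<le> L * real m * (\<Sum>k<Suc j. norm ((x(j := y)) k - (x(j := y')) k))"
      by (rule kernel_integral_lipschitz_space[OF 1(2,5,4) m(2) \<sigma>])
    moreover have "(\<Sum>k<Suc j. norm ((x(j := y)) k - (x(j := y')) k)) = norm (y - y')" by simp
    ultimately have "\<bar>?F \<mu> y - ?F \<nu> y'\<bar> \<le> L * real m * (W2 \<mu> \<nu> + norm (y - y'))"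
      by (simp add: distrib_left)
    then show "norm (?F \<mu> y *\<^sub>R b - ?F \<nu> y' *\<^sub>R b) \<le> L * real m * (W2 \<mu> \<nu> + norm (y - y'))"
      using b by (simp flip: scaleR_left_diff_distrib)
  qed
qed

text \<open>
  A spatial variable may occupy several slots of the kernel; each contributes its partial gradient.
  The uniform remainder in Taylor's formula survives the integration.
\<close>
lemma slot_GDERIV:
  fixes f :: "(nat \<Rightarrow> 'a::euclidean_space) \<Rightarrow> real"
  assumes f: "coordwise_continuous m f" "\<And>s. \<bar>f s\<bar> \<le> B"
    and taylor: "\<And>s t. \<bar>f (\<lambda>l. s l + t l) - f s - (\<Sum>l<m. G l s \<bullet> t l)\<bar> \<le> C * (\<Sum>l<m. norm (t l))\<^sup>2"
    and G: "\<And>l b. l < m \<Longrightarrow> b \<in> Basis \<Longrightarrow> smooth_kernel m (\<lambda>s. G l s \<bullet> b)"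
    and C: "0 \<le> C" and \<mu>: "\<mu> \<in> P2"
  shows "GDERIV (\<lambda>y. kernel_integral m f \<sigma> \<mu> (x(k := y))) (x k) :>
    (\<Sum>l<m. if \<sigma> l = Some k then \<Sum>b\<in>Basis. kernel_integral m (\<lambda>s. G l s \<bullet> b) \<sigma> \<mu> x *\<^sub>R b else 0)"
    (is "GDERIV _ _ :> ?D")
proof (rule GDERIV_of_quadratic_remainder[where C="C * (real m)\<^sup>2"])
  fix h :: 'a
  interpret P: prob_space "PiM {..<m} (\<lambda>_. \<mu>)" using P2_prob[OF \<mu>] by (rule prob_space_PiM)
  define t where "t = (\<lambda>l. if \<sigma> l = Some k then h else 0)"
  have slot: "slot \<sigma> (x(k := x k + h)) y = (\<lambda>l. slot \<sigma> x y l + t l)" for y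
    by (auto simp: slot_def t_def fun_eq_iff split: option.split)
  have Gi: "integrable (PiM {..<m} (\<lambda>_. \<mu>)) (\<lambda>y. G l (slot \<sigma> x y) \<bullet> b)" if "l < m" "b \<in> Basis" for l b
    using G[OF that]
  proof (cases rule: smooth_kernel_unfold)
    case (1 B')
    show ?thesis by (rule kernel_integrable_P2[OF smooth_kernel_continuous[OF G[OF that]] 1(4) \<mu>])
  qed
  have expand: "G l s \<bullet> t l = (\<Sum>b\<in>Basis. (G l s \<bullet> b) * (t l \<bullet> b))" for l s
    by (rule euclidean_inner)
  have Gti: "integrable (PiM {..<m} (\<lambda>_. \<mu>)) (\<lambda>y. G l (slot \<sigma> x y) \<bullet> t l)" if "l < m" for l
    unfolding expand using Gi[OF that] by (intro Bochner_Integration.integrable_sum integrable_mult_left) auto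
  have Gint: "(\<integral>y. G l (slot \<sigma> x y) \<bullet> t l \<partial>PiM {..<m} (\<lambda>_. \<mu>))
      = h \<bullet> (if \<sigma> l = Some k then \<Sum>b\<in>Basis. kernel_integral m (\<lambda>s. G l s \<bullet> b) \<sigma> \<mu> x *\<^sub>R b else 0)" if "l < m" for l
  proof -
    have "(\<integral>y. G l (slot \<sigma> x y) \<bullet> t l \<partial>PiM {..<m} (\<lambda>_. \<mu>))
        = (\<Sum>b\<in>Basis. kernel_integral m (\<lambda>s. G l s \<bullet> b) \<sigma> \<mu> x * (t l \<bullet> b))"
      unfolding expand kernel_integral_def using Gi[OF that]
      by (subst Bochner_Integration.integral_sum) (auto intro: integrable_mult_left)
    also have "\<dots> = h \<bullet> (if \<sigma> l = Some k then \<Sum>b\<in>Basis. kernel_integral m (\<lambda>s. G l s \<bullet> b) \<sigma> \<mu> x *\<^sub>R b else 0)"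
      by (simp add: t_def inner_sum_right)
    finally show ?thesis .
  qed
  define R where "R = (\<lambda>y. f (\<lambda>l. slot \<sigma> x y l + t l) - f (slot \<sigma> x y) - (\<Sum>l<m. G l (slot \<sigma> x y) \<bullet> t l))"
  have i1: "integrable (PiM {..<m} (\<lambda>_. \<mu>)) (\<lambda>y. f (\<lambda>l. slot \<sigma> x y l + t l))"
    using kernel_integrable_P2[OF f \<mu>, of \<sigma> "x(k := x k + h)"] by (simp add: slot)
  have i2: "integrable (PiM {..<m} (\<lambda>_. \<mu>)) (\<lambda>y. f (slot \<sigma> x y))"
    by (rule kernel_integrable_P2[OF f \<mu>])
  have i3: "integrable (PiM {..<m} (\<lambda>_. \<mu>)) (\<lambda>y. \<Sum>l<m. G l (slot \<sigma> x y) \<bullet> t l)"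
    by (intro Bochner_Integration.integrable_sum Gti) simp
  have "kernel_integral m f \<sigma> \<mu> (x(k := x k + h)) - kernel_integral m f \<sigma> \<mu> (x(k := x k)) - h \<bullet> ?D
      = (\<integral>y. R y \<partial>PiM {..<m} (\<lambda>_. \<mu>))"
  proof -
    have "(\<integral>y. (\<Sum>l<m. G l (slot \<sigma> x y) \<bullet> t l) \<partial>PiM {..<m} (\<lambda>_. \<mu>)) = h \<bullet> ?D"
      unfolding inner_sum_right using Gti Gint by (subst Bochner_Integration.integral_sum) auto
    then show ?thesis
      unfolding R_def kernel_integral_def slot fun_upd_triv
      by (subst Bochner_Integration.integral_diff[OF Bochner_Integration.integrable_diff[OF i1 i2] i3],
          subst Bochner_Integration.integral_diff[OF i1 i2]) simp
  qed
  also have "\<bar>\<dots>\<bar> \<le> (\<integral>y. C * (real m * norm h)\<^sup>2 \<partial>PiM {..<m} (\<lambda>_. \<mu>))"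
  proof (rule order_trans[OF integral_abs_bound integral_mono])
    show "integrable (PiM {..<m} (\<lambda>_. \<mu>)) (\<lambda>y. \<bar>R y\<bar>)"
      unfolding R_def by (intro integrable_abs Bochner_Integration.integrable_diff i1 i2 i3)
    fix y
    have "(\<Sum>l<m. norm (t l)) \<le> real m * norm h"
      using sum_bounded_above[of "{..<m}" "\<lambda>l. norm (t l)" "norm h"] by (auto simp: t_def)
    then have "C * (\<Sum>l<m. norm (t l))\<^sup>2 \<le> C * (real m * norm h)\<^sup>2"
      by (intro mult_left_mono power_mono C sum_nonneg) auto
    then show "\<bar>R y\<bar> \<le> C * (real m * norm h)\<^sup>2"
      unfolding R_def by (rule order_trans[OF taylor])
  qed simp
  also have "\<dots> = C * (real m)\<^sup>2 * (norm h)\<^sup>2" by (simp add: P.prob_space power_mult_distrib)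
  finally show "\<bar>kernel_integral m f \<sigma> \<mu> (x(k := x k + h)) - kernel_integral m f \<sigma> \<mu> (x(k := x k)) - h \<bullet> ?D\<bar>
      \<le> C * (real m)\<^sup>2 * (norm h)\<^sup>2" .
qed

text \<open>
  Integrating out the \<open>l\<close>-th variable last turns it into a spatial variable: by independence it
  may be replaced by a further copy.
\<close>
lemma integral_split_coordinate:
  fixes \<xi> :: "'w \<Rightarrow> 'a::euclidean_space" and \<zeta> :: "'w \<Rightarrow> real"
  assumes \<Omega>: "prob_space \<Omega>" and \<xi>: "\<xi> \<in> borel_measurable \<Omega>" and \<zeta>: "integrable \<Omega> \<zeta>"
    and g: "coordwise_continuous m g" and B: "\<And>s. \<bar>g s\<bar> \<le> B"
    and l: "l < m" "\<sigma> l = None" and \<sigma>: "\<And>i k. \<sigma> i = Some k \<Longrightarrow> k < j"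
  shows "integrable (PiM {..<m} (\<lambda>_. \<Omega>)) (\<lambda>w. g (slot \<sigma> x (\<lambda>i. \<xi> (w i))) * \<zeta> (w l))"
    and "integrable \<Omega> (\<lambda>\<omega>. kernel_integral m g (\<sigma>(l := Some j)) (distr \<Omega> borel \<xi>) (x(j := \<xi> \<omega>)) * \<zeta> \<omega>)"
    and "(\<integral>w. g (slot \<sigma> x (\<lambda>i. \<xi> (w i))) * \<zeta> (w l) \<partial>PiM {..<m} (\<lambda>_. \<Omega>))
      = (\<integral>\<omega>. kernel_integral m g (\<sigma>(l := Some j)) (distr \<Omega> borel \<xi>) (x(j := \<xi> \<omega>)) * \<zeta> \<omega> \<partial>\<Omega>)"
proof -
  let ?P = "PiM {..<m} (\<lambda>_. \<Omega>)"
  interpret Om: prob_space \<Omega> by fact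
  interpret Q: prob_space ?P using \<Omega> by (rule prob_space_PiM)
  interpret pp: pair_prob_space \<Omega> ?P ..
  define \<Phi> where "\<Phi> = (\<lambda>w. g (slot \<sigma> x (\<lambda>i. \<xi> (w i))) * \<zeta> (w l))"
  note gi = kernel_integrable[OF g B \<Omega> \<xi>]
  have \<Phi>: "integrable ?P \<Phi>"
  proof (rule Bochner_Integration.integrable_bound)
    have z: "integrable ?P (\<lambda>w. \<zeta> (w l))" by (rule integral_PiM_component(1)[OF \<Omega> l(1) \<zeta>])
    show "integrable ?P (\<lambda>w. B * \<zeta> (w l))" using z by (rule integrable_mult_right)
    show "\<Phi> \<in> borel_measurable ?P"
      unfolding \<Phi>_def by (intro borel_measurable_times borel_measurable_integrable gi z)
    have "0 \<le> B" using B[of undefined] by (rule order_trans[OF abs_ge_zero])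
    then show "AE w in ?P. norm (\<Phi> w) \<le> norm (B * \<zeta> (w l))"
      using B by (intro AE_I2) (simp add: \<Phi>_def abs_mult mult_right_mono)
  qed
  then show "integrable ?P (\<lambda>w. g (slot \<sigma> x (\<lambda>i. \<xi> (w i))) * \<zeta> (w l))" by (simp add: \<Phi>_def)
  define T where "T = (\<lambda>(\<omega>, w :: nat \<Rightarrow> 'w). w(l := \<omega>))"
  have ins: "insert l {..<m} = {..<m}" using l(1) by auto
  have d: "distr (\<Omega> \<Otimes>\<^sub>M ?P) ?P T = ?P"
    using distr_pair_PiM_eq_PiM[of "{..<m}" "\<lambda>_. \<Omega>" l] \<Omega> unfolding ins T_def by simp
  have Tm: "T \<in> measurable (\<Omega> \<Otimes>\<^sub>M ?P) ?P"
    unfolding T_def case_prod_beta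
    by (rule measurable_fun_upd[where J="{..<m}"]) (use l(1) in auto)
  define \<Psi> where "\<Psi> = (\<lambda>z. \<Phi> (T z))"
  have \<Psi>: "\<Psi> (\<omega>, w) = g (slot (\<sigma>(l := Some j)) (x(j := \<xi> \<omega>)) (\<lambda>i. \<xi> (w i))) * \<zeta> \<omega>" for \<omega> w
  proof -
    have "slot \<sigma> x (\<lambda>i. \<xi> ((w(l := \<omega>)) i)) i = slot (\<sigma>(l := Some j)) (x(j := \<xi> \<omega>)) (\<lambda>i. \<xi> (w i)) i" for i
      using l(2) \<sigma>[of i] by (auto simp: slot_def split: option.split)
    then have "slot \<sigma> x (\<lambda>i. \<xi> ((w(l := \<omega>)) i)) = slot (\<sigma>(l := Some j)) (x(j := \<xi> \<omega>)) (\<lambda>i. \<xi> (w i))"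
      by (rule ext)
    then show ?thesis by (simp only: \<Psi>_def \<Phi>_def T_def prod.case fun_upd_same)
  qed
  have i: "integrable (\<Omega> \<Otimes>\<^sub>M ?P) \<Psi>"
    unfolding \<Psi>_def using integrable_distr[OF Tm, of \<Phi>] \<Phi> by (simp add: d)
  have inner: "(\<integral>w. \<Psi> (\<omega>, w) \<partial>?P) = kernel_integral m g (\<sigma>(l := Some j)) (distr \<Omega> borel \<xi>) (x(j := \<xi> \<omega>)) * \<zeta> \<omega>" for \<omega>
    unfolding \<Psi> kernel_integral_distr[OF g \<Omega> \<xi>] by (rule integral_mult_left_zero)
  show "integrable \<Omega> (\<lambda>\<omega>. kernel_integral m g (\<sigma>(l := Some j)) (distr \<Omega> borel \<xi>) (x(j := \<xi> \<omega>)) * \<zeta> \<omega>)"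
    using pp.integrable_fst'[OF i] unfolding inner .
  have "(\<integral>w. \<Phi> w \<partial>?P) = (\<integral>z. \<Psi> z \<partial>(\<Omega> \<Otimes>\<^sub>M ?P))"
    unfolding \<Psi>_def using integral_distr[OF Tm borel_measurable_integrable[OF \<Phi>]] by (simp add: d)
  also have "\<dots> = (\<integral>\<omega>. (\<integral>w. \<Psi> (\<omega>, w) \<partial>?P) \<partial>\<Omega>)" by (rule pp.integral_fst'[OF i, symmetric])
  finally show "(\<integral>w. g (slot \<sigma> x (\<lambda>i. \<xi> (w i))) * \<zeta> (w l) \<partial>?P)
      = (\<integral>\<omega>. kernel_integral m g (\<sigma>(l := Some j)) (distr \<Omega> borel \<xi>) (x(j := \<xi> \<omega>)) * \<zeta> \<omega> \<partial>\<Omega>)"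
    unfolding inner by (simp add: \<Phi>_def)
qed

text \<open>
  The lifting at \<open>\<xi>\<close> and at \<open>\<xi> + \<eta>\<close> is expressed by \<open>m\<close> independent copies, and Taylor's formula for
  the kernel is integrated. In the linear term, \<open>integral_split_coordinate\<close> isolates the copy of \<open>\<eta>\<close>.
\<close>
lemma kernel_integral_L_derivative:
  fixes f :: "(nat \<Rightarrow> 'a::euclidean_space) \<Rightarrow> real" and \<Omega> :: "'w measure"
  assumes \<Omega>: "prob_space \<Omega>" and f: "coordwise_continuous m f" "\<And>s. \<bar>f s\<bar> \<le> B"
    and taylor: "\<And>s t. \<bar>f (\<lambda>l. s l + t l) - f s - (\<Sum>l<m. G l s \<bullet> t l)\<bar> \<le> C * (\<Sum>l<m. norm (t l))\<^sup>2"
    and G: "\<And>l b. l < m \<Longrightarrow> b \<in> Basis \<Longrightarrow> smooth_kernel m (\<lambda>s. G l s \<bullet> b)"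
    and C: "0 \<le> C" and \<sigma>: "\<And>l k. \<sigma> l = Some k \<Longrightarrow> k < j"
  shows "has_L_derivative \<Omega> (\<lambda>\<mu>. kernel_integral m f \<sigma> \<mu> x)
    (\<lambda>\<mu> y. \<Sum>l<m. if \<sigma> l = None
      then \<Sum>b\<in>Basis. kernel_integral m (\<lambda>s. G l s \<bullet> b) (\<sigma>(l := Some j)) \<mu> (x(j := y)) *\<^sub>R b else 0)"
    (is "has_L_derivative \<Omega> ?F ?P")
proof -
  have P0: "W2_lipschitz_bounded ?P"
  proof (rule W2_lipschitz_bounded_sum)
    fix l assume l: "l \<in> {..<m}"
    have s: "i < Suc j" if "(\<sigma>(l := Some j)) l' = Some i" for l' i
      using that \<sigma>[of l' i] by (auto split: if_splits simp: less_Suc_eq)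
    show "W2_lipschitz_bounded (\<lambda>\<mu> y. if \<sigma> l = None
        then \<Sum>b\<in>Basis. kernel_integral m (\<lambda>s. G l s \<bullet> b) (\<sigma>(l := Some j)) \<mu> (x(j := y)) *\<^sub>R b else 0)"
    proof (cases "\<sigma> l = None")
      case True
      have "W2_lipschitz_bounded (\<lambda>\<mu> y. \<Sum>b\<in>Basis. kernel_integral m (\<lambda>s. G l s \<bullet> b) (\<sigma>(l := Some j)) \<mu> (x(j := y)) *\<^sub>R b)"
        using l by (intro W2_lipschitz_bounded_sum W2_lipschitz_bounded_kernel_integral G s) auto
      then show ?thesis using True by simp
    next
      case False
      then obtain k where "\<sigma> l = Some k" by blast
      then show ?thesis by (simp add: W2_lipschitz_bounded_zero)
    qed
  qed
  obtain K B' where KB: "0 \<le> K" "\<And>\<mu> \<nu> y y'. \<mu> \<in> P2 \<Longrightarrow> \<nu> \<in> P2 \<Longrightarrow>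
      norm (?P \<mu> y) \<le> B' \<and> norm (?P \<mu> y - ?P \<nu> y') \<le> K * (W2 \<mu> \<nu> + norm (y - y'))"
    using P0 unfolding W2_lipschitz_bounded_def by blast
  let ?Q = "PiM {..<m} (\<lambda>_. \<Omega>)"
  show ?thesis
  proof (rule has_L_derivativeI[OF \<Omega> KB(1), where C="C * (real m)\<^sup>2" and B=B'])
    show "0 \<le> C * (real m)\<^sup>2" using C by simp
    show "norm (?P \<mu> y) \<le> B'" if "\<mu> \<in> P2" for \<mu> y using KB(2)[OF that that] by blast
    show "norm (?P \<mu> y - ?P \<nu> y') \<le> K * (W2 \<mu> \<nu> + norm (y - y'))" if "\<mu> \<in> P2" "\<nu> \<in> P2" for \<mu> \<nu> y y'
      using KB(2)[OF that] by blast
    fix \<xi> \<eta> :: "'w \<Rightarrow> 'a" assume \<xi>: "\<xi> \<in> L2 \<Omega>" and \<eta>: "\<eta> \<in> L2 \<Omega>"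
    note \<xi>m = L2_measurable[OF \<xi>] and \<xi>\<eta>m = L2_measurable[OF L2_add[OF \<xi> \<eta>]]
    define s where "s = (\<lambda>w. slot \<sigma> x (\<lambda>l. \<xi> (w l)))"
    define t where "t = (\<lambda>w l. if \<sigma> l = None then \<eta> (w l) else 0)"
    have slot: "slot \<sigma> x (\<lambda>l. \<xi> (w l) + \<eta> (w l)) = (\<lambda>l. s w l + t w l)" for w
      by (auto simp: slot_def s_def t_def fun_eq_iff split: option.split)
    have \<eta>b: "integrable \<Omega> (\<lambda>\<omega>. \<eta> \<omega> \<bullet> b)" for b
      using prob_space.expectation_norm_le_L2norm(1)[OF \<Omega> \<eta>] L2_measurable[OF \<eta>]
      by (intro integrable_inner_left) (simp add: integrable_norm_iff)
    define A where "A = (\<lambda>l b \<omega>. kernel_integral m (\<lambda>s. G l s \<bullet> b) (\<sigma>(l := Some j)) (distr \<Omega> borel \<xi>) (x(j := \<xi> \<omega>)))"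
    have split: "integrable ?Q (\<lambda>w. (G l (s w) \<bullet> b) * (\<eta> (w l) \<bullet> b))"
      "integrable \<Omega> (\<lambda>\<omega>. A l b \<omega> * (\<eta> \<omega> \<bullet> b))"
      "(\<integral>w. (G l (s w) \<bullet> b) * (\<eta> (w l) \<bullet> b) \<partial>?Q) = (\<integral>\<omega>. A l b \<omega> * (\<eta> \<omega> \<bullet> b) \<partial>\<Omega>)"
      if lb: "l < m" "\<sigma> l = None" "b \<in> Basis" for l b
    proof -
      obtain B'' where B'': "\<And>s. \<bar>G l s \<bullet> b\<bar> \<le> B''"
        using G[OF lb(1,3)] by (elim smooth_kernel_unfold) blast
      note * = integral_split_coordinate[where g="\<lambda>s. G l s \<bullet> b" and \<zeta>="\<lambda>\<omega>. \<eta> \<omega> \<bullet> b" and \<sigma>=\<sigma> and l=l and j=j and x=x,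
          OF \<Omega> \<xi>m \<eta>b smooth_kernel_continuous[OF G[OF lb(1,3)]] B'' lb(1,2)]
      show "integrable ?Q (\<lambda>w. (G l (s w) \<bullet> b) * (\<eta> (w l) \<bullet> b))"
        "integrable \<Omega> (\<lambda>\<omega>. A l b \<omega> * (\<eta> \<omega> \<bullet> b))"
        "(\<integral>w. (G l (s w) \<bullet> b) * (\<eta> (w l) \<bullet> b) \<partial>?Q) = (\<integral>\<omega>. A l b \<omega> * (\<eta> \<omega> \<bullet> b) \<partial>\<Omega>)"
        unfolding s_def A_def by (rule *; erule \<sigma>)+
    qed
    define H where "H = (\<lambda>l w. if \<sigma> l = None then \<Sum>b\<in>Basis. (G l (s w) \<bullet> b) * (\<eta> (w l) \<bullet> b) else 0)"
    define H' where "H' = (\<lambda>l \<omega>. if \<sigma> l = None then \<Sum>b\<in>Basis. A l b \<omega> * (\<eta> \<omega> \<bullet> b) else 0)"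
    have H_eq: "G l (s w) \<bullet> t w l = H l w" for l w
      using euclidean_inner[of "G l (s w)" "\<eta> (w l)"] unfolding H_def t_def
      by (cases "\<sigma> l = None") (simp_all only: if_True if_False inner_zero_right simp_thms)
    have H'_eq: "?P (distr \<Omega> borel \<xi>) (\<xi> \<omega>) \<bullet> \<eta> \<omega> = (\<Sum>l<m. H' l \<omega>)" for \<omega>
    proof -
      have e: "(\<Sum>b\<in>Basis. A l b \<omega> *\<^sub>R b) \<bullet> \<eta> \<omega> = (\<Sum>b\<in>Basis. A l b \<omega> * (\<eta> \<omega> \<bullet> b))" for l
        unfolding inner_sum_left inner_scaleR_left by (intro sum.cong refl arg_cong2[where f="(*)"] inner_commute)
      have P: "?P (distr \<Omega> borel \<xi>) (\<xi> \<omega>) = (\<Sum>l<m. if \<sigma> l = None then \<Sum>b\<in>Basis. A l b \<omega> *\<^sub>R b else 0)"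
        by (simp only: A_def)
      have Q: "(\<Sum>l<m. if \<sigma> l = None then \<Sum>b\<in>Basis. A l b \<omega> *\<^sub>R b else 0) \<bullet> \<eta> \<omega> = (\<Sum>l<m. H' l \<omega>)"
        unfolding inner_sum_left H'_def by (simp only: if_distrib[of "\<lambda>v. v \<bullet> \<eta> \<omega>"] e inner_zero_left)
      show ?thesis by (simp only: P Q)
    qed
    have HH: "integrable ?Q (H l) \<and> integrable \<Omega> (H' l) \<and> (\<integral>w. H l w \<partial>?Q) = (\<integral>\<omega>. H' l \<omega> \<partial>\<Omega>)" if l: "l < m" for l
    proof (cases "\<sigma> l = None")
      case True
      have h: "H l = (\<lambda>w. \<Sum>b\<in>Basis. (G l (s w) \<bullet> b) * (\<eta> (w l) \<bullet> b))"
        "H' l = (\<lambda>\<omega>. \<Sum>b\<in>Basis. A l b \<omega> * (\<eta> \<omega> \<bullet> b))"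
        unfolding H_def H'_def by (simp_all only: True if_True simp_thms)
      have "(\<integral>w. (\<Sum>b\<in>Basis. (G l (s w) \<bullet> b) * (\<eta> (w l) \<bullet> b)) \<partial>?Q) = (\<Sum>b\<in>Basis. \<integral>w. (G l (s w) \<bullet> b) * (\<eta> (w l) \<bullet> b) \<partial>?Q)"
        by (intro Bochner_Integration.integral_sum split(1)[OF l True])
      also have "\<dots> = (\<Sum>b\<in>Basis. \<integral>\<omega>. A l b \<omega> * (\<eta> \<omega> \<bullet> b) \<partial>\<Omega>)"
        by (intro sum.cong refl split(3)[OF l True])
      also have "\<dots> = (\<integral>\<omega>. (\<Sum>b\<in>Basis. A l b \<omega> * (\<eta> \<omega> \<bullet> b)) \<partial>\<Omega>)"
        by (intro Bochner_Integration.integral_sum[symmetric] split(2)[OF l True])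
      finally show ?thesis unfolding h
        by (intro conjI Bochner_Integration.integrable_sum split(1,2)[OF l True])
    next
      case False
      have h: "H l = (\<lambda>w. 0)" "H' l = (\<lambda>\<omega>. 0)"
        unfolding H_def H'_def by (simp_all only: False if_False simp_thms)
      show ?thesis unfolding h by simp
    qed
    then have Hi: "integrable ?Q (H l)" and H'i: "integrable \<Omega> (H' l)"
      and HH': "(\<integral>w. H l w \<partial>?Q) = (\<integral>\<omega>. H' l \<omega> \<partial>\<Omega>)" if "l < m" for l
      using that by blast+
    have lin: "(\<integral>w. (\<Sum>l<m. H l w) \<partial>?Q) = (\<integral>\<omega>. ?P (distr \<Omega> borel \<xi>) (\<xi> \<omega>) \<bullet> \<eta> \<omega> \<partial>\<Omega>)"
      unfolding H'_eq using Hi H'i HH' by (simp add: Bochner_Integration.integral_sum)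
    have i1: "integrable ?Q (\<lambda>w. f (\<lambda>l. s w l + t w l))"
      using kernel_integrable[OF f \<Omega> \<xi>\<eta>m, of \<sigma> x] by (simp add: slot)
    have i2: "integrable ?Q (\<lambda>w. f (s w))"
      unfolding s_def by (rule kernel_integrable[OF f \<Omega> \<xi>m])
    have i3: "integrable ?Q (\<lambda>w. \<Sum>l<m. H l w)" using Hi by (intro Bochner_Integration.integrable_sum) auto
    define R where "R = (\<lambda>w. f (\<lambda>l. s w l + t w l) - f (s w) - (\<Sum>l<m. H l w))"
    have "?F (distr \<Omega> borel (\<lambda>\<omega>. \<xi> \<omega> + \<eta> \<omega>)) - ?F (distr \<Omega> borel \<xi>) - (\<integral>\<omega>. ?P (distr \<Omega> borel \<xi>) (\<xi> \<omega>) \<bullet> \<eta> \<omega> \<partial>\<Omega>)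
        = (\<integral>w. R w \<partial>?Q)"
      unfolding kernel_integral_distr[OF f(1) \<Omega> \<xi>m] kernel_integral_distr[OF f(1) \<Omega> \<xi>\<eta>m] slot lin[symmetric] R_def
      by (subst Bochner_Integration.integral_diff[OF Bochner_Integration.integrable_diff[OF i1 i2] i3],
          subst Bochner_Integration.integral_diff[OF i1 i2]) (simp add: s_def)
    also have "\<bar>\<dots>\<bar> \<le> (\<integral>w. (C * real m) * (\<Sum>l<m. (norm (\<eta> (w l)))\<^sup>2) \<partial>?Q)"
    proof (rule order_trans[OF integral_abs_bound integral_mono])
      show "integrable ?Q (\<lambda>w. \<bar>R w\<bar>)"
        unfolding R_def by (intro integrable_abs Bochner_Integration.integrable_diff i1 i2 i3)
      show "integrable ?Q (\<lambda>w. (C * real m) * (\<Sum>l<m. (norm (\<eta> (w l)))\<^sup>2))"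
        by (intro integrable_mult_right Bochner_Integration.integrable_sum integral_PiM_component(1)[OF \<Omega>] L2_integrable_sq[OF \<eta>]) simp
      fix w
      have "(\<Sum>l<m. norm (t w l)) \<le> (\<Sum>l<m. norm (\<eta> (w l)))"
        by (intro sum_mono) (simp add: t_def)
      then have "(\<Sum>l<m. norm (t w l))\<^sup>2 \<le> (\<Sum>l<m. norm (\<eta> (w l)))\<^sup>2"
        by (intro power_mono sum_nonneg) auto
      also have "\<dots> \<le> real m * (\<Sum>l<m. (norm (\<eta> (w l)))\<^sup>2)"
        using sum_squared_le_sum_of_squares[of "\<lambda>l. norm (\<eta> (w l))" "{..<m}"] by (simp add: mult.commute)
      finally have "C * (\<Sum>l<m. norm (t w l))\<^sup>2 \<le> C * (real m * (\<Sum>l<m. (norm (\<eta> (w l)))\<^sup>2))"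
        by (intro mult_left_mono C)
      then show "\<bar>R w\<bar> \<le> (C * real m) * (\<Sum>l<m. (norm (\<eta> (w l)))\<^sup>2)"
        unfolding R_def H_eq[symmetric] mult.assoc by (rule order_trans[OF taylor])
    qed
    also have "\<dots> = C * real m * (\<Sum>l<m. \<integral>w. (norm (\<eta> (w l)))\<^sup>2 \<partial>?Q)"
      by (subst integral_mult_right_zero, subst Bochner_Integration.integral_sum)
        (auto intro!: integral_PiM_component(1)[OF \<Omega>] L2_integrable_sq[OF \<eta>])
    also have "(\<Sum>l<m. \<integral>w. (norm (\<eta> (w l)))\<^sup>2 \<partial>?Q) = real m * (L2norm \<Omega> \<eta>)\<^sup>2"
      unfolding L2norm_sq using integral_PiM_component(2)[OF \<Omega> _ L2_integrable_sq[OF \<eta>]] by simp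
    also have "C * real m * (real m * (L2norm \<Omega> \<eta>)\<^sup>2) = C * (real m)\<^sup>2 * (L2norm \<Omega> \<eta>)\<^sup>2"
      by (simp add: power2_eq_square)
    finally show "\<bar>?F (distr \<Omega> borel (\<lambda>\<omega>. \<xi> \<omega> + \<eta> \<omega>)) - ?F (distr \<Omega> borel \<xi>) - (\<integral>\<omega>. ?P (distr \<Omega> borel \<xi>) (\<xi> \<omega>) \<bullet> \<eta> \<omega> \<partial>\<Omega>)\<bar>
        \<le> C * (real m)\<^sup>2 * (L2norm \<Omega> \<eta>)\<^sup>2" .
  qed
qed

lemma jointly_continuous_kernel_integral:
  fixes f :: "(nat \<Rightarrow> 'a::euclidean_space) \<Rightarrow> real"
  assumes f: "smooth_kernel m f" and \<sigma>: "\<And>l k. \<sigma> l = Some k \<Longrightarrow> k < j"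
  shows "jointly_continuous j (kernel_integral m f \<sigma>)"
  using f
proof (cases rule: smooth_kernel_unfold)
  case (1 B L C G)
  show ?thesis
    by (rule jointly_continuousI[where L="L * real m"])
      (use 1(2) kernel_integral_lipschitz_W2[OF 1(2,5,4)] kernel_integral_lipschitz_space[OF 1(2,5,4) _ \<sigma>] in auto)
qed

text \<open>
  The components of the spatial gradients and of the Lions derivative are sums of integrals of the
  same form. In the latter one more integration variable has become the new spatial variable \<open>j\<close>.
\<close>
theorem C_order_kernel_integral:
  fixes f :: "(nat \<Rightarrow> 'a::euclidean_space) \<Rightarrow> real"
  assumes \<Omega>: "prob_space \<Omega>" and "smooth_kernel m f" and "\<And>l k. \<sigma> l = Some k \<Longrightarrow> k < j"
  shows "C_order \<Omega> n j (kernel_integral m f \<sigma>)"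
  using assms(2,3)
proof (induction n arbitrary: j f \<sigma>)
  case 0
  then show ?case by (simp add: jointly_continuous_kernel_integral)
next
  case (Suc n)
  from Suc.prems(1) show ?case
  proof (cases rule: smooth_kernel_unfold)
    case (1 B L C G)
    note fc = smooth_kernel_continuous[OF Suc.prems(1)]
    have "jointly_continuous j (kernel_integral m f \<sigma>)"
      by (rule jointly_continuous_kernel_integral[OF Suc.prems])
    moreover have "\<exists>g. (\<forall>\<mu>\<in>P2. \<forall>x\<in>{..<j} \<rightarrow>\<^sub>E UNIV. GDERIV (\<lambda>y. kernel_integral m f \<sigma> \<mu> (x(k := y))) (x k) :> g \<mu> x) \<and>
        (\<forall>b\<in>Basis. C_order \<Omega> n j (\<lambda>\<mu> x. g \<mu> x \<bullet> b))" for k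
    proof (intro exI conjI ballI)
      show "GDERIV (\<lambda>y. kernel_integral m f \<sigma> \<mu> (x(k := y))) (x k) :>
          (\<lambda>\<mu> x. \<Sum>l<m. if \<sigma> l = Some k then \<Sum>b\<in>Basis. kernel_integral m (\<lambda>s. G l s \<bullet> b) \<sigma> \<mu> x *\<^sub>R b else 0) \<mu> x"
        if "\<mu> \<in> P2" for \<mu> x
        by (rule slot_GDERIV[OF fc 1(4,6,7,3) that])
      fix b :: 'a assume b: "b \<in> Basis"
      have "(if \<sigma> l = Some k then \<Sum>b\<in>Basis. kernel_integral m (\<lambda>s. G l s \<bullet> b) \<sigma> \<mu> x *\<^sub>R b else 0) \<bullet> b
          = (if \<sigma> l = Some k then kernel_integral m (\<lambda>s. G l s \<bullet> b) \<sigma> \<mu> x else 0)" for l \<mu> x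
        using b by (simp add: inner_sum_left_Basis)
      moreover have "C_order \<Omega> n j (\<lambda>\<mu> x. \<Sum>l<m. if \<sigma> l = Some k then kernel_integral m (\<lambda>s. G l s \<bullet> b) \<sigma> \<mu> x else 0)"
      proof (rule C_order_sum)
        fix l assume l: "l \<in> {..<m}"
        then have "C_order \<Omega> n j (kernel_integral m (\<lambda>s. G l s \<bullet> b) \<sigma>)"
          using b by (intro Suc.IH 1(7) Suc.prems(2)) auto
        then show "C_order \<Omega> n j (\<lambda>\<mu> x. if \<sigma> l = Some k then kernel_integral m (\<lambda>s. G l s \<bullet> b) \<sigma> \<mu> x else 0)"
          by (cases "\<sigma> l = Some k") (simp_all add: C_order_zero)
      qed
      ultimately show "C_order \<Omega> n j (\<lambda>\<mu> x. (\<lambda>\<mu> x. \<Sum>l<m. if \<sigma> l = Some k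
          then \<Sum>b\<in>Basis. kernel_integral m (\<lambda>s. G l s \<bullet> b) \<sigma> \<mu> x *\<^sub>R b else 0) \<mu> x \<bullet> b)"
        by (simp only: inner_sum_left)
    qed
    moreover have "\<exists>p. (\<forall>x\<in>{..<j} \<rightarrow>\<^sub>E UNIV. has_L_derivative \<Omega> (\<lambda>\<mu>. kernel_integral m f \<sigma> \<mu> x) (\<lambda>\<mu> y. p \<mu> (x(j := y)))) \<and>
        (\<forall>b\<in>Basis. C_order \<Omega> n (Suc j) (\<lambda>\<mu> x. p \<mu> x \<bullet> b))"
    proof (intro exI conjI ballI)
      show "has_L_derivative \<Omega> (\<lambda>\<mu>. kernel_integral m f \<sigma> \<mu> x)
          (\<lambda>\<mu> y. (\<lambda>\<mu> x. \<Sum>l<m. if \<sigma> l = None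
            then \<Sum>b\<in>Basis. kernel_integral m (\<lambda>s. G l s \<bullet> b) (\<sigma>(l := Some j)) \<mu> x *\<^sub>R b else 0) \<mu> (x(j := y)))" for x
        by (rule kernel_integral_L_derivative[OF \<Omega> fc 1(4,6,7,3) Suc.prems(2)])
      fix b :: 'a assume b: "b \<in> Basis"
      have "(if \<sigma> l = None then \<Sum>b\<in>Basis. kernel_integral m (\<lambda>s. G l s \<bullet> b) (\<sigma>(l := Some j)) \<mu> x *\<^sub>R b else 0) \<bullet> b
          = (if \<sigma> l = None then kernel_integral m (\<lambda>s. G l s \<bullet> b) (\<sigma>(l := Some j)) \<mu> x else 0)" for l \<mu> x
        using b by (simp add: inner_sum_left_Basis)
      moreover have "C_order \<Omega> n (Suc j) (\<lambda>\<mu> x. \<Sum>l<m. if \<sigma> l = None then kernel_integral m (\<lambda>s. G l s \<bullet> b) (\<sigma>(l := Some j)) \<mu> x else 0)"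
      proof (rule C_order_sum)
        fix l assume l: "l \<in> {..<m}"
        have s: "k < Suc j" if "(\<sigma>(l := Some j)) l' = Some k" for l' k
          using that Suc.prems(2)[of l' k] by (auto split: if_splits simp: less_Suc_eq)
        have "C_order \<Omega> n (Suc j) (kernel_integral m (\<lambda>s. G l s \<bullet> b) (\<sigma>(l := Some j)))"
          using b l by (intro Suc.IH 1(7) s) auto
        then show "C_order \<Omega> n (Suc j) (\<lambda>\<mu> x. if \<sigma> l = None then kernel_integral m (\<lambda>s. G l s \<bullet> b) (\<sigma>(l := Some j)) \<mu> x else 0)"
          by (cases "\<sigma> l") (simp_all add: C_order_zero)
      qed
      ultimately show "C_order \<Omega> n (Suc j) (\<lambda>\<mu> x. (\<lambda>\<mu> x. \<Sum>l<m. if \<sigma> l = None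
          then \<Sum>b\<in>Basis. kernel_integral m (\<lambda>s. G l s \<bullet> b) (\<sigma>(l := Some j)) \<mu> x *\<^sub>R b else 0) \<mu> x \<bullet> b)"
        by (simp only: inner_sum_left)
    qed
    ultimately show ?thesis by simp
  qed
qed

section \<open>The approximating functions\<close>

text \<open>
  Jensen's inequality is applied in the form of this line, which avoids integrating \<open>w\<close> itself.
\<close>
lemma concave_supporting_line:
  fixes w :: "real \<Rightarrow> real"
  assumes "concave_on {0..} w" "mono_on {0..} w" "0 < r0"
  obtains c where "0 \<le> c" "\<And>r. 0 \<le> r \<Longrightarrow> w r \<le> w r0 + c * (r - r0)"
proof -
  have cv: "convex_on {0..} (\<lambda>x. - w x)" using assms(1) by (simp add: concave_on_def)
  have int: "r0 \<in> interior {0..}" using assms(3) by simp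
  \<comment> \<open>The right derivative at \<open>r0\<close>.\<close>
  define c where "c = - Inf ((\<lambda>t. (- w r0 - - w t) / (r0 - t)) ` ({r0<..} \<inter> {0..}))"
  have line: "w r \<le> w r0 + c * (r - r0)" if "0 \<le> r" for r
    using convex_le_Inf_differential[OF cv int, of r] that by (simp add: c_def)
  have "w r0 \<le> w (r0 + 1)" using assms(2,3) by (auto intro: mono_onD)
  also have "\<dots> \<le> w r0 + c" using line[of "r0 + 1"] assms(3) by simp
  finally have "0 \<le> c" by simp
  then show ?thesis using line that by blast
qed

definition empirical :: "nat \<Rightarrow> (nat \<Rightarrow> 'a::euclidean_space) \<Rightarrow> 'a measure" where
  "empirical m s = distr (measure_pmf (pmf_of_set {..<m})) borel s"

definition rms_dist :: "nat \<Rightarrow> (nat \<Rightarrow> 'a::euclidean_space) \<Rightarrow> (nat \<Rightarrow> 'a) \<Rightarrow> real" where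
  "rms_dist m s s' = sqrt ((\<Sum>l<m. (norm (s l - s' l))\<^sup>2) / real m)"

lemma rms_dist_nonneg [simp]: "0 \<le> rms_dist m s s'"
  by (simp add: rms_dist_def sum_nonneg)

lemma L2_pmf_of_set: "0 < m \<Longrightarrow> (s :: nat \<Rightarrow> 'a::euclidean_space) \<in> L2 (measure_pmf (pmf_of_set {..<m}))"
  by (intro L2I integrable_measure_pmf_finite) (auto simp: set_pmf_of_set[of "{..<m}"] lessThan_empty_iff)

lemma empirical_in_P2: "0 < m \<Longrightarrow> empirical m s \<in> P2"
  unfolding empirical_def
  by (intro distr_in_P2 L2_pmf_of_set prob_space_measure_pmf)

lemma W2_empirical_le:
  assumes "0 < m"
  shows "W2 (empirical m s) (empirical m s') \<le> rms_dist m s s'"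
proof -
  have "W2 (empirical m s) (empirical m s') \<le> L2norm (measure_pmf (pmf_of_set {..<m})) (\<lambda>l. s l - s' l)"
    unfolding empirical_def
    by (intro W2_le_L2norm L2_pmf_of_set prob_space_measure_pmf assms)
  also have "\<dots> = rms_dist m s s'"
    using assms by (simp add: L2norm_def rms_dist_def integral_pmf_of_set[of "{..<m}"] lessThan_empty_iff)
  finally show ?thesis .
qed

lemma rms_dist_mono:
  assumes "\<And>l. norm (t l - t' l) \<le> norm (s l - s' l)"
  shows "rms_dist m t t' \<le> rms_dist m s s'"
  unfolding rms_dist_def
  by (intro real_sqrt_le_mono divide_right_mono sum_mono power_mono assms) auto

lemma W2_continuousD:
  fixes u :: "'a::euclidean_space measure \<Rightarrow> real"
  assumes "continuous_map W2_topology euclidean u" "\<mu> \<in> P2" "0 < e"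
  obtains d where "0 < d" "\<And>\<nu>. \<nu> \<in> P2 \<Longrightarrow> W2 \<mu> \<nu> < d \<Longrightarrow> \<bar>u \<nu> - u \<mu>\<bar> < e"
proof -
  have "openin W2_topology {\<nu> \<in> topspace W2_topology. u \<nu> \<in> ball (u \<mu>) e}"
    by (rule openin_continuous_map_preimage[OF assms(1)]) simp
  then obtain r where "0 < r" "W2.mball \<mu> r \<subseteq> {\<nu> \<in> topspace W2_topology. u \<nu> \<in> ball (u \<mu>) e}"
    using assms(2,3) unfolding W2.openin_mtopology W2.topspace_mtopology by auto
  then show ?thesis
    using assms(2) by (intro that[of r]) (auto simp: W2.in_mball dist_real_def abs_minus_commute)
qed

definition clamp_real :: "real \<Rightarrow> real \<Rightarrow> real" where
  "clamp_real k a = max (- k) (min k a)"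

lemma clamp_real_bounded: "0 \<le> k \<Longrightarrow> \<bar>clamp_real k a\<bar> \<le> k"
  and clamp_real_lipschitz: "\<bar>clamp_real k a - clamp_real k b\<bar> \<le> \<bar>a - b\<bar>"
  and clamp_real_id: "\<bar>a\<bar> \<le> k \<Longrightarrow> clamp_real k a = a"
  by (auto simp: clamp_real_def max_def min_def)

definition retract_ball :: "real \<Rightarrow> 'a::euclidean_space \<Rightarrow> 'a" where
  "retract_ball R = closest_point (cball 0 R)"

lemma retract_ball_lipschitz: "0 \<le> R \<Longrightarrow> norm (retract_ball R x - retract_ball R y) \<le> norm (x - y)"
  using closest_point_lipschitz[of "cball 0 R :: 'a::euclidean_space set" x y]
  by (simp add: retract_ball_def dist_norm)

lemma retract_ball_in: "0 \<le> R \<Longrightarrow> norm (retract_ball R x) \<le> R"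
  using closest_point_in_set[of "cball 0 R" x] by (simp add: retract_ball_def)

lemma retract_ball_id: "norm x \<le> R \<Longrightarrow> retract_ball R x = x"
  by (simp add: retract_ball_def closest_point_self)

lemma retract_ball_dist_le: "0 \<le> R \<Longrightarrow> norm (x - retract_ball R x) \<le> norm x"
  using closest_point_le[of "cball 0 R" 0 x] by (simp add: retract_ball_def dist_norm)

lemma retract_ball_measurable: "0 \<le> R \<Longrightarrow> retract_ball R \<in> borel_measurable borel"
  unfolding retract_ball_def
  by (intro borel_measurable_continuous_onI continuous_on_closest_point) auto

text \<open>
  The truncation makes the value bounded, as \<open>smoothing_by_gauss_noise\<close> requires; the projection
  onto the ball makes the law of large numbers uniform.
\<close>
definition sample_value ::
  "('a::euclidean_space measure \<Rightarrow> real) \<Rightarrow> real \<Rightarrow> nat \<Rightarrow> (nat \<Rightarrow> 'a) \<Rightarrow> real" where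
  "sample_value u R m s = clamp_real R (u (empirical m (\<lambda>l. retract_ball R (s l))))"

definition smoothed_sample_value ::
  "('a::euclidean_space measure \<Rightarrow> real) \<Rightarrow> real \<Rightarrow> nat \<Rightarrow> real \<Rightarrow> (nat \<Rightarrow> 'a) \<Rightarrow> real" where
  "smoothed_sample_value u R m \<sigma> s = (\<integral>z. sample_value u R m (\<lambda>l. s l + assemble z l) \<partial>gauss_noise \<sigma> m)"

definition smooth_approx ::
  "('a::euclidean_space measure \<Rightarrow> real) \<Rightarrow> real \<Rightarrow> nat \<Rightarrow> real \<Rightarrow> 'a measure \<Rightarrow> real" where
  "smooth_approx u R m \<sigma> \<mu> = (\<integral>y. smoothed_sample_value u R m \<sigma> y \<partial>PiM {..<m} (\<lambda>_. \<mu>))"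

lemma smooth_approx_eq_kernel_integral:
  "smooth_approx u R m \<sigma> \<mu> = kernel_integral m (smoothed_sample_value u R m \<sigma>) (\<lambda>_. None) \<mu> x"
proof -
  have "slot (\<lambda>_. None) x y = y" for y :: "nat \<Rightarrow> 'a" by (auto simp: slot_def)
  then show ?thesis by (simp add: smooth_approx_def kernel_integral_def)
qed

context
  fixes u :: "'a::euclidean_space measure \<Rightarrow> real" and R \<sigma> :: real and m :: nat
  assumes u: "continuous_map W2_topology euclidean u" and R: "0 \<le> R" and m: "0 < m" and \<sigma>: "0 < \<sigma>"
begin

lemma W2_empirical_retract_le:
  "W2 (empirical m (\<lambda>l. retract_ball R (s l))) (empirical m (\<lambda>l. retract_ball R (s' l))) \<le> rms_dist m s s'"
  by (rule order_trans[OF W2_empirical_le[OF m] rms_dist_mono[OF retract_ball_lipschitz[OF R]]])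

lemma sample_value_bounded: "\<bar>sample_value u R m s\<bar> \<le> R"
  unfolding sample_value_def by (rule clamp_real_bounded[OF R])

lemma sample_value_continuous: "coordwise_continuous m (sample_value u R m)"
  unfolding coordwise_continuous_def
proof (intro allI impI)
  fix s :: "nat \<Rightarrow> 'a" and e :: real assume "0 < e"
  obtain d where d: "0 < d" "\<And>\<nu>. \<nu> \<in> P2 \<Longrightarrow> W2 (empirical m (\<lambda>l. retract_ball R (s l))) \<nu> < d \<Longrightarrow>
      \<bar>u \<nu> - u (empirical m (\<lambda>l. retract_ball R (s l)))\<bar> < e"
    by (rule W2_continuousD[OF u empirical_in_P2[OF m] \<open>0 < e\<close>]) blast
  show "\<exists>d>0. \<forall>s'. (\<forall>l<m. norm (s' l - s l) < d) \<longrightarrow> \<bar>sample_value u R m s' - sample_value u R m s\<bar> < e"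
  proof (intro exI[of _ "d / 2"] conjI allI impI)
    fix s' assume close: "\<forall>l<m. norm (s' l - s l) < d / 2"
    have "(norm (s l - s' l))\<^sup>2 \<le> (d / 2)\<^sup>2" if "l < m" for l
    proof (rule power_mono)
      show "norm (s l - s' l) \<le> d / 2" using close that norm_minus_commute[of "s l"] less_imp_le by metis
    qed simp
    then have "(\<Sum>l<m. (norm (s l - s' l))\<^sup>2) \<le> real m * (d / 2)\<^sup>2"
      using sum_bounded_above[of "{..<m}" "\<lambda>l. (norm (s l - s' l))\<^sup>2" "(d / 2)\<^sup>2"] by simp
    then have "rms_dist m s s' \<le> sqrt ((d / 2)\<^sup>2)"
      unfolding rms_dist_def using m by (intro real_sqrt_le_mono) (simp add: field_simps)
    also have "\<dots> < d" using d(1) by simp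
    finally have "W2 (empirical m (\<lambda>l. retract_ball R (s l))) (empirical m (\<lambda>l. retract_ball R (s' l))) < d"
      by (rule le_less_trans[OF W2_empirical_retract_le])
    then show "\<bar>sample_value u R m s' - sample_value u R m s\<bar> < e"
      unfolding sample_value_def by (intro le_less_trans[OF clamp_real_lipschitz] d(2) empirical_in_P2[OF m])
  qed (use d in simp)
qed

lemma smoothed_sample_value_smooth: "smooth_kernel m (smoothed_sample_value u R m \<sigma>)"
  and sample_value_shift_measurable:
    "(\<lambda>z. sample_value u R m (\<lambda>l. s l + assemble z l)) \<in> borel_measurable (gauss_noise \<sigma> m)"
  unfolding smoothed_sample_value_def
  using smoothing_by_gauss_noise[OF \<sigma> coordwise_continuous_measurable[OF sample_value_continuous]
      sample_value_bounded coordwise_continuous_cong[OF sample_value_continuous]] by blast+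

lemma sample_value_shift_integrable:
  "integrable (gauss_noise \<sigma> m) (\<lambda>z. sample_value u R m (\<lambda>l. s l + assemble z l))"
proof -
  interpret prob_space "gauss_noise \<sigma> m :: (nat \<times> 'a \<Rightarrow> real) measure" by (rule prob_space_gauss_noise[OF \<sigma>])
  show ?thesis
    using sample_value_shift_measurable sample_value_bounded by (intro integrable_const_bound[where B=R]) auto
qed

lemma smoothed_sample_value_bounded: "\<bar>smoothed_sample_value u R m \<sigma> s\<bar> \<le> R"
proof -
  interpret prob_space "gauss_noise \<sigma> m :: (nat \<times> 'a \<Rightarrow> real) measure" by (rule prob_space_gauss_noise[OF \<sigma>])
  have "\<bar>smoothed_sample_value u R m \<sigma> s\<bar> \<le> (\<integral>z. R \<partial>(gauss_noise \<sigma> m :: (nat \<times> 'a \<Rightarrow> real) measure))"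
    unfolding smoothed_sample_value_def
    by (rule order_trans[OF integral_abs_bound integral_mono])
      (auto intro!: integrable_abs sample_value_shift_integrable sample_value_bounded)
  then show ?thesis by (simp add: prob_space)
qed

lemma smooth_approx_in_C_infinity:
  assumes "prob_space \<Omega>"
  shows "smooth_approx u R m \<sigma> \<in> C_infinity \<Omega>"
proof -
  have "(\<lambda>\<mu> x. smooth_approx u R m \<sigma> \<mu>) = kernel_integral m (smoothed_sample_value u R m \<sigma>) (\<lambda>_. None)"
    by (intro ext smooth_approx_eq_kernel_integral)
  then show ?thesis
    using C_order_kernel_integral[OF assms smoothed_sample_value_smooth, of "\<lambda>_. None" 0]
    by (simp add: C_infinity_def)
qed

text \<open>
  Neither step of the construction increases distances, so the kernel has modulus \<open>w\<close> with respect
  to the root mean square distance of samples. For independent draws from a coupling the expectation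
  of that distance is at most the cost of the coupling.
\<close>
lemma smooth_approx_modulus:
  assumes w: "modulus_of_continuity w" and uw: "has_modulus w u"
  shows "has_modulus w (smooth_approx u R m \<sigma>)"
  unfolding has_modulus_def
proof (intro ballI)
  fix \<mu> \<nu> :: "'a measure" assume P2: "\<mu> \<in> P2" "\<nu> \<in> P2"
  let ?f = "smoothed_sample_value u R m \<sigma>"
  have w_mono: "w a \<le> w b" if "0 \<le> a" "a \<le> b" for a b
    using w that by (auto simp: modulus_of_continuity_def intro: mono_onD)
  have f_mod: "\<bar>?f s - ?f s'\<bar> \<le> w (rms_dist m s s')" for s s'
  proof -
    interpret prob_space "gauss_noise \<sigma> m :: (nat \<times> 'a \<Rightarrow> real) measure" by (rule prob_space_gauss_noise[OF \<sigma>])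
    have "\<bar>?f s - ?f s'\<bar> = \<bar>\<integral>z. sample_value u R m (\<lambda>l. s l + assemble z l) - sample_value u R m (\<lambda>l. s' l + assemble z l) \<partial>gauss_noise \<sigma> m\<bar>"
      unfolding smoothed_sample_value_def
      by (subst Bochner_Integration.integral_diff[OF sample_value_shift_integrable sample_value_shift_integrable]) (rule refl)
    also have "\<dots> \<le> (\<integral>z. w (rms_dist m s s') \<partial>(gauss_noise \<sigma> m :: (nat \<times> 'a \<Rightarrow> real) measure))"
    proof (rule order_trans[OF integral_abs_bound integral_mono])
      fix z :: "nat \<times> 'a \<Rightarrow> real"
      have "\<bar>sample_value u R m (\<lambda>l. s l + assemble z l) - sample_value u R m (\<lambda>l. s' l + assemble z l)\<bar>
          \<le> w (W2 (empirical m (\<lambda>l. retract_ball R (s l + assemble z l))) (empirical m (\<lambda>l. retract_ball R (s' l + assemble z l))))"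
        unfolding sample_value_def
        by (rule order_trans[OF clamp_real_lipschitz]) (use uw[unfolded has_modulus_def] empirical_in_P2[OF m] in blast)
      also have "\<dots> \<le> w (rms_dist m s s')"
        using W2_empirical_retract_le[of "\<lambda>l. s l + assemble z l" "\<lambda>l. s' l + assemble z l"]
        by (intro w_mono W2_nonneg) (simp add: rms_dist_def)
      finally show "\<bar>sample_value u R m (\<lambda>l. s l + assemble z l) - sample_value u R m (\<lambda>l. s' l + assemble z l)\<bar>
          \<le> w (rms_dist m s s')" .
    qed (auto intro!: integrable_abs Bochner_Integration.integrable_diff sample_value_shift_integrable)
    finally show ?thesis by (simp add: prob_space)
  qed
  have fc: "coordwise_continuous m ?f" by (rule smooth_kernel_continuous[OF smoothed_sample_value_smooth])
  have main: "\<bar>smooth_approx u R m \<sigma> \<mu> - smooth_approx u R m \<sigma> \<nu>\<bar> \<le> w (W2 \<mu> \<nu> + \<delta>)" if \<delta>: "0 < \<delta>" for \<delta>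
  proof -
    \<comment> \<open>A supporting line exists only at positive points, hence the summand \<open>\<delta>\<close>, which tends to 0 at the end.\<close>
    define r0 where "r0 = W2 \<mu> \<nu> + \<delta>"
    have r0: "0 < r0" using \<delta> W2_nonneg[of \<mu> \<nu>] unfolding r0_def by linarith
    obtain c where c: "0 \<le> c" "\<And>r. 0 \<le> r \<Longrightarrow> w r \<le> w r0 + c * (r - r0)"
      using concave_supporting_line[of w r0] w r0 unfolding modulus_of_continuity_def by blast
    obtain \<pi> :: "('a \<times> 'a) measure" where \<pi>: "prob_space \<pi>" "sets \<pi> = sets borel"
        "distr \<pi> borel fst = \<mu>" "distr \<pi> borel snd = \<nu>"
        "fst \<in> L2 \<pi>" "snd \<in> L2 \<pi>" "L2norm \<pi> (\<lambda>z. fst z - snd z) < r0"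
      unfolding r0_def by (rule W2_coupling[OF P2 \<delta>])
    let ?Q = "PiM {..<m} (\<lambda>_. \<pi>)"
    interpret Q: prob_space ?Q using \<pi>(1) by (rule prob_space_PiM)
    define r where "r = (\<lambda>w. rms_dist m (\<lambda>l. fst (w l :: 'a \<times> 'a)) (\<lambda>l. snd (w l)))"
    note sq = L2_integrable_sq[OF L2_diff[OF \<pi>(5,6)]]
    note comp = integral_PiM_component[OF \<pi>(1) _ sq]
    have r_sq: "(norm (r w))\<^sup>2 = (\<Sum>l<m. (norm (fst (w l) - snd (w l)))\<^sup>2) / real m" for w
      by (simp add: r_def rms_dist_def sum_nonneg)
    have r_sq_int: "integrable ?Q (\<lambda>w. (norm (r w))\<^sup>2)"
      unfolding r_sq by (intro integrable_divide Bochner_Integration.integrable_sum comp(1)) simp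
    have r_L2: "r \<in> L2 ?Q"
    proof (rule L2I[OF _ r_sq_int])
      have "(\<lambda>w. sqrt ((norm (r w))\<^sup>2)) \<in> borel_measurable ?Q"
        by (rule measurable_compose[OF borel_measurable_integrable[OF r_sq_int], of sqrt]) simp
      then show "r \<in> borel_measurable ?Q" by (simp add: r_def)
    qed
    have "(L2norm ?Q r)\<^sup>2 = (L2norm \<pi> (\<lambda>z. fst z - snd z))\<^sup>2"
    proof -
      have "(\<integral>w. (\<Sum>l<m. (norm (fst (w l) - snd (w l)))\<^sup>2) / real m \<partial>?Q)
          = (\<Sum>l<m. \<integral>w. (norm (fst (w l) - snd (w l)))\<^sup>2 \<partial>?Q) / real m"
        by (subst integral_divide_zero, subst Bochner_Integration.integral_sum) (auto intro!: comp(1))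
      also have "(\<Sum>l<m. \<integral>w. (norm (fst (w l) - snd (w l)))\<^sup>2 \<partial>?Q) = real m * (\<integral>z. (norm (fst z - snd z))\<^sup>2 \<partial>\<pi>)"
        using comp(2) by simp
      finally show ?thesis unfolding L2norm_sq r_sq using m by simp
    qed
    then have "L2norm ?Q r = L2norm \<pi> (\<lambda>z. fst z - snd z)" by (simp add: power2_eq_iff_nonneg)
    then have Er: "integrable ?Q r" "(\<integral>w. r w \<partial>?Q) \<le> r0"
      using Q.expectation_norm_le_L2norm[OF r_L2] \<pi>(7) by (auto simp: r_def)
    have i: "integrable ?Q (\<lambda>w. ?f (\<lambda>l. fst (w l)))" "integrable ?Q (\<lambda>w. ?f (\<lambda>l. snd (w l)))"
      using kernel_integrable[OF fc smoothed_sample_value_bounded \<pi>(1) L2_measurable[OF \<pi>(5)], of "\<lambda>_. None"]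
        kernel_integrable[OF fc smoothed_sample_value_bounded \<pi>(1) L2_measurable[OF \<pi>(6)], of "\<lambda>_. None"]
      by (simp_all add: slot_def[abs_def])
    have "smooth_approx u R m \<sigma> \<mu> = (\<integral>w. ?f (\<lambda>l. fst (w l)) \<partial>?Q)"
      unfolding smooth_approx_def \<pi>(3)[symmetric] by (rule integral_PiM_distr[OF \<pi>(1) L2_measurable[OF \<pi>(5)] fc])
    moreover have "smooth_approx u R m \<sigma> \<nu> = (\<integral>w. ?f (\<lambda>l. snd (w l)) \<partial>?Q)"
      unfolding smooth_approx_def \<pi>(4)[symmetric] by (rule integral_PiM_distr[OF \<pi>(1) L2_measurable[OF \<pi>(6)] fc])
    ultimately have "\<bar>smooth_approx u R m \<sigma> \<mu> - smooth_approx u R m \<sigma> \<nu>\<bar>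
        = \<bar>\<integral>w. ?f (\<lambda>l. fst (w l)) - ?f (\<lambda>l. snd (w l)) \<partial>?Q\<bar>"
      by (simp only: Bochner_Integration.integral_diff[OF i])
    also have "\<dots> \<le> (\<integral>p. w r0 + c * (r p - r0) \<partial>?Q)"
    proof (rule order_trans[OF integral_abs_bound integral_mono])
      show "integrable ?Q (\<lambda>w. \<bar>?f (\<lambda>l. fst (w l)) - ?f (\<lambda>l. snd (w l))\<bar>)"
        by (intro integrable_abs Bochner_Integration.integrable_diff i)
      show "integrable ?Q (\<lambda>p. w r0 + c * (r p - r0))" using Er(1) by simp
      show "\<bar>?f (\<lambda>l. fst (p l)) - ?f (\<lambda>l. snd (p l))\<bar> \<le> w r0 + c * (r p - r0)" for p
        by (rule order_trans[OF f_mod]) (use c(2)[of "r p"] in \<open>simp add: r_def\<close>)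
    qed
    also have "\<dots> = w r0 + c * ((\<integral>p. r p \<partial>?Q) - r0)"
      using Er(1) by (simp add: Q.prob_space)
    also have "\<dots> \<le> w r0" using c(1) Er(2) by (simp add: mult_nonneg_nonpos)
    finally show ?thesis by (simp add: r0_def)
  qed
  have "((\<lambda>n. w (W2 \<mu> \<nu> + 1 / real (Suc n))) \<longlongrightarrow> w (W2 \<mu> \<nu>)) sequentially"
  proof (rule continuous_on_tendsto_compose[of "{0..}" w])
    show "continuous_on {0..} w" using w by (simp add: modulus_of_continuity_def)
    show "(\<lambda>n. W2 \<mu> \<nu> + 1 / real (Suc n)) \<longlonglongrightarrow> W2 \<mu> \<nu>"
      using tendsto_add[OF tendsto_const[of "W2 \<mu> \<nu>"] LIMSEQ_inverse_real_of_nat] by (simp add: inverse_eq_divide)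
  qed (auto intro!: always_eventually add_nonneg_nonneg W2_nonneg)
  then show "\<bar>smooth_approx u R m \<sigma> \<mu> - smooth_approx u R m \<sigma> \<nu>\<bar> \<le> w (W2 \<mu> \<nu>)"
    by (rule LIMSEQ_le_const) (auto intro!: main)
qed

end

section \<open>Uniform convergence of empirical measures on a ball\<close>

lemma nn_integral_finitely_valued:
  fixes \<phi> :: "nat \<Rightarrow> real" and q :: "'a \<Rightarrow> nat"
  assumes M: "prob_space M" and q: "q \<in> measurable M (count_space UNIV)"
    and fin: "AE x in M. q x < n" and \<phi>: "\<And>i. 0 \<le> \<phi> i"
  shows "(\<integral>\<^sup>+x. ennreal (\<phi> (q x)) \<partial>M) = ennreal (\<Sum>i<n. \<phi> i * measure M {x \<in> space M. q x = i})"
proof -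
  interpret prob_space M by fact
  have cell: "{x \<in> space M. q x = i} \<in> sets M" for i
    using measurable_sets[OF q, of "{i}"] by (simp add: vimage_def Int_def conj_commute)
  have "(\<integral>\<^sup>+x. ennreal (\<phi> (q x)) \<partial>M) = (\<integral>\<^sup>+x. (\<Sum>i<n. ennreal (\<phi> i) * indicator {x \<in> space M. q x = i} x) \<partial>M)"
  proof (rule nn_integral_cong_AE)
    have "AE x in M. x \<in> space M" by (rule AE_space)
    with fin show "AE x in M. ennreal (\<phi> (q x)) = (\<Sum>i<n. ennreal (\<phi> i) * indicator {x \<in> space M. q x = i} x)"
    proof eventually_elim
      case (elim x)
      have "(\<Sum>i<n. ennreal (\<phi> i) * indicator {x \<in> space M. q x = i} x) = (\<Sum>i<n. if i = q x then ennreal (\<phi> i) else 0)"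
        using elim by (intro sum.cong) (auto simp: indicator_def)
      then show ?case using elim by simp
    qed
  qed
  also have "\<dots> = (\<Sum>i<n. ennreal (\<phi> i) * emeasure M {x \<in> space M. q x = i})"
    using cell by (subst nn_integral_sum) (auto simp: nn_integral_cmult_indicator)
  also have "\<dots> = (\<Sum>i<n. ennreal (\<phi> i * measure M {x \<in> space M. q x = i}))"
    using \<phi> by (intro sum.cong) (auto simp: emeasure_eq_measure ennreal_mult)
  also have "\<dots> = ennreal (\<Sum>i<n. \<phi> i * measure M {x \<in> space M. q x = i})"
    using \<phi> by (intro sum_ennreal) auto
  finally show ?thesis .
qed

text \<open>
  The coupling couples the common mass \<open>min (a i) (b i)\<close> of each cell within that cell, at cost
  at most \<open>\<eta>\<^sup>2\<close>, and the remaining mass arbitrarily, at cost at most \<open>(2 R)\<^sup>2\<close>.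
\<close>
lemma W2_le_cell_masses:
  fixes \<alpha> \<beta> :: "'a::euclidean_space measure" and q :: "'a \<Rightarrow> nat"
  assumes P2: "\<alpha> \<in> P2" "\<beta> \<in> P2"
    and supp: "AE x in \<alpha>. norm x \<le> R" "AE x in \<beta>. norm x \<le> R"
    and q: "q \<in> measurable borel (count_space UNIV)"
    and diam: "\<And>x y. q x = q y \<Longrightarrow> norm (x - y) \<le> \<eta>" and n: "\<And>x. norm x \<le> R \<Longrightarrow> q x < n"
  shows "(W2 \<alpha> \<beta>)\<^sup>2 \<le> \<eta>\<^sup>2 + 4 * R\<^sup>2 * (\<Sum>i<n. \<bar>measure \<alpha> {x. q x = i} - measure \<beta> {x. q x = i}\<bar>)"
proof -
  define a where "a = (\<lambda>i. measure \<alpha> {x. q x = i})"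
  define b where "b = (\<lambda>i. measure \<beta> {x. q x = i})"
  define p where "p = (\<lambda>i. max 0 (a i - b i))"
  define r where "r = (\<lambda>i. max 0 (b i - a i))"
  define \<tau> where "\<tau> = (\<Sum>i<n. p i)"
  \<comment> \<open>Weights with respect to \<open>\<alpha> \<Otimes>\<^sub>M \<beta>\<close>: \<open>K1\<close> for the mass that stays in its cell, \<open>K2\<close> for the rest, of total
    mass \<open>\<tau>\<close>. The convention \<open>x / 0 = 0\<close> gives
    the right weights for cells of mass zero and for \<open>\<tau> = 0\<close>.\<close>
  define K1 where "K1 = (\<lambda>i j. if i = j then min (a i) (b i) / (a i * b i) else 0)"
  define K2 where "K2 = (\<lambda>i j. p i / a i * (r j / b j) / \<tau>)"
  define K where "K = (\<lambda>i j. K1 i j + K2 i j)"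
  interpret \<alpha>: prob_space \<alpha> by (rule P2_prob[OF P2(1)])
  interpret \<beta>: prob_space \<beta> by (rule P2_prob[OF P2(2)])
  note sb = P2_sets[OF P2(1)] P2_sets[OF P2(2)]
  have sp: "space \<alpha> = UNIV" "space \<beta> = UNIV" using sb[THEN sets_eq_imp_space_eq] by auto
  have q\<alpha>: "q \<in> measurable \<alpha> (count_space UNIV)" and q\<beta>: "q \<in> measurable \<beta> (count_space UNIV)"
    using q measurable_cong_sets[OF sb(1) refl] measurable_cong_sets[OF sb(2) refl] by blast+
  have q\<alpha>n: "AE x in \<alpha>. q x < n" using supp(1) by eventually_elim (rule n)
  have q\<beta>n: "AE x in \<beta>. q x < n" using supp(2) by eventually_elim (rule n)
  have nonneg: "0 \<le> a i" "0 \<le> b i" "0 \<le> p i" "0 \<le> r i" for i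
    by (auto simp: a_def b_def p_def r_def)
  have \<tau>0: "0 \<le> \<tau>" by (simp add: \<tau>_def sum_nonneg nonneg)
  have K0: "0 \<le> K1 i j" "0 \<le> K2 i j" "0 \<le> K i j" for i j
    using nonneg \<tau>0 by (auto simp: K1_def K2_def K_def)
  have int\<alpha>: "(\<integral>\<^sup>+x. ennreal (\<phi> (q x)) \<partial>\<alpha>) = ennreal (\<Sum>i<n. \<phi> i * a i)" if "\<And>i. 0 \<le> \<phi> i" for \<phi>
    using nn_integral_finitely_valued[OF \<alpha>.prob_space_axioms q\<alpha> q\<alpha>n that] by (simp add: a_def sp)
  have int\<beta>: "(\<integral>\<^sup>+x. ennreal (\<phi> (q x)) \<partial>\<beta>) = ennreal (\<Sum>i<n. \<phi> i * b i)" if "\<And>i. 0 \<le> \<phi> i" for \<phi>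
    using nn_integral_finitely_valued[OF \<beta>.prob_space_axioms q\<beta> q\<beta>n that] by (simp add: b_def sp)
  have "ennreal (\<Sum>i<n. a i) = 1" using int\<alpha>[of "\<lambda>_. 1", symmetric] by (simp add: \<alpha>.emeasure_space_1)
  then have suma: "(\<Sum>i<n. a i) = 1" by simp
  have "ennreal (\<Sum>i<n. b i) = 1" using int\<beta>[of "\<lambda>_. 1", symmetric] by (simp add: \<beta>.emeasure_space_1)
  then have sumb: "(\<Sum>i<n. b i) = 1" by simp
  have \<tau>r: "\<tau> = (\<Sum>i<n. r i)"
  proof -
    have "(\<Sum>i<n. p i) - (\<Sum>i<n. r i) = (\<Sum>i<n. a i - b i)"
      unfolding sum_subtractf[symmetric] by (intro sum.cong) (auto simp: p_def r_def)
    then show ?thesis by (simp add: \<tau>_def sum_subtractf suma sumb)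
  qed
  have \<tau>le: "\<tau> \<le> (\<Sum>i<n. \<bar>a i - b i\<bar>)"
    unfolding \<tau>_def by (intro sum_mono) (auto simp: p_def)
  have pa: "p i / a i * a i = p i" and rb: "r i / b i * b i = r i" for i
    using nonneg[of i] by (auto simp: p_def r_def)
  have row: "(\<Sum>j<n. K i j * b j) = 1" if i: "i < n" "a i \<noteq> 0" for i
  proof -
    have "(\<Sum>j<n. K1 i j * b j) = (\<Sum>j<n. if i = j then min (a i) (b i) / (a i * b i) * b i else 0)"
      by (intro sum.cong) (auto simp: K1_def)
    also have "\<dots> = min (a i) (b i) / (a i * b i) * b i" using i by simp
    also have "\<dots> = min (a i) (b i) / a i" using nonneg[of i] by (auto simp: min_def)
    finally have 1: "(\<Sum>j<n. K1 i j * b j) = min (a i) (b i) / a i" .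
    have "(\<Sum>j<n. K2 i j * b j) = (\<Sum>j<n. p i / a i / \<tau> * (r j / b j * b j))"
      by (intro sum.cong) (auto simp: K2_def)
    also have "\<dots> = p i / a i / \<tau> * \<tau>" unfolding rb \<tau>r by (rule sum_distrib_left[symmetric])
    also have "\<dots> = p i / a i * (\<tau> / \<tau>)" by simp
    also have "\<dots> = p i / a i"
    proof (cases "\<tau> = 0")
      case True
      then have "p i = 0" using i nonneg by (auto simp: \<tau>_def sum_nonneg_eq_0_iff)
      then show ?thesis by simp
    qed simp
    finally have 2: "(\<Sum>j<n. K2 i j * b j) = p i / a i" .
    have "min (a i) (b i) + p i = a i" by (auto simp: p_def)
    then show ?thesis unfolding K_def distrib_right sum.distrib 1 2 using i by (simp flip: add_divide_distrib)
  qed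
  have col: "(\<Sum>i<n. K i j * a i) = 1" if j: "j < n" "b j \<noteq> 0" for j
  proof -
    have "(\<Sum>i<n. K1 i j * a i) = (\<Sum>i<n. if i = j then min (a j) (b j) / (a j * b j) * a j else 0)"
      by (intro sum.cong) (auto simp: K1_def)
    also have "\<dots> = min (a j) (b j) / (a j * b j) * a j" using j by simp
    also have "\<dots> = min (a j) (b j) / b j" using nonneg[of j] by (auto simp: min_def)
    finally have 1: "(\<Sum>i<n. K1 i j * a i) = min (a j) (b j) / b j" .
    have "(\<Sum>i<n. K2 i j * a i) = (\<Sum>i<n. r j / b j / \<tau> * (p i / a i * a i))"
      by (intro sum.cong) (auto simp: K2_def)
    also have "\<dots> = r j / b j / \<tau> * \<tau>" unfolding pa \<tau>_def by (rule sum_distrib_left[symmetric])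
    also have "\<dots> = r j / b j * (\<tau> / \<tau>)" by simp
    also have "\<dots> = r j / b j"
    proof (cases "\<tau> = 0")
      case True
      then have "r j = 0" using j nonneg by (auto simp: \<tau>r sum_nonneg_eq_0_iff)
      then show ?thesis by simp
    qed simp
    finally have 2: "(\<Sum>i<n. K2 i j * a i) = r j / b j" .
    have "min (a j) (b j) + r j = b j" by (auto simp: r_def)
    then show ?thesis unfolding K_def distrib_right sum.distrib 1 2 using j by (simp flip: add_divide_distrib)
  qed
  define k where "k = (\<lambda>z. ennreal (K (q (fst z)) (q (snd z))))"
  have pairm: "(\<lambda>z. F (q (fst z)) (q (snd z))) \<in> borel_measurable (\<alpha> \<Otimes>\<^sub>M \<beta>)" for F :: "nat \<Rightarrow> nat \<Rightarrow> ennreal"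
  proof -
    have "(\<lambda>z. (q (fst z), q (snd z))) \<in> measurable (\<alpha> \<Otimes>\<^sub>M \<beta>) (count_space UNIV \<Otimes>\<^sub>M count_space UNIV)"
      by (intro measurable_Pair measurable_compose[OF measurable_fst q\<alpha>] measurable_compose[OF measurable_snd q\<beta>])
    then have "(\<lambda>z. (q (fst z), q (snd z))) \<in> measurable (\<alpha> \<Otimes>\<^sub>M \<beta>) (count_space UNIV)"
      by (simp add: pair_measure_countable)
    from measurable_compose[OF this, of "\<lambda>(i, j). F i j" borel] show ?thesis by simp
  qed
  have km: "k \<in> borel_measurable (\<alpha> \<Otimes>\<^sub>M \<beta>)" unfolding k_def by (rule pairm)
  have nz\<alpha>: "AE x in \<alpha>. a (q x) \<noteq> 0"
    using AE_cell_not_null[OF q\<alpha>] by (simp add: a_def sp \<alpha>.emeasure_eq_measure)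
  have nz\<beta>: "AE x in \<beta>. b (q x) \<noteq> 0"
    using AE_cell_not_null[OF q\<beta>] by (simp add: b_def sp \<beta>.emeasure_eq_measure)
  have m1: "AE x in \<alpha>. (\<integral>\<^sup>+y. k (x, y) \<partial>\<beta>) = 1"
    using nz\<alpha> q\<alpha>n
  proof eventually_elim
    case (elim x)
    show ?case unfolding k_def using int\<beta>[of "K (q x)"] K0 row[OF elim(2,1)] by simp
  qed
  have m2: "AE y in \<beta>. (\<integral>\<^sup>+x. k (x, y) \<partial>\<alpha>) = 1"
    using nz\<beta> q\<beta>n
  proof eventually_elim
    case (elim y)
    show ?case unfolding k_def using int\<alpha>[of "\<lambda>i. K i (q y)"] K0 col[OF elim(2,1)] by simp
  qed
  define M where "M = density (\<alpha> \<Otimes>\<^sub>M \<beta>) k"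
  have M: "distr M \<alpha> fst = \<alpha>" "distr M \<beta> snd = \<beta>" "prob_space M"
    unfolding M_def using marginals_of_density[OF P2_prob[OF P2(1)] P2_prob[OF P2(2)] km m1 m2] by auto
  have fs: "fst \<in> measurable M \<alpha>" "snd \<in> measurable M \<beta>" unfolding M_def by simp_all
  have law: "distr M borel fst = \<alpha>" "distr M borel snd = \<beta>"
    using M(1,2) distr_cong[OF refl sb(1), of M fst fst] distr_cong[OF refl sb(2), of M snd snd] by simp_all
  have L2: "fst \<in> L2 M" "snd \<in> L2 M"
    using L2_distr[OF fs(1) L2_measurable[OF P2_L2[OF P2(1)]]] L2_distr[OF fs(2) L2_measurable[OF P2_L2[OF P2(2)]]]
      P2_L2[OF P2(1)] P2_L2[OF P2(2)] by (simp_all add: M)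
  have suppM: "AE z in M. norm (fst z) \<le> R" "AE z in M. norm (snd z) \<le> R"
  proof -
    have s: "{x \<in> space \<alpha>. norm x \<le> R} \<in> sets \<alpha>" "{x \<in> space \<beta>. norm x \<le> R} \<in> sets \<beta>"
      using borel_closed[OF closed_cball[of "0 :: 'a" R]] by (simp_all add: sb sp cball_def)
    show "AE z in M. norm (fst z) \<le> R" using AE_distr_iff[OF fs(1) s(1)] supp(1) unfolding M(1) by blast
    show "AE z in M. norm (snd z) \<le> R" using AE_distr_iff[OF fs(2) s(2)] supp(2) unfolding M(2) by blast
  qed
  have diff_m: "(\<lambda>z. (norm (fst z - snd z))\<^sup>2) \<in> borel_measurable M"
    by (rule borel_measurable_integrable[OF L2_integrable_sq[OF L2_diff[OF L2]]])
  then have diff_m': "(\<lambda>z. (norm (fst z - snd z))\<^sup>2) \<in> borel_measurable (\<alpha> \<Otimes>\<^sub>M \<beta>)" by (simp add: M_def)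
  have "ennreal ((W2 \<alpha> \<beta>)\<^sup>2) \<le> ennreal ((L2norm M (\<lambda>z. fst z - snd z))\<^sup>2)"
    using W2_le_L2norm[OF M(3) L2] by (intro ennreal_leI power_mono W2_nonneg) (simp add: law)
  also have "\<dots> = (\<integral>\<^sup>+z. ennreal ((norm (fst z - snd z))\<^sup>2) \<partial>M)"
    unfolding L2norm_sq by (rule nn_integral_eq_integral[symmetric, OF L2_integrable_sq[OF L2_diff[OF L2]]]) simp
  also have "\<dots> \<le> (\<integral>\<^sup>+z. (if q (fst z) = q (snd z) then ennreal (\<eta>\<^sup>2) else ennreal (4 * R\<^sup>2)) \<partial>M)"
  proof (rule nn_integral_mono_AE)
    show "AE z in M. ennreal ((norm (fst z - snd z))\<^sup>2) \<le> (if q (fst z) = q (snd z) then ennreal (\<eta>\<^sup>2) else ennreal (4 * R\<^sup>2))"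
      using suppM
    proof eventually_elim
      case (elim z)
      have "norm (fst z - snd z) \<le> 2 * R" using norm_triangle_ineq4[of "fst z" "snd z"] elim by linarith
      then have "(norm (fst z - snd z))\<^sup>2 \<le> 4 * R\<^sup>2"
        using power_mono[of "norm (fst z - snd z)" "2 * R" 2] by (simp add: power_mult_distrib)
      moreover have "(norm (fst z - snd z))\<^sup>2 \<le> \<eta>\<^sup>2" if "q (fst z) = q (snd z)"
        using diam[OF that] by (intro power_mono) auto
      ultimately show ?case by (auto intro: ennreal_leI)
    qed
  qed
  also have "\<dots> = (\<integral>\<^sup>+z. k z * (if q (fst z) = q (snd z) then ennreal (\<eta>\<^sup>2) else ennreal (4 * R\<^sup>2)) \<partial>(\<alpha> \<Otimes>\<^sub>M \<beta>))"
    unfolding M_def by (rule nn_integral_density[OF km pairm])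
  also have "\<dots> \<le> (\<integral>\<^sup>+z. ennreal (\<eta>\<^sup>2) * k z + ennreal (4 * R\<^sup>2 * K2 (q (fst z)) (q (snd z))) \<partial>(\<alpha> \<Otimes>\<^sub>M \<beta>))"
  proof (rule nn_integral_mono)
    fix z
    show "k z * (if q (fst z) = q (snd z) then ennreal (\<eta>\<^sup>2) else ennreal (4 * R\<^sup>2))
        \<le> ennreal (\<eta>\<^sup>2) * k z + ennreal (4 * R\<^sup>2 * K2 (q (fst z)) (q (snd z)))"
    proof (cases "q (fst z) = q (snd z)")
      case False
      then have "K (q (fst z)) (q (snd z)) = K2 (q (fst z)) (q (snd z))" by (simp add: K_def K1_def)
      then show ?thesis using False K0 by (simp add: k_def ennreal_mult mult.commute)
    qed (simp add: mult.commute)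
  qed
  also have "\<dots> = (\<integral>\<^sup>+z. ennreal (\<eta>\<^sup>2) * k z \<partial>(\<alpha> \<Otimes>\<^sub>M \<beta>)) + (\<integral>\<^sup>+z. ennreal (4 * R\<^sup>2 * K2 (q (fst z)) (q (snd z))) \<partial>(\<alpha> \<Otimes>\<^sub>M \<beta>))"
  proof (rule nn_integral_add)
    show "(\<lambda>z. ennreal (\<eta>\<^sup>2) * k z) \<in> borel_measurable (\<alpha> \<Otimes>\<^sub>M \<beta>)"
      using km by measurable
  qed (rule pairm)
  also have "(\<integral>\<^sup>+z. ennreal (\<eta>\<^sup>2) * k z \<partial>(\<alpha> \<Otimes>\<^sub>M \<beta>)) = ennreal (\<eta>\<^sup>2)"
  proof -
    have "(\<integral>\<^sup>+z. k z \<partial>(\<alpha> \<Otimes>\<^sub>M \<beta>)) = (\<integral>\<^sup>+x. (\<integral>\<^sup>+y. k (x, y) \<partial>\<beta>) \<partial>\<alpha>)" by (rule \<beta>.nn_integral_fst[OF km, symmetric])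
    also have "\<dots> = (\<integral>\<^sup>+x. 1 \<partial>\<alpha>)" by (rule nn_integral_cong_AE[OF m1])
    also have "\<dots> = 1" by (simp add: \<alpha>.emeasure_space_1)
    finally show ?thesis by (simp add: nn_integral_cmult[OF km])
  qed
  also have "(\<integral>\<^sup>+z. ennreal (4 * R\<^sup>2 * K2 (q (fst z)) (q (snd z))) \<partial>(\<alpha> \<Otimes>\<^sub>M \<beta>))
      = ennreal (4 * R\<^sup>2 * (\<Sum>i<n. (\<Sum>j<n. K2 i j * b j) * a i))"
  proof -
    have "(\<integral>\<^sup>+z. ennreal (4 * R\<^sup>2 * K2 (q (fst z)) (q (snd z))) \<partial>(\<alpha> \<Otimes>\<^sub>M \<beta>))
        = (\<integral>\<^sup>+x. (\<integral>\<^sup>+y. ennreal (4 * R\<^sup>2 * K2 (q x) (q y)) \<partial>\<beta>) \<partial>\<alpha>)"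
      using \<beta>.nn_integral_fst[OF pairm[of "\<lambda>i j. ennreal (4 * R\<^sup>2 * K2 i j)"]] by simp
    also have "\<dots> = (\<integral>\<^sup>+x. ennreal (\<Sum>j<n. (4 * R\<^sup>2 * K2 (q x) j) * b j) \<partial>\<alpha>)"
      using K0 by (intro nn_integral_cong int\<beta>) simp
    also have "\<dots> = ennreal (\<Sum>i<n. (\<Sum>j<n. (4 * R\<^sup>2 * K2 i j) * b j) * a i)"
      using K0 nonneg by (intro int\<alpha>[of "\<lambda>i. \<Sum>j<n. (4 * R\<^sup>2 * K2 i j) * b j"] sum_nonneg) simp
    also have "(\<Sum>i<n. (\<Sum>j<n. (4 * R\<^sup>2 * K2 i j) * b j) * a i) = 4 * R\<^sup>2 * (\<Sum>i<n. (\<Sum>j<n. K2 i j * b j) * a i)"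
      by (simp add: sum_distrib_left sum_distrib_right mult_ac)
    finally show ?thesis .
  qed
  also have "(\<Sum>i<n. (\<Sum>j<n. K2 i j * b j) * a i) \<le> \<tau>"
  proof -
    have "(\<Sum>j<n. K2 i j * b j) \<le> p i / a i" for i
    proof -
      have "(\<Sum>j<n. K2 i j * b j) = (\<Sum>j<n. p i / a i / \<tau> * (r j / b j * b j))"
        by (intro sum.cong) (auto simp: K2_def)
      also have "\<dots> = p i / a i / \<tau> * \<tau>" unfolding rb \<tau>r by (rule sum_distrib_left[symmetric])
    also have "\<dots> = p i / a i * (\<tau> / \<tau>)" by simp
      also have "\<dots> \<le> p i / a i * 1" using nonneg[of i] by (intro mult_left_mono) auto
      finally show ?thesis by simp
    qed
    then have "(\<Sum>i<n. (\<Sum>j<n. K2 i j * b j) * a i) \<le> (\<Sum>i<n. p i / a i * a i)"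
      using nonneg by (intro sum_mono mult_right_mono) auto
    then show ?thesis by (simp only: pa \<tau>_def)
  qed
  finally have "ennreal ((W2 \<alpha> \<beta>)\<^sup>2) \<le> ennreal (\<eta>\<^sup>2) + ennreal (4 * R\<^sup>2 * \<tau>)"
    by (simp add: mult_left_mono ennreal_leI add_left_mono)
  then have "(W2 \<alpha> \<beta>)\<^sup>2 \<le> \<eta>\<^sup>2 + 4 * R\<^sup>2 * \<tau>"
    using \<tau>0 by (simp add: ennreal_plus[symmetric] del: ennreal_plus)
  also have "4 * R\<^sup>2 * \<tau> \<le> 4 * R\<^sup>2 * (\<Sum>i<n. \<bar>a i - b i\<bar>)" using \<tau>le by (intro mult_left_mono) auto
  finally show ?thesis by (simp add: a_def b_def)
qed

text \<open>
  The mixed products have mean zero by independence.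
\<close>
lemma centred_sum_second_moment:
  fixes X :: "'w \<Rightarrow> real" and m :: nat
  assumes M: "prob_space M" and X: "X \<in> borel_measurable M" and b: "\<And>\<omega>. \<bar>X \<omega>\<bar> \<le> 1" and c: "(\<integral>\<omega>. X \<omega> \<partial>M) = 0"
  shows "integrable (PiM {..<m} (\<lambda>_. M)) (\<lambda>w. (\<Sum>l<m. X (w l))\<^sup>2)"
    and "(\<integral>w. (\<Sum>l<m. X (w l))\<^sup>2 \<partial>PiM {..<m} (\<lambda>_. M)) \<le> real m"
proof -
  let ?Q = "PiM {..<m} (\<lambda>_. M)"
  interpret M: prob_space M by fact
  interpret Q: prob_space ?Q using M by (rule prob_space_PiM)
  interpret P: product_sigma_finite "\<lambda>_ :: nat. M"
    by (intro product_sigma_finite.intro M.sigma_finite_measure_axioms)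
  have Xi: "integrable M X" using X b by (intro M.integrable_const_bound[where B=1]) auto
  have Xl: "(\<lambda>w. X (w l)) \<in> borel_measurable ?Q" if "l < m" for l
    by (rule measurable_PiM_coordinate_compose[OF X that])
  have b2: "\<bar>X \<omega> * X \<omega>'\<bar> \<le> 1" for \<omega> \<omega>'
    using mult_mono[OF b[of \<omega>] b[of \<omega>']] by (simp add: abs_mult)
  have i: "integrable ?Q (\<lambda>w. X (w l) * X (w l'))" if "l < m" "l' < m" for l l'
    using b2 Xl[OF that(1)] Xl[OF that(2)]
    by (intro Q.integrable_const_bound[where B=1] AE_I2) (auto intro: borel_measurable_times)
  have z: "(\<integral>w. X (w l) * X (w l') \<partial>?Q) = 0" if l: "l < m" "l' < m" "l \<noteq> l'" for l l'
  proof -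
    define f where "f = (\<lambda>i x. if i \<in> {l, l'} then X x else 1)"
    have "(\<Prod>i<m. f i (w i)) = X (w l) * X (w l')" for w
    proof -
      have "{..<m} \<inter> {l, l'} = {l, l'}" using l by auto
      then show ?thesis
        using l(3) prod.inter_restrict[of "{..<m}" "\<lambda>i. X (w i)" "{l, l'}"] by (simp add: f_def)
    qed
    then have "(\<integral>w. X (w l) * X (w l') \<partial>?Q) = (\<integral>w. (\<Prod>i<m. f i (w i)) \<partial>?Q)" by simp
    also have "\<dots> = (\<Prod>i<m. \<integral>x. f i x \<partial>M)"
    proof (rule P.product_integral_prod)
      show "integrable M (f i)" for i
        unfolding f_def by (cases "i \<in> {l, l'}") (simp_all add: Xi)
    qed simp
    also have "\<dots> = 0" using l c by (intro prod_zero bexI[of _ l]) (auto simp: f_def)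
    finally show ?thesis .
  qed
  have sq: "(\<Sum>l<m. X (w l))\<^sup>2 = (\<Sum>l<m. \<Sum>l'<m. X (w l) * X (w l'))" for w :: "nat \<Rightarrow> 'w"
    by (simp add: power2_eq_square sum_product)
  show "integrable ?Q (\<lambda>w. (\<Sum>l<m. X (w l))\<^sup>2)"
    unfolding sq by (intro Bochner_Integration.integrable_sum i) auto
  have "(\<integral>w. (\<Sum>l<m. X (w l))\<^sup>2 \<partial>?Q) = (\<Sum>l<m. \<Sum>l'<m. \<integral>w. X (w l) * X (w l') \<partial>?Q)"
    unfolding sq using i by (subst Bochner_Integration.integral_sum) (auto intro!: Bochner_Integration.integrable_sum)
  also have "\<dots> = (\<Sum>l<m. \<Sum>l'<m. if l' = l then \<integral>w. X (w l) * X (w l) \<partial>?Q else 0)"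
    using z by (intro sum.cong refl) auto
  also have "\<dots> = (\<Sum>l<m. \<integral>w. X (w l) * X (w l) \<partial>?Q)" by simp
  also have "\<dots> \<le> (\<Sum>l<m. 1)"
  proof (rule sum_mono)
    fix l assume "l \<in> {..<m}"
    then have "(\<integral>w. X (w l) * X (w l) \<partial>?Q) \<le> (\<integral>w. 1 \<partial>?Q)"
      using i b2 by (intro integral_mono) (auto simp: abs_le_iff)
    then show "(\<integral>w. X (w l) * X (w l) \<partial>?Q) \<le> 1" by (simp add: Q.prob_space)
  qed
  finally show "(\<integral>w. (\<Sum>l<m. X (w l))\<^sup>2 \<partial>?Q) \<le> real m" by simp
qed

lemma centred_mean_abs:
  fixes X :: "'w \<Rightarrow> real" and m :: nat
  assumes M: "prob_space M" and X: "X \<in> borel_measurable M" "\<And>\<omega>. \<bar>X \<omega>\<bar> \<le> 1" "(\<integral>\<omega>. X \<omega> \<partial>M) = 0" and m: "0 < m"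
  shows "integrable (PiM {..<m} (\<lambda>_. M)) (\<lambda>w. \<bar>(\<Sum>l<m. X (w l)) / real m\<bar>)"
    and "(\<integral>w. \<bar>(\<Sum>l<m. X (w l)) / real m\<bar> \<partial>PiM {..<m} (\<lambda>_. M)) \<le> 1 / sqrt (real m)"
proof -
  let ?Q = "PiM {..<m} (\<lambda>_. M)"
  interpret Q: prob_space ?Q using M by (rule prob_space_PiM)
  note s = centred_sum_second_moment[OF M X, of m]
  define Y where "Y = (\<lambda>w. (\<Sum>l<m. X (w l)) / real m)"
  have Y_sq: "(norm (Y w))\<^sup>2 = (\<Sum>l<m. X (w l))\<^sup>2 / (real m)\<^sup>2" for w
    by (simp add: Y_def power_divide)
  have Y: "Y \<in> L2 ?Q"
  proof (rule L2I)
    have "(\<lambda>w. X (w l)) \<in> borel_measurable ?Q" if "l < m" for l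
      by (rule measurable_PiM_coordinate_compose[OF X(1) that])
    then show "Y \<in> borel_measurable ?Q" unfolding Y_def by (intro borel_measurable_divide borel_measurable_sum) auto
    show "integrable ?Q (\<lambda>w. (norm (Y w))\<^sup>2)" unfolding Y_sq using s(1) by (rule integrable_divide)
  qed
  show "integrable ?Q (\<lambda>w. \<bar>(\<Sum>l<m. X (w l)) / real m\<bar>)"
    using Q.expectation_norm_le_L2norm(1)[OF Y] by (simp add: Y_def)
  have "(\<integral>w. \<bar>(\<Sum>l<m. X (w l)) / real m\<bar> \<partial>?Q) \<le> L2norm ?Q Y"
    using Q.expectation_norm_le_L2norm(2)[OF Y] by (simp add: Y_def)
  also have "\<dots> \<le> sqrt (1 / real m)"
  proof -
    have "(\<integral>w. (norm (Y w))\<^sup>2 \<partial>?Q) = (\<integral>w. (\<Sum>l<m. X (w l))\<^sup>2 \<partial>?Q) / (real m)\<^sup>2"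
      unfolding Y_sq by (rule integral_divide_zero)
    also have "\<dots> \<le> real m / (real m)\<^sup>2" using s(2) by (rule divide_right_mono) simp
    also have "\<dots> = 1 / real m" by (simp add: power2_eq_square)
    finally show ?thesis unfolding L2norm_def by (rule real_sqrt_le_mono)
  qed
  finally show "(\<integral>w. \<bar>(\<Sum>l<m. X (w l)) / real m\<bar> \<partial>?Q) \<le> 1 / sqrt (real m)"
    by (simp add: real_sqrt_divide)
qed

lemma retract_ball_law_in_P2:
  assumes "0 \<le> R" "\<mu> \<in> P2"
  shows "retract_ball R \<in> L2 \<mu>" "distr \<mu> borel (retract_ball R) \<in> P2"
proof -
  interpret prob_space \<mu> by (rule P2_prob[OF assms(2)])
  have "retract_ball R \<in> borel_measurable \<mu>"
    using retract_ball_measurable[OF assms(1)] measurable_cong_sets[OF P2_sets[OF assms(2)] refl] by blast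
  then show "retract_ball R \<in> L2 \<mu>" by (rule L2_bounded) (rule retract_ball_in[OF assms(1)])
  then show "distr \<mu> borel (retract_ball R) \<in> P2" by (rule distr_in_P2[OF P2_prob[OF assms(2)]])
qed

text \<open>
  On a ball the law of large numbers holds in the Wasserstein metric at a rate that is the same
  for all measures: it suffices to count the sample points in finitely many small cells.
\<close>
lemma empirical_rate_on_ball:
  fixes R \<epsilon> :: real
  assumes R: "0 \<le> R" and \<epsilon>: "0 < \<epsilon>"
  obtains m where "0 < m"
    "\<And>\<mu> :: 'a::euclidean_space measure. \<mu> \<in> P2 \<Longrightarrow> \<exists>V. integrable (PiM {..<m} (\<lambda>_. \<mu>)) V \<and>
      (\<integral>y. V y \<partial>PiM {..<m} (\<lambda>_. \<mu>)) \<le> \<epsilon> \<and>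
      (\<forall>y. (W2 (empirical m (\<lambda>l. retract_ball R (y l))) (distr \<mu> borel (retract_ball R)))\<^sup>2 \<le> V y)"
proof -
  define \<eta> where "\<eta> = sqrt (\<epsilon> / 2)"
  have \<eta>: "0 < \<eta>" "\<eta>\<^sup>2 = \<epsilon> / 2" using \<epsilon> by (auto simp: \<eta>_def)
  obtain q :: "'a \<Rightarrow> nat" where q: "q \<in> measurable borel (count_space UNIV)"
      "\<And>x y. q x = q y \<Longrightarrow> norm (x - y) \<le> \<eta>" "\<And>R. finite (q ` cball 0 R)"
    by (rule countable_partition_small_diameter[OF \<eta>(1)]) blast
  obtain n where "\<forall>i\<in>q ` cball 0 R. i < n"
    using q(3)[of R] unfolding finite_nat_set_iff_bounded by blast
  then have n: "q x < n" if "norm x \<le> R" for x using that by simp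
  obtain m :: nat where m': "(8 * R\<^sup>2 * real n / \<epsilon>)\<^sup>2 < real m" using reals_Archimedean2 by blast
  have m: "0 < m" using m' by (metis gr0I not_less of_nat_0 zero_le_power2)
  have rate: "4 * R\<^sup>2 * (real n * (1 / sqrt (real m))) \<le> \<epsilon> / 2"
  proof -
    have "8 * R\<^sup>2 * real n / \<epsilon> \<le> sqrt (real m)" using m' by (intro real_le_rsqrt) simp
    then show ?thesis using m \<epsilon> by (simp add: field_simps)
  qed
  have cell: "{x. q x = i} \<in> sets borel" for i
    using measurable_sets[OF q(1), of "{i}"] by (simp add: vimage_def)
  have "\<exists>V. integrable (PiM {..<m} (\<lambda>_. \<mu>)) V \<and> (\<integral>y. V y \<partial>PiM {..<m} (\<lambda>_. \<mu>)) \<le> \<epsilon> \<and>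
      (\<forall>y. (W2 (empirical m (\<lambda>l. retract_ball R (y l))) (distr \<mu> borel (retract_ball R)))\<^sup>2 \<le> V y)"
    if \<mu>: "\<mu> \<in> P2" for \<mu> :: "'a measure"
  proof -
    let ?Q = "PiM {..<m} (\<lambda>_. \<mu>)"
    interpret \<mu>: prob_space \<mu> by (rule P2_prob[OF \<mu>])
    interpret Q: prob_space ?Q using P2_prob[OF \<mu>] by (rule prob_space_PiM)
    note T = L2_measurable[OF retract_ball_law_in_P2(1)[OF R \<mu>]]
    define p where "p = (\<lambda>i. measure (distr \<mu> borel (retract_ball R)) {x. q x = i})"
    define X where "X = (\<lambda>i y. indicator {x. q x = i} (retract_ball R y) - p i)"
    interpret D: prob_space "distr \<mu> borel (retract_ball R)" by (rule \<mu>.prob_space_distr[OF T])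
    have ind: "(\<lambda>y. indicator {x. q x = i} (retract_ball R y) :: real) \<in> borel_measurable \<mu>" for i
      by (rule measurable_compose[OF T borel_measurable_indicator[OF cell]])
    have Xm: "X i \<in> borel_measurable \<mu>" for i
      unfolding X_def by (intro borel_measurable_diff ind) simp
    have p01: "0 \<le> p i" "p i \<le> 1" for i by (auto simp: p_def)
    have Xb: "\<bar>X i y\<bar> \<le> 1" for i y
      using p01[of i] by (auto simp: X_def indicator_def abs_le_iff)
    have indi: "integrable \<mu> (\<lambda>y. indicator {x. q x = i} (retract_ball R y) :: real)" for i
      by (intro \<mu>.integrable_const_bound[where B=1] ind AE_I2) (simp add: indicator_def)
    have Xc: "(\<integral>y. X i y \<partial>\<mu>) = 0" for i
    proof -
      have "(\<integral>y. (indicator {x. q x = i} (retract_ball R y) :: real) \<partial>\<mu>) = (\<integral>x. indicator {x. q x = i} x \<partial>distr \<mu> borel (retract_ball R))"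
        by (rule integral_distr[OF T borel_measurable_indicator[OF cell], symmetric])
      also have "\<dots> = p i" using cell by (simp add: p_def)
      finally show ?thesis using indi unfolding X_def by (subst Bochner_Integration.integral_diff) (auto simp: \<mu>.prob_space)
    qed
    note mean = centred_mean_abs[OF P2_prob[OF \<mu>] Xm Xb Xc m]
    define V where "V = (\<lambda>y. \<eta>\<^sup>2 + 4 * R\<^sup>2 * (\<Sum>i<n. \<bar>(\<Sum>l<m. X i (y l)) / real m\<bar>))"
    have i1: "integrable ?Q (\<lambda>y. \<Sum>i<n. \<bar>(\<Sum>l<m. X i (y l)) / real m\<bar>)"
      by (rule Bochner_Integration.integrable_sum) (rule mean(1))
    have V: "integrable ?Q V" unfolding V_def using i1 by (intro Bochner_Integration.integrable_add integrable_mult_right) auto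
    have "(\<integral>y. V y \<partial>?Q) = \<eta>\<^sup>2 + 4 * R\<^sup>2 * (\<integral>y. (\<Sum>i<n. \<bar>(\<Sum>l<m. X i (y l)) / real m\<bar>) \<partial>?Q)"
      unfolding V_def using i1
      by (subst Bochner_Integration.integral_add) (auto simp: Q.prob_space intro: integrable_mult_right)
    also have "(\<integral>y. (\<Sum>i<n. \<bar>(\<Sum>l<m. X i (y l)) / real m\<bar>) \<partial>?Q) = (\<Sum>i<n. \<integral>y. \<bar>(\<Sum>l<m. X i (y l)) / real m\<bar> \<partial>?Q)"
      by (rule Bochner_Integration.integral_sum) (rule mean(1))
    also have "\<dots> \<le> (\<Sum>i<n. 1 / sqrt (real m))" by (intro sum_mono mean(2))
    finally have "(\<integral>y. V y \<partial>?Q) \<le> \<eta>\<^sup>2 + 4 * R\<^sup>2 * (real n * (1 / sqrt (real m)))"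
      by (simp add: mult_left_mono)
    then have V\<epsilon>: "(\<integral>y. V y \<partial>?Q) \<le> \<epsilon>" using rate \<eta>(2) by linarith
    have "(W2 (empirical m (\<lambda>l. retract_ball R (y l))) (distr \<mu> borel (retract_ball R)))\<^sup>2 \<le> V y" for y
    proof -
      let ?e = "empirical m (\<lambda>l. retract_ball R (y l))"
      have ball: "{x :: 'a. norm x \<le> R} \<in> sets borel"
        using borel_closed[OF closed_cball[of "0 :: 'a" R]] by (simp add: cball_def)
      have s1: "AE x in ?e. norm x \<le> R"
        unfolding empirical_def using ball retract_ball_in[OF R] by (subst AE_distr_iff) auto
      have s2: "AE x in distr \<mu> borel (retract_ball R). norm x \<le> R"
        using ball retract_ball_in[OF R] by (subst AE_distr_iff[OF T]) auto
      have "measure ?e {x. q x = i} = (\<Sum>l<m. indicator {x. q x = i} (retract_ball R (y l))) / real m" for i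
      proof -
        have "measure ?e {x. q x = i} = (\<integral>x. indicator {x. q x = i} x \<partial>?e)"
          using cell by (simp add: empirical_def)
        also have "\<dots> = (\<integral>l. indicator {x. q x = i} (retract_ball R (y l)) \<partial>measure_pmf (pmf_of_set {..<m}))"
          unfolding empirical_def by (rule integral_distr) (auto intro: borel_measurable_indicator[OF cell])
        also have "\<dots> = (\<Sum>l<m. indicator {x. q x = i} (retract_ball R (y l))) / real m"
          using m by (subst integral_pmf_of_set) (auto simp: lessThan_empty_iff)
        finally show ?thesis .
      qed
      then have d: "measure ?e {x. q x = i} - measure (distr \<mu> borel (retract_ball R)) {x. q x = i} = (\<Sum>l<m. X i (y l)) / real m" for i
        using m by (simp add: X_def p_def sum_subtractf diff_divide_distrib)
      show ?thesis
        using W2_le_cell_masses[OF empirical_in_P2[OF m] retract_ball_law_in_P2(2)[OF R \<mu>] s1 s2 q(1,2) n]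
        unfolding d V_def .
    qed
    then show ?thesis using V V\<epsilon> by blast
  qed
  then show ?thesis using that[OF m] by blast
qed

section \<open>Convergence on compact sets\<close>

lemma W2_retract_ball_le:
  fixes \<mu> \<nu> :: "'a::euclidean_space measure"
  assumes R: "0 \<le> R" and P2: "\<mu> \<in> P2" "\<nu> \<in> P2"
  shows "W2 (distr \<mu> borel (retract_ball R)) (distr \<nu> borel (retract_ball R)) \<le> W2 \<mu> \<nu>"
proof (rule field_le_epsilon)
  fix e :: real assume e: "0 < e"
  obtain \<pi> :: "('a \<times> 'a) measure" where \<pi>: "prob_space \<pi>" "sets \<pi> = sets borel"
      "distr \<pi> borel fst = \<mu>" "distr \<pi> borel snd = \<nu>"
      "fst \<in> L2 \<pi>" "snd \<in> L2 \<pi>" "L2norm \<pi> (\<lambda>z. fst z - snd z) < W2 \<mu> \<nu> + e"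
    by (rule W2_coupling[OF P2 e])
  interpret \<pi>: prob_space \<pi> by fact
  note T = retract_ball_measurable[OF R]
  note f = L2_measurable[OF \<pi>(5)] and s = L2_measurable[OF \<pi>(6)]
  have L2: "(\<lambda>z. retract_ball R (fst z)) \<in> L2 \<pi>" "(\<lambda>z. retract_ball R (snd z)) \<in> L2 \<pi>"
    by (intro \<pi>.L2_bounded[where B=R] measurable_compose[OF f T] measurable_compose[OF s T] retract_ball_in[OF R])+
  have "distr \<mu> borel (retract_ball R) = distr \<pi> borel (\<lambda>z. retract_ball R (fst z))"
    "distr \<nu> borel (retract_ball R) = distr \<pi> borel (\<lambda>z. retract_ball R (snd z))"
    unfolding \<pi>(3,4)[symmetric] using distr_distr[OF T f] distr_distr[OF T s] by (simp_all add: comp_def)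
  then have "W2 (distr \<mu> borel (retract_ball R)) (distr \<nu> borel (retract_ball R))
      \<le> L2norm \<pi> (\<lambda>z. retract_ball R (fst z) - retract_ball R (snd z))"
    using W2_le_L2norm[OF \<pi>(1) L2] by simp
  also have "\<dots> \<le> L2norm \<pi> (\<lambda>z. fst z - snd z)"
    unfolding L2norm_def
    by (intro real_sqrt_le_mono integral_mono L2_integrable_sq L2_diff L2 \<pi>(5,6) power_mono retract_ball_lipschitz R) simp
  finally show "W2 (distr \<mu> borel (retract_ball R)) (distr \<nu> borel (retract_ball R)) \<le> W2 \<mu> \<nu> + e"
    using \<pi>(7) by simp
qed

lemma W2_retract_ball_tendsto:
  fixes \<mu> :: "'a::euclidean_space measure"
  assumes \<mu>: "\<mu> \<in> P2"
  shows "(\<lambda>k. W2 (distr \<mu> borel (retract_ball (real k))) \<mu>) \<longlonglongrightarrow> 0"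
proof -
  define g where "g = (\<lambda>k (x :: 'a). (norm (retract_ball (real k) x - x))\<^sup>2)"
  have L2: "(\<lambda>x. retract_ball (real k) x - x) \<in> L2 \<mu>" for k
    by (rule L2_diff[OF retract_ball_law_in_P2(1)[OF _ \<mu>] P2_L2[OF \<mu>]]) simp
  have "(\<lambda>k. \<integral>x. g k x \<partial>\<mu>) \<longlonglongrightarrow> (\<integral>x. 0 \<partial>\<mu>)"
  proof (rule integral_dominated_convergence[where w="\<lambda>x. (norm x)\<^sup>2"])
    show "integrable \<mu> (\<lambda>x. (norm x)\<^sup>2)" by (rule L2_integrable_sq[OF P2_L2[OF \<mu>]])
    show "g k \<in> borel_measurable \<mu>" for k
      unfolding g_def by (rule borel_measurable_integrable[OF L2_integrable_sq[OF L2]])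
    show "AE x in \<mu>. norm (g k x) \<le> (norm x)\<^sup>2" for k
      using retract_ball_dist_le[of "real k"] by (intro AE_I2) (simp add: g_def power_mono norm_minus_commute)
    show "AE x in \<mu>. (\<lambda>k. g k x) \<longlonglongrightarrow> 0"
    proof (rule AE_I2)
      fix x :: 'a
      obtain N :: nat where N: "norm x \<le> real N" using real_arch_simple by blast
      have "eventually (\<lambda>k. g k x = 0) sequentially"
        using eventually_ge_at_top[of N]
        by eventually_elim (use N in \<open>auto simp: g_def retract_ball_id\<close>)
      then show "(\<lambda>k. g k x) \<longlonglongrightarrow> 0" by (rule tendsto_eventually)
    qed
  qed simp
  then have "(\<lambda>k. sqrt (\<integral>x. g k x \<partial>\<mu>)) \<longlonglongrightarrow> sqrt 0" by (intro tendsto_real_sqrt) simp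
  then have lim: "(\<lambda>k. L2norm \<mu> (\<lambda>x. retract_ball (real k) x - x)) \<longlonglongrightarrow> 0"
    by (simp add: L2norm_def g_def)
  have "W2 (distr \<mu> borel (retract_ball (real k))) \<mu> \<le> L2norm \<mu> (\<lambda>x. retract_ball (real k) x - x)" for k
    using W2_le_L2norm[OF P2_prob[OF \<mu>] retract_ball_law_in_P2(1)[OF _ \<mu>] P2_L2[OF \<mu>], of "real k"]
      distr_id2[OF P2_sets[OF \<mu>, symmetric]] by simp
  then show ?thesis
    by (intro tendsto_sandwich[OF _ _ tendsto_const lim]) (auto simp: W2_nonneg)
qed

text \<open>
  A sample is good if its perturbed, projected empirical measure lies within \<open>\<delta>\<close> of \<open>\<mu>\<close>, and then the error
  is at most \<open>e\<close>. For a bad sample the noise or the sampling error accounts for a distance of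
  at least \<open>\<delta> / 4\<close>, so that the error, which is at most \<open>2 R\<close>, is dominated by a multiple of the squared
  distances. The function \<open>V\<close> is an integrable bound for the squared sampling error, whose
  measurability is thereby not an issue.
\<close>
lemma smooth_approx_error:
  fixes u :: "'a::euclidean_space measure \<Rightarrow> real"
  assumes u: "continuous_map W2_topology euclidean u" and R: "0 \<le> R" and m: "0 < m" and \<sigma>: "0 < \<sigma>"
    and \<mu>: "\<mu> \<in> P2" and \<nu>: "\<nu> \<in> P2" and \<delta>: "0 < \<delta>"
    and near: "\<And>\<rho>. \<rho> \<in> P2 \<Longrightarrow> W2 \<mu> \<rho> < \<delta> \<Longrightarrow> \<bar>u \<rho> - u \<mu>\<bar> < e"
    and uR: "\<bar>u \<mu>\<bar> \<le> R" and close: "W2 (distr \<nu> borel (retract_ball R)) \<mu> \<le> \<delta> / 2"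
    and V: "integrable (PiM {..<m} (\<lambda>_. \<nu>)) V"
      "\<And>y. (W2 (empirical m (\<lambda>l. retract_ball R (y l))) (distr \<nu> borel (retract_ball R)))\<^sup>2 \<le> V y"
  shows "\<bar>smooth_approx u R m \<sigma> \<nu> - u \<mu>\<bar>
    \<le> e + 16 * R / \<delta>\<^sup>2 * (real DIM('a) * \<sigma>\<^sup>2 + (\<integral>y. V y \<partial>PiM {..<m} (\<lambda>_. \<nu>)))"
proof -
  let ?N = "gauss_noise \<sigma> m :: (nat \<times> 'a \<Rightarrow> real) measure"
  let ?Q = "PiM {..<m} (\<lambda>_. \<nu>)"
  interpret N: prob_space ?N by (rule prob_space_gauss_noise[OF \<sigma>])
  interpret Q: prob_space ?Q using P2_prob[OF \<nu>] by (rule prob_space_PiM)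
  define A where "A = (\<lambda>z. (\<Sum>l<m. (norm (assemble z l :: 'a))\<^sup>2) / real m)"
  have e0: "0 < e" using near[OF \<mu>] \<delta> by (simp add: W2_self)
  have A0: "0 \<le> A z" for z by (simp add: A_def sum_nonneg)
  have V0: "0 \<le> V y" for y using V(2)[of y] by (rule order_trans[OF zero_le_power2])
  define c where "c = 16 * R / \<delta>\<^sup>2"
  have c0: "0 \<le> c" using R by (simp add: c_def)
  have pw: "\<bar>sample_value u R m (\<lambda>l. y l + assemble z l) - u \<mu>\<bar> \<le> e + c * (A z + V y)" for y z
  proof -
    let ?e = "empirical m (\<lambda>l. retract_ball R (y l + assemble z l))"
    let ?e' = "empirical m (\<lambda>l. retract_ball R (y l))"
    have P: "?e \<in> P2" "?e' \<in> P2" "distr \<nu> borel (retract_ball R) \<in> P2"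
      by (rule empirical_in_P2[OF m] retract_ball_law_in_P2(2)[OF R \<nu>])+
    have eq: "sample_value u R m (\<lambda>l. y l + assemble z l) - u \<mu> = clamp_real R (u ?e) - clamp_real R (u \<mu>)"
      using clamp_real_id[OF uR] by (simp add: sample_value_def)
    show ?thesis
    proof (cases "W2 \<mu> ?e < \<delta>")
      case True
      have "\<bar>sample_value u R m (\<lambda>l. y l + assemble z l) - u \<mu>\<bar> \<le> \<bar>u ?e - u \<mu>\<bar>"
        unfolding eq by (rule clamp_real_lipschitz)
      also have "\<dots> \<le> e" using near[OF P(1) True] by simp
      also have "\<dots> \<le> e + c * (A z + V y)" using c0 A0 V0 by simp
      finally show ?thesis .
    next
      case False
      have "W2 ?e \<mu> \<le> W2 ?e ?e' + W2 ?e' \<mu>" by (rule W2_triangle[OF P(1,2) \<mu>])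
      also have "W2 ?e' \<mu> \<le> W2 ?e' (distr \<nu> borel (retract_ball R)) + W2 (distr \<nu> borel (retract_ball R)) \<mu>"
        by (rule W2_triangle[OF P(2,3) \<mu>])
      also have "W2 ?e ?e' \<le> sqrt (A z)"
        using W2_empirical_retract_le[OF u R m \<sigma>, of "\<lambda>l. y l + assemble z l" y]
        by (simp add: rms_dist_def A_def)
      also have "W2 ?e' (distr \<nu> borel (retract_ball R)) \<le> sqrt (V y)"
        using V(2)[of y] by (rule real_le_rsqrt)
      finally have "\<delta> / 2 \<le> sqrt (A z) + sqrt (V y)"
        using False close by (simp add: W2_commute)
      then have "(\<delta> / 2)\<^sup>2 \<le> (sqrt (A z) + sqrt (V y))\<^sup>2" using \<delta> by (intro power_mono) auto
      also have "\<dots> \<le> 2 * A z + 2 * V y"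
        using norm_add_sq_le_weighted[of 1 "sqrt (A z)" "sqrt (V y)"] A0 V0 by simp
      finally have "1 \<le> 8 * (A z + V y) / \<delta>\<^sup>2" using \<delta> by (simp add: field_simps power2_eq_square)
      then have "2 * R * 1 \<le> 2 * R * (8 * (A z + V y) / \<delta>\<^sup>2)" using R by (intro mult_left_mono) auto
      also have "\<dots> = c * (A z + V y)" by (simp add: c_def)
      finally have "2 * R \<le> c * (A z + V y)" by simp
      moreover have "\<bar>sample_value u R m (\<lambda>l. y l + assemble z l) - u \<mu>\<bar> \<le> 2 * R"
        using sample_value_bounded[OF u R m \<sigma>, of "\<lambda>l. y l + assemble z l"] uR by linarith
      ultimately show ?thesis using e0 by linarith
    qed
  qed
  have Ai: "integrable ?N A" and AI: "(\<integral>z. A z \<partial>?N) = real DIM('a) * \<sigma>\<^sup>2"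
  proof -
    note g = gauss_noise_second_moment[OF \<sigma>, of _ m, where 'v='a]
    show "integrable ?N A"
      unfolding A_def by (intro integrable_divide Bochner_Integration.integrable_sum g(1)) simp
    have "(\<integral>z. A z \<partial>?N) = (\<Sum>l<m. \<integral>z. (norm (assemble z l :: 'a))\<^sup>2 \<partial>?N) / real m"
      unfolding A_def by (subst integral_divide_zero, subst Bochner_Integration.integral_sum) (auto intro: g(1))
    also have "\<dots> = real DIM('a) * \<sigma>\<^sup>2" using g(2) m by simp
    finally show "(\<integral>z. A z \<partial>?N) = real DIM('a) * \<sigma>\<^sup>2" .
  qed
  let ?f = "smoothed_sample_value u R m \<sigma>"
  have f: "\<bar>?f y - u \<mu>\<bar> \<le> e + c * (real DIM('a) * \<sigma>\<^sup>2 + V y)" for y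
  proof -
    note i = sample_value_shift_integrable[OF u R m \<sigma>, of y]
    have "?f y - u \<mu> = (\<integral>z. sample_value u R m (\<lambda>l. y l + assemble z l) - u \<mu> \<partial>?N)"
      unfolding smoothed_sample_value_def using i by (simp add: N.prob_space)
    also have "\<bar>\<dots>\<bar> \<le> (\<integral>z. e + c * (A z + V y) \<partial>?N)"
      by (rule order_trans[OF integral_abs_bound integral_mono])
        (use i Ai pw in \<open>auto intro!: integrable_abs Bochner_Integration.integrable_diff\<close>)
    also have "\<dots> = e + c * (real DIM('a) * \<sigma>\<^sup>2 + V y)"
      using Ai AI by (simp add: N.prob_space)
    finally show ?thesis .
  qed
  have fi: "integrable ?Q ?f"
    using kernel_integrable_P2[OF smooth_kernel_continuous[OF smoothed_sample_value_smooth[OF u R m \<sigma>]]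
        smoothed_sample_value_bounded[OF u R m \<sigma>] \<nu>, of "\<lambda>_. None"] by (simp add: slot_def[abs_def])
  have "smooth_approx u R m \<sigma> \<nu> - u \<mu> = (\<integral>y. ?f y - u \<mu> \<partial>?Q)"
    unfolding smooth_approx_def using fi by (simp add: Q.prob_space)
  also have "\<bar>\<dots>\<bar> \<le> (\<integral>y. e + c * (real DIM('a) * \<sigma>\<^sup>2 + V y) \<partial>?Q)"
    by (rule order_trans[OF integral_abs_bound integral_mono])
      (use fi V(1) f in \<open>auto intro!: integrable_abs Bochner_Integration.integrable_diff\<close>)
  also have "\<dots> = e + c * (real DIM('a) * \<sigma>\<^sup>2 + (\<integral>y. V y \<partial>?Q))"
    using V(1) by (simp add: Q.prob_space)
  finally show ?thesis by (simp add: c_def)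
qed

text \<open>
  With truncation level \<open>k\<close>, noise of variance \<open>(\<sigma> k)\<^sup>2\<close> and a sample size that brings the squared sampling
  error below \<open>(\<sigma> k)\<^sup>2\<close>, the contribution of the bad samples is of order \<open>k * (\<sigma> k)\<^sup>2\<close>, which tends to 0.
\<close>
lemma exists_smooth_approx:
  fixes u :: "'a::euclidean_space measure \<Rightarrow> real"
  assumes \<Omega>: "prob_space \<Omega>" and u: "continuous_map W2_topology euclidean u"
  obtains v :: "nat \<Rightarrow> 'a measure \<Rightarrow> real" where "\<And>k. v k \<in> C_infinity \<Omega>"
    "\<And>\<mu> e. \<mu> \<in> P2 \<Longrightarrow> 0 < e \<Longrightarrow> \<exists>r>0. \<exists>N. \<forall>k\<ge>N. \<forall>\<nu>\<in>P2. W2 \<mu> \<nu> < r \<longrightarrow> \<bar>v k \<nu> - u \<nu>\<bar> \<le> e"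
    "\<And>w k. modulus_of_continuity w \<Longrightarrow> has_modulus w u \<Longrightarrow> has_modulus w (v k)"
proof -
  define \<sigma> where "\<sigma> = (\<lambda>k. 1 / real (Suc k))"
  have \<sigma>: "0 < \<sigma> k" for k by (simp add: \<sigma>_def)
  have "\<exists>m>0. \<forall>\<mu> \<in> (P2 :: 'a measure set). \<exists>V. integrable (PiM {..<m} (\<lambda>_. \<mu>)) V \<and>
      (\<integral>y. V y \<partial>PiM {..<m} (\<lambda>_. \<mu>)) \<le> (\<sigma> k)\<^sup>2 \<and>
      (\<forall>y. (W2 (empirical m (\<lambda>l. retract_ball (real k) (y l))) (distr \<mu> borel (retract_ball (real k))))\<^sup>2 \<le> V y)" for k
    using empirical_rate_on_ball[of "real k" "(\<sigma> k)\<^sup>2"] \<sigma>[of k] by (metis of_nat_0_le_iff zero_less_power)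
  then obtain m where m: "\<And>k. 0 < m k" and rate: "\<And>k \<mu> :: 'a measure. \<mu> \<in> P2 \<Longrightarrow> \<exists>V. integrable (PiM {..<m k} (\<lambda>_. \<mu>)) V \<and>
      (\<integral>y. V y \<partial>PiM {..<m k} (\<lambda>_. \<mu>)) \<le> (\<sigma> k)\<^sup>2 \<and>
      (\<forall>y. (W2 (empirical (m k) (\<lambda>l. retract_ball (real k) (y l))) (distr \<mu> borel (retract_ball (real k))))\<^sup>2 \<le> V y)"
    by metis
  define v where "v = (\<lambda>k. smooth_approx u (real k) (m k) (\<sigma> k))"
  show ?thesis
  proof
    show "v k \<in> C_infinity \<Omega>" for k
      unfolding v_def by (rule smooth_approx_in_C_infinity[OF u _ m \<sigma> \<Omega>]) simp
    show "has_modulus w (v k)" if "modulus_of_continuity w" "has_modulus w u" for w k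
      unfolding v_def by (rule smooth_approx_modulus[OF u _ m \<sigma> that]) simp
    fix \<mu> :: "'a measure" and e :: real assume \<mu>: "\<mu> \<in> P2" and e: "0 < e"
    have e4: "0 < e / 4" using e by simp
    obtain \<delta> where \<delta>: "0 < \<delta>" "\<And>\<nu>. \<nu> \<in> P2 \<Longrightarrow> W2 \<mu> \<nu> < \<delta> \<Longrightarrow> \<bar>u \<nu> - u \<mu>\<bar> < e / 4"
      by (rule W2_continuousD[OF u \<mu> e4]) blast
    have "eventually (\<lambda>k. W2 (distr \<mu> borel (retract_ball (real k))) \<mu> < \<delta> / 4) sequentially"
      using order_tendstoD(2)[OF W2_retract_ball_tendsto[OF \<mu>], of "\<delta> / 4"] \<delta>(1) by simp
    moreover have "eventually (\<lambda>k. 16 * (real DIM('a) + 1) / \<delta>\<^sup>2 * \<sigma> k < e / 4) sequentially"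
    proof -
      have "(\<lambda>k. 16 * (real DIM('a) + 1) / \<delta>\<^sup>2 * \<sigma> k) \<longlonglongrightarrow> 16 * (real DIM('a) + 1) / \<delta>\<^sup>2 * 0"
        unfolding \<sigma>_def using LIMSEQ_inverse_real_of_nat by (intro tendsto_mult tendsto_const) (simp add: inverse_eq_divide)
      then show ?thesis using e4 by (intro order_tendstoD(2)) auto
    qed
    moreover have "eventually (\<lambda>k. \<bar>u \<mu>\<bar> \<le> real k) sequentially"
    proof -
      obtain N :: nat where N: "\<bar>u \<mu>\<bar> \<le> real N" using real_arch_simple by blast
      show ?thesis using eventually_ge_at_top[of N] by eventually_elim (use N in simp)
    qed
    ultimately have "eventually (\<lambda>k. W2 (distr \<mu> borel (retract_ball (real k))) \<mu> < \<delta> / 4 \<and>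
        16 * (real DIM('a) + 1) / \<delta>\<^sup>2 * \<sigma> k < e / 4 \<and> \<bar>u \<mu>\<bar> \<le> real k) sequentially"
      by eventually_elim auto
    then obtain N where N: "\<And>k. N \<le> k \<Longrightarrow> W2 (distr \<mu> borel (retract_ball (real k))) \<mu> < \<delta> / 4 \<and>
        16 * (real DIM('a) + 1) / \<delta>\<^sup>2 * \<sigma> k < e / 4 \<and> \<bar>u \<mu>\<bar> \<le> real k"
      unfolding eventually_sequentially by blast
    show "\<exists>r>0. \<exists>N. \<forall>k\<ge>N. \<forall>\<nu>\<in>P2. W2 \<mu> \<nu> < r \<longrightarrow> \<bar>v k \<nu> - u \<nu>\<bar> \<le> e"
    proof (rule exI[of _ "\<delta> / 4"], rule conjI, use \<delta>(1) in simp, rule exI[of _ N], intro allI impI ballI)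
      fix k and \<nu> :: "'a measure" assume k: "N \<le> k" and \<nu>: "\<nu> \<in> P2" and close: "W2 \<mu> \<nu> < \<delta> / 4"
      note Nk = N[OF k]
      have k0: "0 \<le> real k" by simp
      obtain V where V: "integrable (PiM {..<m k} (\<lambda>_. \<nu>)) V"
        "(\<integral>y. V y \<partial>PiM {..<m k} (\<lambda>_. \<nu>)) \<le> (\<sigma> k)\<^sup>2"
        "\<And>y. (W2 (empirical (m k) (\<lambda>l. retract_ball (real k) (y l))) (distr \<nu> borel (retract_ball (real k))))\<^sup>2 \<le> V y"
        using rate[OF \<nu>, of k] by blast
      have "W2 (distr \<nu> borel (retract_ball (real k))) \<mu>
          \<le> W2 (distr \<nu> borel (retract_ball (real k))) (distr \<mu> borel (retract_ball (real k))) + W2 (distr \<mu> borel (retract_ball (real k))) \<mu>"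
        by (rule W2_triangle[OF retract_ball_law_in_P2(2)[OF k0 \<nu>] retract_ball_law_in_P2(2)[OF k0 \<mu>] \<mu>])
      also have "\<dots> \<le> \<delta> / 4 + \<delta> / 4"
        using W2_retract_ball_le[OF k0 \<nu> \<mu>] W2_commute[of \<mu> \<nu>] close Nk by linarith
      finally have "W2 (distr \<nu> borel (retract_ball (real k))) \<mu> \<le> \<delta> / 2" by simp
      then have "\<bar>v k \<nu> - u \<mu>\<bar> \<le> e / 4 + 16 * real k / \<delta>\<^sup>2 * (real DIM('a) * (\<sigma> k)\<^sup>2 + (\<integral>y. V y \<partial>PiM {..<m k} (\<lambda>_. \<nu>)))"
        unfolding v_def using Nk by (intro smooth_approx_error[OF u k0 m \<sigma> \<mu> \<nu> \<delta> _ _ V(1,3)]) auto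
      also have "\<dots> \<le> e / 4 + 16 * real k / \<delta>\<^sup>2 * (real DIM('a) * (\<sigma> k)\<^sup>2 + (\<sigma> k)\<^sup>2)"
        using V(2) by (intro add_left_mono mult_left_mono) auto
      also have "16 * real k / \<delta>\<^sup>2 * (real DIM('a) * (\<sigma> k)\<^sup>2 + (\<sigma> k)\<^sup>2) = 16 * (real DIM('a) + 1) / \<delta>\<^sup>2 * \<sigma> k * (real k * \<sigma> k)"
        by (simp add: power2_eq_square algebra_simps add_divide_distrib)
      also have "\<dots> \<le> 16 * (real DIM('a) + 1) / \<delta>\<^sup>2 * \<sigma> k * 1"
        using \<sigma>[of k] by (intro mult_left_mono) (auto simp: \<sigma>_def)
      finally have "\<bar>v k \<nu> - u \<mu>\<bar> \<le> e / 4 + e / 4" using Nk by linarith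
      moreover have "\<bar>u \<nu> - u \<mu>\<bar> < e / 4" using close \<delta>(1) by (intro \<delta>(2)[OF \<nu>]) simp
      ultimately show "\<bar>v k \<nu> - u \<nu>\<bar> \<le> e" using e by linarith
    qed
  qed
qed

lemma locally_uniform_imp_uniform_on_compact:
  fixes v :: "nat \<Rightarrow> 'a::euclidean_space measure \<Rightarrow> real"
  assumes loc: "\<And>\<mu> e. \<mu> \<in> P2 \<Longrightarrow> 0 < e \<Longrightarrow> \<exists>r>0. \<exists>N. \<forall>k\<ge>N. \<forall>\<nu>\<in>P2. W2 \<mu> \<nu> < r \<longrightarrow> \<bar>v k \<nu> - u \<nu>\<bar> \<le> e"
    and K: "compactin W2_topology K"
  shows "(\<lambda>k. SUP \<mu>\<in>K. ennreal \<bar>v k \<mu> - u \<mu>\<bar>) \<longlonglongrightarrow> 0"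
proof (rule order_tendstoI)
  fix a :: ennreal assume "0 < a"
  then obtain b where b: "0 < b" "b < a" using dense by blast
  obtain e where e: "0 < e" "b = ennreal e"
  proof (cases b rule: ennreal_cases)
    case (real e)
    then show ?thesis using b(1) that by simp
  next
    case top
    then show ?thesis using b(2) by simp
  qed
  have KP: "K \<subseteq> P2" using compactin_subset_topspace[OF K] by (simp add: W2.topspace_mtopology)
  have "\<forall>\<mu>\<in>K. \<exists>p. 0 < fst p \<and> (\<forall>k\<ge>snd p. \<forall>\<nu>\<in>P2. W2 \<mu> \<nu> < fst p \<longrightarrow> \<bar>v k \<nu> - u \<nu>\<bar> \<le> e)"
  proof
    fix \<mu> assume "\<mu> \<in> K"
    then obtain r N where "0 < r" "\<forall>k\<ge>N. \<forall>\<nu>\<in>P2. W2 \<mu> \<nu> < r \<longrightarrow> \<bar>v k \<nu> - u \<nu>\<bar> \<le> e"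
      using loc[OF _ e(1)] KP by blast
    then show "\<exists>p. 0 < fst p \<and> (\<forall>k\<ge>snd p. \<forall>\<nu>\<in>P2. W2 \<mu> \<nu> < fst p \<longrightarrow> \<bar>v k \<nu> - u \<nu>\<bar> \<le> e)"
      by (intro exI[of _ "(r, N)"]) simp
  qed
  from bchoice[OF this] obtain p where p: "\<forall>\<mu>\<in>K. 0 < fst (p \<mu>) \<and> (\<forall>k\<ge>snd (p \<mu>). \<forall>\<nu>\<in>P2. W2 \<mu> \<nu> < fst (p \<mu>) \<longrightarrow> \<bar>v k \<nu> - u \<nu>\<bar> \<le> e)"
    by blast
  define r where "r = (\<lambda>\<mu>. fst (p \<mu>))"
  define N where "N = (\<lambda>\<mu>. snd (p \<mu>))"
  have rN: "0 < r \<mu>" "N \<mu> \<le> k \<Longrightarrow> \<nu> \<in> P2 \<Longrightarrow> W2 \<mu> \<nu> < r \<mu> \<Longrightarrow> \<bar>v k \<nu> - u \<nu>\<bar> \<le> e"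
    if "\<mu> \<in> K" for \<mu> k \<nu>
    using bspec[OF p that] by (auto simp: r_def N_def)
  have cover: "K \<subseteq> \<Union> ((\<lambda>\<mu>. W2.mball \<mu> (r \<mu>)) ` K)"
  proof
    fix \<mu> assume "\<mu> \<in> K"
    then have "\<mu> \<in> W2.mball \<mu> (r \<mu>)" using rN(1) KP by (auto simp: W2.centre_in_mball_iff)
    then show "\<mu> \<in> \<Union> ((\<lambda>\<mu>. W2.mball \<mu> (r \<mu>)) ` K)" using \<open>\<mu> \<in> K\<close> by blast
  qed
  have "openin W2_topology U" if "U \<in> (\<lambda>\<mu>. W2.mball \<mu> (r \<mu>)) ` K" for U
    using that by (rule imageE) (simp add: W2.openin_mball)
  from compactinD[OF K this cover] obtain F
    where F: "finite F" "F \<subseteq> (\<lambda>\<mu>. W2.mball \<mu> (r \<mu>)) ` K" "K \<subseteq> \<Union> F" by blast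
  obtain K' where K': "K' \<subseteq> K" "finite K'" "F = (\<lambda>\<mu>. W2.mball \<mu> (r \<mu>)) ` K'"
    using finite_subset_image[OF F(1,2)] by blast
  define N0 where "N0 = (\<Sum>\<mu>\<in>K'. N \<mu>)"
  have le: "(SUP \<mu>\<in>K. ennreal \<bar>v k \<mu> - u \<mu>\<bar>) \<le> ennreal e" if k: "N0 \<le> k" for k
  proof (rule SUP_least)
    fix \<nu> assume "\<nu> \<in> K"
    then obtain \<mu> where \<mu>: "\<mu> \<in> K'" "\<nu> \<in> W2.mball \<mu> (r \<mu>)" using F(3) K'(3) by blast
    have "N \<mu> \<le> N0" unfolding N0_def using \<mu>(1) K'(2) by (intro member_le_sum) auto
    then show "ennreal \<bar>v k \<nu> - u \<nu>\<bar> \<le> ennreal e"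
      using rN(2)[of \<mu> k \<nu>] \<mu> K'(1) k by (intro ennreal_leI) (auto simp: W2.in_mball)
  qed
  show "eventually (\<lambda>k. (SUP \<mu>\<in>K. ennreal \<bar>v k \<mu> - u \<mu>\<bar>) < a) sequentially"
    using eventually_ge_at_top[of N0]
  proof eventually_elim
    case (elim k)
    show ?case by (rule le_less_trans[OF le[OF elim] b(2)[unfolded e(2)]])
  qed
qed simp

theorem theorem4p2:
  fixes \<Omega> :: "'w measure"
    and u :: "(real ^ 'd) measure \<Rightarrow> real"
  assumes "prob_space \<Omega>"
    and "\<exists>U \<in> borel_measurable \<Omega>. distr \<Omega> borel U = uniform_measure lborel {0..1::real}"
    and "continuous_map W2_topology euclidean u"
  shows "\<exists>u_seq :: nat \<Rightarrow> (real ^ 'd) measure \<Rightarrow> real.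
           (\<forall>k. u_seq k \<in> C_infinity \<Omega>) \<and>
           (\<forall>K. compactin W2_topology K \<longrightarrow>
              (\<lambda>k. SUP \<mu>\<in>K. ennreal \<bar>u_seq k \<mu> - u \<mu>\<bar>) \<longlonglongrightarrow> 0) \<and>
           (\<forall>w. modulus_of_continuity w \<and> has_modulus w u \<longrightarrow>
              (\<forall>k. has_modulus w (u_seq k)))"
proof -
  obtain v :: "nat \<Rightarrow> (real ^ 'd) measure \<Rightarrow> real" where v: "\<And>k. v k \<in> C_infinity \<Omega>"
    "\<And>\<mu> e. \<mu> \<in> P2 \<Longrightarrow> 0 < e \<Longrightarrow> \<exists>r>0. \<exists>N. \<forall>k\<ge>N. \<forall>\<nu>\<in>P2. W2 \<mu> \<nu> < r \<longrightarrow> \<bar>v k \<nu> - u \<nu>\<bar> \<le> e"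
    "\<And>w k. modulus_of_continuity w \<Longrightarrow> has_modulus w u \<Longrightarrow> has_modulus w (v k)"
    by (rule exists_smooth_approx[OF assms(1,3)]) blast
  show ?thesis
    using v(1,3) locally_uniform_imp_uniform_on_compact[OF v(2)] by (intro exI[of _ v]) blast
qed

end
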